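(* Let $G$ be a group such that the graded Lie algebra $\mathrm{gr}_\Gamma(G)$ has trivial center. Then the Johnson homomorphism $J\colon\mathrm{gr}_F(\mathcal{T}_G)\to\mathrm{Der}(\mathrm{gr}_\Gamma(G))$ induces a monomorphism of graded Lie algebras $$\widetilde{J}\colon\mathrm{gr}_{\widetilde F}(\widetilde{\mathcal{T}}_G)\to\widetilde{\mathrm{Der}}(\mathrm{gr}_\Gamma(G))$$ (that is, one with $\widetilde{J}\circ\bar\pi=q\circ J$), and $\widetilde J$ is equivariant with respect to the natural actions of $\mathcal{A}(G)$ on source and target.
   Context: For a group $G$, $(x,y)=xyx^{-1}y^{-1}$, $\Gamma^1(G)=G$, $\Gamma^{s+1}(G)=(\Gamma^s(G),G)$, and $\mathrm{gr}_\Gamma(G)=\bigoplus_{s\ge1}\Gamma^s(G)/\Gamma^{s+1}(G)$ is the associated graded Lie algebra (over $\mathbb{Z}$), with bracket induced by the commutator. The Johnson filtration on $\mathrm{Aut}(G)$ (product = composition) is $F^s=\{\alpha\mid\alpha(x)x^{-1}\in\Gamma^{s+1}(G)\ \forall x\in G\}$, $s\ge0$; $(F^s,F^t)\subseteq F^{s+t}$. The Torelli group is $\mathcal{T}_G=F^1$, and $\mathrm{gr}_F(\mathcal{T}_G)=\bigoplus_{s\ge1}F^s/F^{s+1}$ is a graded Lie algebra. Let $\pi\colon\mathrm{Aut}(G)\to\mathrm{Out}(G)=\mathrm{Aut}(G)/\mathrm{Inn}(G)$ be the projection, $\widetilde F^s=\pi(F^s)$, $\widetilde{\mathcal{T}}_G=\widetilde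 F^1$, $\mathrm{gr}_{\widetilde F}(\widetilde{\mathcal{T}}_G)=\bigoplus_{s\ge1}\widetilde F^s/\widetilde F^{s+1}$, and $\bar\pi\colon\mathrm{gr}_F(\mathcal{T}_G)\to\mathrm{gr}_{\widetilde F}(\widetilde{\mathcal{T}}_G)$ the induced epimorphism. For a graded Lie algebra $\mathfrak{g}$, $\mathrm{Der}(\mathfrak{g})=\bigoplus_{s\ge1}\mathrm{Der}^s(\mathfrak{g})$, with $\mathrm{Der}^s(\mathfrak{g})$ the linear derivations raising degree by $s$, and commutator bracket; $\widetilde{\mathrm{Der}}(\mathfrak{g})=\mathrm{Der}(\mathfrak{g})/\mathrm{im}(\mathrm{ad}\colon\mathfrak{g}\to\mathrm{Der}(\mathfrak{g}))$, and $q\colon\mathrm{Der}(\mathfrak{g})\to\widetilde{\mathrm{Der}}(\mathfrak{g})$ is the projection. The Johnson homomorphism is the (well-defined, injective) morphism of graded Lie algebras $J(\bar\alpha)(\bar x)=\overline{\alpha(x)x^{-1}}\in\mathrm{gr}_\Gamma^{s+t}(G)$ for $\alpha\in F^s$, $x\in\Gamma^t(G)$. $\mathcal{A}(G)=F^0/F^1=\mathrm{im}(\mathrm{Aut}(G)\to\mathrm{Aut}(G_{\mathrm{ab}}))$. For $\bar\sigma\in\mathcal{A}(G)$ represented by $\sigma\in\mathrm{Aut}(G)$: $\bar\sigma$ acts on $\mathrm{gr}_F(\mathcal{T}_G)$ by $\bar\sigma\cdot\bar\alpha=\overline{\sigma\alpha\sigma^{-1}}$, and on $\mathrm{gr}_{\widetilde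 F}(\widetilde{\mathcal{T}}_G)$ by conjugation by $\pi(\sigma)$; on $\mathrm{gr}_\Gamma(G)$ by $\bar\sigma\cdot\bar x=\overline{\sigma(x)}$; on $\mathrm{Der}(\mathrm{gr}_\Gamma(G))$ by $\bar\sigma\cdot\delta=\bar\sigma\delta\bar\sigma^{-1}$; and on $\widetilde{\mathrm{Der}}(\mathrm{gr}_\Gamma(G))$ by the induced action on the quotient. These are well-defined actions by graded Lie algebra automorphisms. *)

theory Defs
  imports "HOL-Algebra.Algebra"
begin

section \<open>Graded Lie algebras over the integers\<close>

text \<open>
  The underlying abelian group is written multiplicatively, since quotients (\<^const>\<open>FactGroup\<close>)
  and direct sums (\<^const>\<open>sum_group\<close>) of groups are monoid records in HOL-Algebra: addition is
  \<open>\<otimes>\<close>, zero is \<open>\<one>\<close> and negation is \<open>inv\<close>. A \<open>\<int>\<close>-module is the same thing as an abelian group.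
  Degrees start at 1; the value of \<open>component\<close> at 0 plays no role.
\<close>

record 'a graded_lie = "'a monoid" +
  bracket :: "'a \<Rightarrow> 'a \<Rightarrow> 'a"
  component :: "nat \<Rightarrow> 'a set"

locale graded_lie_algebra = comm_group L for L :: "('a, 'm) graded_lie_scheme" (structure) +
  assumes bracket_closed:
      "\<lbrakk>x \<in> carrier L; y \<in> carrier L\<rbrakk> \<Longrightarrow> bracket L x y \<in> carrier L"
    and bracket_add_left:
      "\<lbrakk>x \<in> carrier L; y \<in> carrier L; z \<in> carrier L\<rbrakk>
        \<Longrightarrow> bracket L (x \<otimes> y) z = bracket L x z \<otimes> bracket L y z"
    and bracket_add_right:
      "\<lbrakk>x \<in> carrier L; y \<in> carrier L; z \<in> carrier L\<rbrakk>
        \<Longrightarrow> bracket L x (y \<otimes> z) = bracket L x y \<otimes> bracket L x z"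
    and bracket_alternating: "x \<in> carrier L \<Longrightarrow> bracket L x x = \<one>"
    and jacobi:
      "\<lbrakk>x \<in> carrier L; y \<in> carrier L; z \<in> carrier L\<rbrakk>
        \<Longrightarrow> bracket L x (bracket L y z) \<otimes> bracket L y (bracket L z x)
              \<otimes> bracket L z (bracket L x y) = \<one>"
    and component_subgroup: "1 \<le> s \<Longrightarrow> subgroup (component L s) L"
    and component_bracket:
      "\<lbrakk>1 \<le> s; 1 \<le> t; x \<in> component L s; y \<in> component L t\<rbrakk>
        \<Longrightarrow> bracket L x y \<in> component L (s + t)"
    and direct_sum:
      "(\<lambda>f. gfinprod L f {1..}) \<in> iso (sum_group {1..} (\<lambda>s. L\<lparr>carrier := component L s\<rparr>)) L"

locale graded_lie_algebra_hom =
  L: graded_lie_algebra L + M: graded_lie_algebra M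
  for L :: "('a, 'm) graded_lie_scheme" (structure) and M :: "('b, 'n) graded_lie_scheme" (structure) +
  fixes h
  assumes hom: "h \<in> hom L M"
    and hom_bracket:
      "\<lbrakk>x \<in> carrier L; y \<in> carrier L\<rbrakk> \<Longrightarrow> h (bracket L x y) = bracket M (h x) (h y)"
    and hom_component: "\<lbrakk>1 \<le> s; x \<in> component L s\<rbrakk> \<Longrightarrow> h x \<in> component M s"

definition lie_center :: "('a, 'm) graded_lie_scheme \<Rightarrow> 'a set" where
  "lie_center L = {x \<in> carrier L. \<forall>y\<in>carrier L. bracket L x y = \<one>\<^bsub>L\<^esub>}"

text \<open>
  The external direct sum of abelian groups \<open>A s\<close>, \<open>s \<ge> 1\<close>, with the bilinear extension of
  brackets \<open>b s t\<close> from \<open>A s\<close> and \<open>A t\<close> to \<open>A (s + t)\<close>.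
\<close>

definition graded_sum ::
    "(nat \<Rightarrow> ('a, 'm) monoid_scheme) \<Rightarrow> (nat \<Rightarrow> nat \<Rightarrow> 'a \<Rightarrow> 'a \<Rightarrow> 'a) \<Rightarrow> (nat \<Rightarrow> 'a) graded_lie" where
  "graded_sum A b =
    \<lparr>carrier = carrier (sum_group {1..} A),
     monoid.mult = monoid.mult (sum_group {1..} A),
     one = one (sum_group {1..} A),
     bracket = (\<lambda>x y. \<lambda>n\<in>{1..}. finprod (A n) (\<lambda>s. b s (n - s) (x s) (y (n - s))) {1..<n}),
     component = (\<lambda>s. {x \<in> carrier (sum_group {1..} A). \<forall>t\<ge>1. t \<noteq> s \<longrightarrow> x t = \<one>\<^bsub>A t\<^esub>})\<rparr>"

text \<open>As for ideals in \<^theory>\<open>HOL-Algebra.QuotRing\<close>, operations on cosets are unions over representatives.\<close>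

definition quotient_lie :: "('a, 'm) graded_lie_scheme \<Rightarrow> 'a set \<Rightarrow> 'a set graded_lie" where
  "quotient_lie L I =
    \<lparr>carrier = carrier (L Mod I),
     monoid.mult = monoid.mult (L Mod I),
     one = one (L Mod I),
     bracket = (\<lambda>U V. \<Union>x\<in>U. \<Union>y\<in>V. I #>\<^bsub>L\<^esub> bracket L x y),
     component = (\<lambda>s. (\<lambda>x. I #>\<^bsub>L\<^esub> x) ` component L s)\<rparr>"

subsection \<open>Derivations\<close>

definition derivations :: "('a, 'm) graded_lie_scheme \<Rightarrow> nat \<Rightarrow> ('a \<Rightarrow> 'a) set" where
  "derivations L s =
    {\<delta> \<in> hom L L \<inter> extensional (carrier L).
      (\<forall>x\<in>carrier L. \<forall>y\<in>carrier L.
        \<delta> (bracket L x y) = bracket L (\<delta> x) y \<otimes>\<^bsub>L\<^esub> bracket L x (\<delta> y)) \<and>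
      (\<forall>t\<ge>1. \<delta> ` component L t \<subseteq> component L (s + t))}"

text \<open>
  \<open>Der L\<close> is the sum of the groups \<open>derivations L s\<close>, \<open>s \<ge> 1\<close>, inside the group of all
  (extensional) self-maps of \<open>L\<close> under pointwise addition. The sum is direct, because homogeneous
  maps of distinct degrees send a homogeneous element to distinct components.
\<close>

definition Der :: "('a, 'm) graded_lie_scheme \<Rightarrow> ('a \<Rightarrow> 'a) graded_lie" where
  "Der L =
    (let D = subgroup_generated (product_group (carrier L) (\<lambda>_. L)) (\<Union>s\<in>{1..}. derivations L s) in
      \<lparr>carrier = carrier D,
       monoid.mult = monoid.mult D,
       one = one D,
       bracket = (\<lambda>\<delta> \<epsilon>. \<lambda>x\<in>carrier L. \<delta> (\<epsilon> x) \<otimes>\<^bsub>L\<^esub> inv\<^bsub>L\<^esub> (\<epsilon> (\<delta> x))),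
       component = derivations L\<rparr>)"

definition ad :: "('a, 'm) graded_lie_scheme \<Rightarrow> 'a \<Rightarrow> 'a \<Rightarrow> 'a" where
  "ad L x = (\<lambda>y\<in>carrier L. bracket L x y)"

definition outer_Der :: "('a, 'm) graded_lie_scheme \<Rightarrow> ('a \<Rightarrow> 'a) set graded_lie" where
  "outer_Der L = quotient_lie (Der L) (ad L ` carrier L)"

definition outer_Der_proj :: "('a, 'm) graded_lie_scheme \<Rightarrow> ('a \<Rightarrow> 'a) \<Rightarrow> ('a \<Rightarrow> 'a) set" where
  "outer_Der_proj L \<delta> = (ad L ` carrier L) #>\<^bsub>Der L\<^esub> \<delta>"

section \<open>Filtered groups\<close>

definition commutator :: "('a, 'm) monoid_scheme \<Rightarrow> 'a \<Rightarrow> 'a \<Rightarrow> 'a" where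
  "commutator G x y = x \<otimes>\<^bsub>G\<^esub> y \<otimes>\<^bsub>G\<^esub> inv\<^bsub>G\<^esub> x \<otimes>\<^bsub>G\<^esub> inv\<^bsub>G\<^esub> y"

text \<open>The lower central series is indexed from 1; the value at 0 is a dummy.\<close>

fun lower_central :: "('a, 'm) monoid_scheme \<Rightarrow> nat \<Rightarrow> 'a set" where
  "lower_central G 0 = carrier G"
| "lower_central G (Suc 0) = carrier G"
| "lower_central G (Suc (Suc s)) =
    generate G {commutator G x y | x y. x \<in> lower_central G (Suc s) \<and> y \<in> carrier G}"

definition gr_degree :: "('a, 'm) monoid_scheme \<Rightarrow> (nat \<Rightarrow> 'a set) \<Rightarrow> nat \<Rightarrow> 'a set monoid" where
  "gr_degree G \<Phi> s = (G\<lparr>carrier := \<Phi> s\<rparr>) Mod \<Phi> (Suc s)"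

definition gr :: "('a, 'm) monoid_scheme \<Rightarrow> (nat \<Rightarrow> 'a set) \<Rightarrow> (nat \<Rightarrow> 'a set) graded_lie" where
  "gr G \<Phi> = graded_sum (gr_degree G \<Phi>)
    (\<lambda>s t U V. \<Union>x\<in>U. \<Union>y\<in>V. \<Phi> (Suc (s + t)) #>\<^bsub>G\<^esub> commutator G x y)"

abbreviation gr_Gamma :: "('a, 'm) monoid_scheme \<Rightarrow> (nat \<Rightarrow> 'a set) graded_lie" where
  "gr_Gamma G \<equiv> gr G (lower_central G)"

section \<open>Automorphisms, outer automorphisms and the Johnson filtrations\<close>

definition Inn :: "('a, 'm) monoid_scheme \<Rightarrow> ('a \<Rightarrow> 'a) set" where
  "Inn G = (\<lambda>g. \<lambda>x\<in>carrier G. g \<otimes>\<^bsub>G\<^esub> x \<otimes>\<^bsub>G\<^esub> inv\<^bsub>G\<^esub> g) ` carrier G"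

definition Out :: "('a, 'm) monoid_scheme \<Rightarrow> ('a \<Rightarrow> 'a) set monoid" where
  "Out G = AutoGroup G Mod Inn G"

definition Out_proj :: "('a, 'm) monoid_scheme \<Rightarrow> ('a \<Rightarrow> 'a) \<Rightarrow> ('a \<Rightarrow> 'a) set" where
  "Out_proj G \<alpha> = Inn G #>\<^bsub>AutoGroup G\<^esub> \<alpha>"

definition johnson_filtration :: "('a, 'm) monoid_scheme \<Rightarrow> nat \<Rightarrow> ('a \<Rightarrow> 'a) set" where
  "johnson_filtration G s =
    {\<alpha> \<in> carrier (AutoGroup G). \<forall>x\<in>carrier G. \<alpha> x \<otimes>\<^bsub>G\<^esub> inv\<^bsub>G\<^esub> x \<in> lower_central G (Suc s)}"

definition outer_johnson_filtration :: "('a, 'm) monoid_scheme \<Rightarrow> nat \<Rightarrow> ('a \<Rightarrow> 'a) set set" where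
  "outer_johnson_filtration G s = Out_proj G ` johnson_filtration G s"

text \<open>The graded sums start in degree 1, so they only involve the Torelli groups, the first filtration steps.\<close>

abbreviation gr_F :: "('a, 'm) monoid_scheme \<Rightarrow> (nat \<Rightarrow> ('a \<Rightarrow> 'a) set) graded_lie" where
  "gr_F G \<equiv> gr (AutoGroup G) (johnson_filtration G)"

abbreviation gr_outer_F :: "('a, 'm) monoid_scheme \<Rightarrow> (nat \<Rightarrow> ('a \<Rightarrow> 'a) set set) graded_lie" where
  "gr_outer_F G \<equiv> gr (Out G) (outer_johnson_filtration G)"

definition gr_proj ::
    "('a, 'm) monoid_scheme \<Rightarrow> (nat \<Rightarrow> ('a \<Rightarrow> 'a) set) \<Rightarrow> nat \<Rightarrow> ('a \<Rightarrow> 'a) set set" where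
  "gr_proj G f =
    (\<lambda>s\<in>{1..}. \<Union>\<alpha>\<in>f s. outer_johnson_filtration G (Suc s) #>\<^bsub>Out G\<^esub> Out_proj G \<alpha>)"

text \<open>
  The Johnson homomorphism: the degree \<open>n\<close> part of \<open>J f y\<close> is the sum over \<open>s + t = n\<close> of the
  classes of \<open>\<alpha> x x\<^sup>-\<^sup>1\<close>, for \<open>\<alpha>\<close> and \<open>x\<close> representing the degree \<open>s\<close> part of \<open>f\<close> and the
  degree \<open>t\<close> part of \<open>y\<close>.
\<close>

definition johnson ::
    "('a, 'm) monoid_scheme \<Rightarrow> (nat \<Rightarrow> ('a \<Rightarrow> 'a) set) \<Rightarrow> (nat \<Rightarrow> 'a set) \<Rightarrow> nat \<Rightarrow> 'a set" where
  "johnson G f = (\<lambda>y\<in>carrier (gr_Gamma G). \<lambda>n\<in>{1..}.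
    finprod (gr_degree G (lower_central G) n)
      (\<lambda>s. \<Union>\<alpha>\<in>f s. \<Union>x\<in>y (n - s). lower_central G (Suc n) #>\<^bsub>G\<^esub> (\<alpha> x \<otimes>\<^bsub>G\<^esub> inv\<^bsub>G\<^esub> x))
      {1..<n})"

section \<open>The group \<open>\<A>(G)\<close> and its actions\<close>

text \<open>Elements of \<open>\<A>(G)\<close> are cosets \<open>S\<close>; the actions are unions over representatives \<open>\<sigma> \<in> S\<close>.\<close>

definition aut_ab :: "('a, 'm) monoid_scheme \<Rightarrow> ('a \<Rightarrow> 'a) set monoid" where
  "aut_ab G = gr_degree (AutoGroup G) (johnson_filtration G) 0"

definition act_gr_Gamma ::
    "('a, 'm) monoid_scheme \<Rightarrow> ('a \<Rightarrow> 'a) set \<Rightarrow> (nat \<Rightarrow> 'a set) \<Rightarrow> nat \<Rightarrow> 'a set" where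
  "act_gr_Gamma G S y = (\<lambda>t\<in>{1..}. \<Union>\<sigma>\<in>S. \<Union>x\<in>y t. lower_central G (Suc t) #>\<^bsub>G\<^esub> \<sigma> x)"

definition act_Der ::
    "('a, 'm) monoid_scheme \<Rightarrow> ('a \<Rightarrow> 'a) set
      \<Rightarrow> ((nat \<Rightarrow> 'a set) \<Rightarrow> nat \<Rightarrow> 'a set) \<Rightarrow> (nat \<Rightarrow> 'a set) \<Rightarrow> nat \<Rightarrow> 'a set" where
  "act_Der G S \<delta> = (\<lambda>y\<in>carrier (gr_Gamma G).
    act_gr_Gamma G S (\<delta> (act_gr_Gamma G (inv\<^bsub>aut_ab G\<^esub> S) y)))"

definition act_outer_Der ::
    "('a, 'm) monoid_scheme \<Rightarrow> ('a \<Rightarrow> 'a) set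
      \<Rightarrow> ((nat \<Rightarrow> 'a set) \<Rightarrow> nat \<Rightarrow> 'a set) set \<Rightarrow> ((nat \<Rightarrow> 'a set) \<Rightarrow> nat \<Rightarrow> 'a set) set" where
  "act_outer_Der G S U = (\<Union>\<delta>\<in>U. outer_Der_proj (gr_Gamma G) (act_Der G S \<delta>))"

definition act_gr_outer_F ::
    "('a, 'm) monoid_scheme \<Rightarrow> ('a \<Rightarrow> 'a) set
      \<Rightarrow> (nat \<Rightarrow> ('a \<Rightarrow> 'a) set set) \<Rightarrow> nat \<Rightarrow> ('a \<Rightarrow> 'a) set set" where
  "act_gr_outer_F G S f = (\<lambda>s\<in>{1..}. \<Union>\<sigma>\<in>S. \<Union>a\<in>f s.
    outer_johnson_filtration G (Suc s) #>\<^bsub>Out G\<^esub>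
      (Out_proj G \<sigma> \<otimes>\<^bsub>Out G\<^esub> a \<otimes>\<^bsub>Out G\<^esub> inv\<^bsub>Out G\<^esub> (Out_proj G \<sigma>)))"

end

(*
  A pairing m of filtered groups that is additive in each variable modulo higher filtration
  induces a bilinear convolution of the graded sums: for commutators this is the Lie bracket,
  with the Jacobi identity coming from Hall-Witt, and for (alpha, x) |-> alpha(x) x^-1 it is J.

  Conjugation c : G -> Aut(G) induces gr(c) : gr_Gamma(G) -> gr_F(T_G) with J o gr(c) = ad.
  If gr_Gamma(G) has trivial center and conjugation by g lies in F^s, then g lies in Gamma^s;
  hence the kernel of the projection to the outer graded Lie algebra is the image of gr(c).
  Since J is injective, J f is inner iff f lies in this image, so q o J factors through an
  injective map.
*)
theory Submission
  imports Defs
begin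

text \<open>Well-definedness and injectivity of the induced map are the two halves of one comparison
  of kernels. Well-definedness is where the centre enters: if the outer class of \<alpha> in
  \<open>johnson_filtration G s\<close> dies in degree s, then \<alpha> is conjugation by some g up
  to the next filtration step, but nothing yet forces g into \<open>lower_central G s\<close>; if g
  lay only in an earlier term, J(\<alpha>) would not visibly be ad of an element of degree s.
  Injectivity rests on injectivity of J, which is detected on degree 1 elements because the Johnson
  filtration is defined by displacements of all of G.

  The technical obstacle is that elements of the graded sums are families of cosets, their
  operations are unions over representatives, and brackets are sums over all splittings of a degree.
  Identities are therefore reduced by additivity to homogeneous elements
  \<open>homog G \<Phi> s x\<close>, where they become congruences of group words modulo the next
  filtration step. Equivariance is proved for J itself and then descends to cosets.\<close>

section \<open>Commutators and N-series\<close>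

context group
begin

lemma inv_mult_cancel:
  "\<lbrakk>x \<in> carrier G; y \<in> carrier G\<rbrakk> \<Longrightarrow> inv x \<otimes> (x \<otimes> y) = y"
  "\<lbrakk>x \<in> carrier G; y \<in> carrier G\<rbrakk> \<Longrightarrow> x \<otimes> (inv x \<otimes> y) = y"
  by (simp_all flip: m_assoc)

lemma commutator_closed [simp]:
  "\<lbrakk>x \<in> carrier G; y \<in> carrier G\<rbrakk> \<Longrightarrow> commutator G x y \<in> carrier G"
  by (simp add: commutator_def)

text \<open>Normalisation to reduced words: inverses move to single letters, products associate to
  the right, and \<open>inv_mult_cancel\<close> cancels neighbours that no longer form a subterm
  after right association. Identities valid in free groups then follow by simplification.\<close>

lemmas word_simps = commutator_def m_assoc inv_mult_group inv_mult_cancel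

lemma inv_commutator:
  "\<lbrakk>x \<in> carrier G; y \<in> carrier G\<rbrakk> \<Longrightarrow> inv (commutator G x y) = commutator G y x"
  by (simp add: word_simps)

lemma commutator_one [simp]:
  "x \<in> carrier G \<Longrightarrow> commutator G x \<one> = \<one>" "x \<in> carrier G \<Longrightarrow> commutator G \<one> x = \<one>"
  by (simp_all add: word_simps)

lemma commutator_self: "x \<in> carrier G \<Longrightarrow> commutator G x x = \<one>"
  by (simp add: word_simps)

lemma conj_eq_commutator:
  "\<lbrakk>x \<in> carrier G; y \<in> carrier G\<rbrakk> \<Longrightarrow> x \<otimes> y \<otimes> inv x = commutator G x y \<otimes> y"
  by (simp add: word_simps)

lemma commutator_mult_left:
  "\<lbrakk>x \<in> carrier G; y \<in> carrier G; z \<in> carrier G\<rbrakk>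
    \<Longrightarrow> commutator G (x \<otimes> y) z = (x \<otimes> commutator G y z \<otimes> inv x) \<otimes> commutator G x z"
  by (simp add: word_simps)

lemma commutator_mult_right:
  "\<lbrakk>x \<in> carrier G; y \<in> carrier G; z \<in> carrier G\<rbrakk>
    \<Longrightarrow> commutator G x (y \<otimes> z) = commutator G x y \<otimes> (y \<otimes> commutator G x z \<otimes> inv y)"
  by (simp add: word_simps)

lemma commutator_inv_right:
  "\<lbrakk>x \<in> carrier G; y \<in> carrier G\<rbrakk>
    \<Longrightarrow> commutator G x (inv y) = inv y \<otimes> inv (commutator G x y) \<otimes> inv (inv y)"
  by (simp add: word_simps)

lemma conj_commutator:
  "\<lbrakk>g \<in> carrier G; x \<in> carrier G; y \<in> carrier G\<rbrakk>
    \<Longrightarrow> g \<otimes> commutator G x y \<otimes> inv g = commutator G (g \<otimes> x \<otimes> inv g) (g \<otimes> y \<otimes> inv g)"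
  by (simp add: word_simps)

text \<open>The conjugated entries are what make the three factors cancel as reduced words for the
  convention x y x^-1 y^-1. In the associated graded the conjugations disappear, leaving the Jacobi
  identity.\<close>

lemma hall_witt:
  "\<lbrakk>x \<in> carrier G; y \<in> carrier G; z \<in> carrier G\<rbrakk>
    \<Longrightarrow> commutator G (commutator G x y) (y \<otimes> z \<otimes> inv y)
      \<otimes> commutator G (commutator G y z) (z \<otimes> x \<otimes> inv z)
      \<otimes> commutator G (commutator G z x) (x \<otimes> y \<otimes> inv x) = \<one>"
  by (simp add: word_simps)

lemma normal_conj_closed: "\<lbrakk>N \<lhd> G; x \<in> carrier G; h \<in> N\<rbrakk> \<Longrightarrow> x \<otimes> h \<otimes> inv x \<in> N"
  by (rule normal.inv_op_closed2)

end

text \<open>\<open>\<Phi> 1\<close> may be a proper subgroup: for the Johnson filtration it is the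
  Torelli group inside \<open>AutoGroup G\<close>. Invariance under conjugation thus follows only
  for conjugators in \<open>\<Phi> 1\<close> (\<open>Phi_conj\<close>); for the Johnson filtration,
  arbitrary conjugators are handled by \<open>johnson_filtration_conj\<close>.\<close>

locale N_series = group G for G (structure) +
  fixes \<Phi> :: "nat \<Rightarrow> 'a set"
  assumes subgroup_Phi: "1 \<le> s \<Longrightarrow> subgroup (\<Phi> s) G"
    and Phi_Suc: "1 \<le> s \<Longrightarrow> \<Phi> (Suc s) \<subseteq> \<Phi> s"
    and Phi_commutator:
      "\<lbrakk>1 \<le> s; 1 \<le> t; x \<in> \<Phi> s; y \<in> \<Phi> t\<rbrakk> \<Longrightarrow> commutator G x y \<in> \<Phi> (s + t)"
begin

lemma Phi_carrier: "\<lbrakk>1 \<le> s; x \<in> \<Phi> s\<rbrakk> \<Longrightarrow> x \<in> carrier G"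
  using subgroup_Phi subgroup.mem_carrier by metis

lemma Phi_one [simp]: "1 \<le> s \<Longrightarrow> \<one> \<in> \<Phi> s"
  using subgroup_Phi subgroup.one_closed by metis

lemma Phi_mult: "\<lbrakk>1 \<le> s; x \<in> \<Phi> s; y \<in> \<Phi> s\<rbrakk> \<Longrightarrow> x \<otimes> y \<in> \<Phi> s"
  using subgroup_Phi subgroup.m_closed by metis

lemma Phi_inv: "\<lbrakk>1 \<le> s; x \<in> \<Phi> s\<rbrakk> \<Longrightarrow> inv x \<in> \<Phi> s"
  using subgroup_Phi subgroup.m_inv_closed by metis

lemma Phi_antimono: "\<lbrakk>1 \<le> s; s \<le> t\<rbrakk> \<Longrightarrow> \<Phi> t \<subseteq> \<Phi> s"
proof (rotate_tac 1, induction t rule: dec_induct)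
  case (step n)
  then show ?case using Phi_Suc[of n] by simp
qed simp

lemma Phi_mono: "\<lbrakk>x \<in> \<Phi> t; 1 \<le> s; s \<le> t\<rbrakk> \<Longrightarrow> x \<in> \<Phi> s"
  using Phi_antimono by blast

lemma Phi_conj:
  assumes s: "1 \<le> s" and t: "1 \<le> t" and x: "x \<in> \<Phi> s" and y: "y \<in> \<Phi> t"
  shows "x \<otimes> y \<otimes> inv x \<in> \<Phi> t"
proof -
  have "commutator G x y \<in> \<Phi> t"
    using Phi_mono[OF Phi_commutator[OF s t x y]] t by simp
  then show ?thesis
    using assms by (simp add: conj_eq_commutator Phi_carrier Phi_mult)
qed

end

section \<open>The lower central series as an N-series\<close>

context group
begin

lemma lower_central_normal: "lower_central G s \<lhd> G"
proof (induction s rule: induct_nat_012)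
  case (ge2 s)
  note Suc = ge2(2)
  show ?case
    unfolding lower_central.simps
  proof (rule normal_generateI)
    show "{commutator G x y |x y. x \<in> lower_central G (Suc s) \<and> y \<in> carrier G} \<subseteq> carrier G"
      using normal_imp_subgroup[OF Suc] subgroup.subset by fastforce
  next
    fix h g
    assume "h \<in> {commutator G x y |x y. x \<in> lower_central G (Suc s) \<and> y \<in> carrier G}"
      and g: "g \<in> carrier G"
    then obtain x y where h: "h = commutator G x y"
      and x: "x \<in> lower_central G (Suc s)" and y: "y \<in> carrier G" by blast
    have xc: "x \<in> carrier G"
      using normal_imp_subgroup[OF Suc] x subgroup.mem_carrier by metis
    have "g \<otimes> x \<otimes> inv g \<in> lower_central G (Suc s)"
      using normal_conj_closed[OF Suc g x] .
    moreover have "g \<otimes> y \<otimes> inv g \<in> carrier G" using g y by simp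
    moreover have "g \<otimes> h \<otimes> inv g = commutator G (g \<otimes> x \<otimes> inv g) (g \<otimes> y \<otimes> inv g)"
      unfolding h using g xc y by (rule conj_commutator)
    ultimately show "g \<otimes> h \<otimes> inv g \<in> {commutator G x y |x y. x \<in> lower_central G (Suc s) \<and> y \<in> carrier G}"
      by blast
  qed
qed (simp_all add: normal_self)

lemma lower_central_subgroup: "subgroup (lower_central G s) G"
  using lower_central_normal by (rule normal_imp_subgroup)

lemma lower_central_carrier: "x \<in> lower_central G s \<Longrightarrow> x \<in> carrier G"
  using lower_central_subgroup subgroup.mem_carrier by metis

lemma lower_central_one [simp]: "lower_central G 1 = carrier G"
  by simp

lemma commutator_mem_lower_central_Suc:
  assumes "1 \<le> s" "x \<in> lower_central G s" "y \<in> carrier G"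
  shows "commutator G x y \<in> lower_central G (Suc s)"
  using assms by (cases s) (auto intro!: generate.incl)

text \<open>A generator (x,y) is x times a conjugate of x^-1, so normality of the previous term
  suffices.\<close>

lemma lower_central_Suc_subset: "lower_central G (Suc s) \<subseteq> lower_central G s"
proof (cases s)
  case (Suc t)
  have "commutator G x y \<in> lower_central G (Suc t)"
    if x: "x \<in> lower_central G (Suc t)" and y: "y \<in> carrier G" for x y
  proof -
    note S = lower_central_subgroup[of "Suc t"]
    have "commutator G x y = x \<otimes> (y \<otimes> inv x \<otimes> inv y)"
      using x y by (simp add: word_simps lower_central_carrier)
    then show ?thesis
      using subgroup.m_closed[OF S x normal_conj_closed[OF lower_central_normal y subgroup.m_inv_closed[OF S x]]]
      by simp
  qed
  then show ?thesis
    unfolding Suc lower_central.simps by (intro generate_subgroup_incl lower_central_subgroup) auto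
qed simp

text \<open>Three subgroups argument by induction on t, for all s simultaneously. For a generator h
  = (y',g) of the next term, Hall-Witt writes (h,x) through ((a,y'),-) and ((g,a),-); the second
  needs the hypothesis at s + 1, so s must stay arbitrary.\<close>

lemma commutator_mem_lower_central:
  assumes "1 \<le> s" "1 \<le> t" "x \<in> lower_central G s" "y \<in> lower_central G t"
  shows "commutator G x y \<in> lower_central G (s + t)"
  using assms(2,1,3,4)
proof (induction t arbitrary: s x y rule: dec_induct)
  case base
  then show ?case using commutator_mem_lower_central_Suc by simp
next
  case (step t)
  define N where "N = lower_central G (s + Suc t)"
  have N: "N \<lhd> G" "subgroup N G"
    unfolding N_def by (rule lower_central_normal lower_central_subgroup)+
  note closed = subgroup.m_closed[OF N(2)] subgroup.m_inv_closed[OF N(2)] normal_conj_closed[OF N(1)]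
  have x: "x \<in> carrier G" using step.prems lower_central_carrier by blast
  obtain t' where t': "t = Suc t'" using step.hyps by (cases t) auto
  let ?K = "{commutator G x y |x y. x \<in> lower_central G t \<and> y \<in> carrier G}"
  have K: "?K \<subseteq> carrier G" using lower_central_carrier by auto
  have "y \<in> generate G ?K" using step.prems by (simp add: t')
  then have "commutator G x y \<in> N"
  proof (induction y rule: generate.induct)
    case one
    then show ?case using x subgroup.one_closed[OF N(2)] by simp
  next
    have gen: "commutator G x h \<in> N" if "h \<in> ?K" for h
    proof -
      from that obtain y' g where h: "h = commutator G y' g"
        and y': "y' \<in> lower_central G t" and g: "g \<in> carrier G" by blast
      have y'c: "y' \<in> carrier G" using y' lower_central_carrier by blast
      \<comment> \<open>Chosen so that g a g^-1 = x: in Hall-Witt for a, y', g the middle factor is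
        then exactly (h,x).\<close>
      define a where "a = inv g \<otimes> x \<otimes> g"
      have "inv g \<otimes> x \<otimes> inv (inv g) \<in> lower_central G s"
        using lower_central_normal g step.prems by (intro normal_conj_closed) auto
      then have a: "a \<in> lower_central G s" using g by (simp add: a_def)
      then have ac: "a \<in> carrier G" using lower_central_carrier by blast
      have ga: "g \<otimes> a \<otimes> inv g = x" using g x by (simp add: a_def word_simps)
      have 1: "commutator G (commutator G a y') (y' \<otimes> g \<otimes> inv y') \<in> N"
        unfolding N_def add_Suc_right
        by (intro commutator_mem_lower_central_Suc step.IH a y') (use step g y'c in auto)
      have "inv (commutator G a g) \<in> lower_central G (Suc s)"
        using commutator_mem_lower_central_Suc[OF _ a g] step.prems
          subgroup.m_inv_closed[OF lower_central_subgroup] by blast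
      then have "commutator G g a \<in> lower_central G (Suc s)"
        using inv_commutator ac g by metis
      moreover have "a \<otimes> y' \<otimes> inv a \<in> lower_central G t"
        using lower_central_normal ac y' by (rule normal_conj_closed)
      \<comment> \<open>Since s + Suc t = Suc s + t, this is the induction hypothesis at t with Suc
        s in the first slot.\<close>
      ultimately have 2: "commutator G (commutator G g a) (a \<otimes> y' \<otimes> inv a) \<in> N"
        unfolding N_def add_Suc_shift[symmetric] by (intro step.IH) auto
      let ?A = "commutator G (commutator G a y') (y' \<otimes> g \<otimes> inv y')"
      let ?B = "commutator G (commutator G g a) (a \<otimes> y' \<otimes> inv a)"
      have "?A \<otimes> commutator G h x \<otimes> ?B = \<one>"
        using hall_witt[OF ac y'c g] unfolding ga h .
      moreover have c: "?A \<in> carrier G" "?B \<in> carrier G" "commutator G h x \<in> carrier G"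
        using ac y'c g x h by auto
      ultimately have "commutator G h x = inv ?A \<otimes> inv ?B"
        by (metis inv_equality inv_inv inv_solve_left m_closed inv_closed m_assoc)
      then have "commutator G h x \<in> N" using 1 2 closed by auto
      then show ?thesis using closed(2) inv_commutator h x y'c g by force
    qed
    { case (incl h) then show ?case by (rule gen) }
    { case (inv h)
      moreover have "h \<in> carrier G" using inv K by blast
      ultimately show ?case
        using commutator_inv_right[OF x, of h] gen[of h]
          closed(3)[of "inv h" "inv (commutator G x h)"] closed(2) by simp }
    case (eng h1 h2)
    have "h1 \<in> carrier G" "h2 \<in> carrier G" using eng.hyps generate_in_carrier[OF K] by auto
    then show ?case
      using commutator_mult_right[OF x, of h1 h2] eng.IH closed by simp
  qed
  then show ?case by (simp add: N_def)
qed

lemma lower_central_N_series: "N_series G (lower_central G)"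
  by (intro N_series.intro group_axioms N_series_axioms.intro)
    (use lower_central_subgroup lower_central_Suc_subset commutator_mem_lower_central in \<open>auto\<close>)

end

section \<open>The Johnson filtration\<close>

definition inner_aut :: "('a, 'm) monoid_scheme \<Rightarrow> 'a \<Rightarrow> 'a \<Rightarrow> 'a" where
  "inner_aut G g = (\<lambda>x\<in>carrier G. g \<otimes>\<^bsub>G\<^esub> x \<otimes>\<^bsub>G\<^esub> inv\<^bsub>G\<^esub> g)"

lemma Inn_eq: "Inn G = inner_aut G ` carrier G"
  by (simp add: Inn_def inner_aut_def)

text \<open>Makes the outer Johnson filtration an N-series as the image of the Johnson filtration
  under \<open>Out_proj\<close>; an outer class has no well-defined displacements to argue with
  directly.\<close>

lemma N_series_image:
  assumes "N_series G \<Phi>" and "group_hom G H h"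
  shows "N_series H (\<lambda>s. h ` \<Phi> s)"
proof -
  interpret N_series G \<Phi> by fact
  interpret group_hom G H h by fact
  have *: "h (commutator G x y) = commutator H (h x) (h y)"
    if "x \<in> carrier G" "y \<in> carrier G" for x y
    using that by (simp add: commutator_def)
  show ?thesis
  proof (intro N_series.intro N_series_axioms.intro)
    show "subgroup (h ` \<Phi> s) H" if "1 \<le> s" for s
      using that by (simp add: subgroup_img_is_subgroup subgroup_Phi)
    show "h ` \<Phi> (Suc s) \<subseteq> h ` \<Phi> s" if "1 \<le> s" for s
      using that Phi_Suc by blast
    show "commutator H x y \<in> h ` \<Phi> (s + t)"
      if "1 \<le> s" "1 \<le> t" "x \<in> h ` \<Phi> s" "y \<in> h ` \<Phi> t" for s t x y
      using that Phi_commutator by (auto simp: Phi_carrier simp flip: *)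
  qed (rule H.group_axioms)
qed

context group
begin

lemma carrier_AutoGroup: "carrier (AutoGroup G) = auto G"
  by (simp add: AutoGroup_def)

lemma aut_hom: "\<alpha> \<in> carrier (AutoGroup G) \<Longrightarrow> group_hom G G \<alpha>"
  by (simp add: carrier_AutoGroup auto_def group_hom_def group_hom_axioms_def group_axioms)

lemma aut_closed [simp]:
  "\<lbrakk>\<alpha> \<in> carrier (AutoGroup G); x \<in> carrier G\<rbrakk> \<Longrightarrow> \<alpha> x \<in> carrier G"
  using aut_hom group_hom.hom_closed by metis

lemma aut_mult [simp]:
  "\<lbrakk>\<alpha> \<in> carrier (AutoGroup G); x \<in> carrier G; y \<in> carrier G\<rbrakk> \<Longrightarrow> \<alpha> (x \<otimes> y) = \<alpha> x \<otimes> \<alpha> y"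
  using aut_hom group_hom.hom_mult by metis

lemma aut_inv [simp]:
  "\<lbrakk>\<alpha> \<in> carrier (AutoGroup G); x \<in> carrier G\<rbrakk> \<Longrightarrow> \<alpha> (inv x) = inv (\<alpha> x)"
  using aut_hom group_hom.hom_inv by metis

lemma aut_one [simp]: "\<alpha> \<in> carrier (AutoGroup G) \<Longrightarrow> \<alpha> \<one> = \<one>"
  using aut_hom group_hom.hom_one by metis

lemma aut_commutator:
  "\<lbrakk>\<alpha> \<in> carrier (AutoGroup G); x \<in> carrier G; y \<in> carrier G\<rbrakk>
    \<Longrightarrow> \<alpha> (commutator G x y) = commutator G (\<alpha> x) (\<alpha> y)"
  by (simp add: commutator_def)

lemma AutoGroup_mult_apply [simp]:
  "\<lbrakk>\<alpha> \<in> carrier (AutoGroup G); \<beta> \<in> carrier (AutoGroup G); x \<in> carrier G\<rbrakk>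
    \<Longrightarrow> (\<alpha> \<otimes>\<^bsub>AutoGroup G\<^esub> \<beta>) x = \<alpha> (\<beta> x)"
  by (simp add: AutoGroup_def BijGroup_def auto_def compose_def)

lemma AutoGroup_one_apply [simp]: "x \<in> carrier G \<Longrightarrow> \<one>\<^bsub>AutoGroup G\<^esub> x = x"
  by (simp add: AutoGroup_def BijGroup_def)

lemma aut_inv_apply [simp]:
  assumes "\<alpha> \<in> carrier (AutoGroup G)" "x \<in> carrier G"
  shows "(inv\<^bsub>AutoGroup G\<^esub> \<alpha>) (\<alpha> x) = x" "\<alpha> ((inv\<^bsub>AutoGroup G\<^esub> \<alpha>) x) = x"
proof -
  interpret A: group "AutoGroup G" by (rule AutoGroup)
  show "(inv\<^bsub>AutoGroup G\<^esub> \<alpha>) (\<alpha> x) = x"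
    using assms by (simp flip: AutoGroup_mult_apply)
  show "\<alpha> ((inv\<^bsub>AutoGroup G\<^esub> \<alpha>) x) = x"
    using assms by (simp flip: AutoGroup_mult_apply)
qed

lemma AutoGroup_eqI:
  assumes "\<alpha> \<in> carrier (AutoGroup G)" "\<beta> \<in> carrier (AutoGroup G)"
    and "\<And>x. x \<in> carrier G \<Longrightarrow> \<alpha> x = \<beta> x"
  shows "\<alpha> = \<beta>"
  using assms by (auto simp: carrier_AutoGroup auto_def Bij_def intro: extensionalityI)

lemma AutoGroup_closed [simp]:
  "\<lbrakk>\<alpha> \<in> carrier (AutoGroup G); \<beta> \<in> carrier (AutoGroup G)\<rbrakk> \<Longrightarrow> \<alpha> \<otimes>\<^bsub>AutoGroup G\<^esub> \<beta> \<in> carrier (AutoGroup G)"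
  "\<alpha> \<in> carrier (AutoGroup G) \<Longrightarrow> inv\<^bsub>AutoGroup G\<^esub> \<alpha> \<in> carrier (AutoGroup G)"
  "\<one>\<^bsub>AutoGroup G\<^esub> \<in> carrier (AutoGroup G)"
  using AutoGroup by (simp_all add: group.inv_closed group.is_monoid monoid.m_closed monoid.one_closed)

lemma aut_lower_central:
  assumes \<alpha>: "\<alpha> \<in> carrier (AutoGroup G)"
  shows "x \<in> lower_central G s \<Longrightarrow> \<alpha> x \<in> lower_central G s"
proof (induction s arbitrary: x rule: induct_nat_012)
  case (ge2 s)
  interpret group_hom G G \<alpha> using \<alpha> by (rule aut_hom)
  let ?K = "{commutator G x y |x y. x \<in> lower_central G (Suc s) \<and> y \<in> carrier G}"
  have "\<alpha> ` generate G ?K = generate G (\<alpha> ` ?K)"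
    by (rule generate_img[symmetric]) (use lower_central_carrier in auto)
  also have "\<dots> \<subseteq> generate G ?K"
  proof (rule mono_generate, safe)
    fix x y
    assume "x \<in> lower_central G (Suc s)" "y \<in> carrier G"
    then show "\<exists>x' y'. \<alpha> (commutator G x y) = commutator G x' y' \<and> x' \<in> lower_central G (Suc s) \<and> y' \<in> carrier G"
      using \<alpha> ge2(2) lower_central_carrier aut_commutator by (intro exI[of _ "\<alpha> x"] exI[of _ "\<alpha> y"]) auto
  qed
  finally show ?case using ge2(3) by auto
qed (use \<alpha> in auto)

lemma johnson_filtrationD:
  "\<alpha> \<in> johnson_filtration G s \<Longrightarrow> \<alpha> \<in> carrier (AutoGroup G)"
  by (simp add: johnson_filtration_def)

lemma johnson_filtration_0: "johnson_filtration G 0 = carrier (AutoGroup G)"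
  by (auto simp: johnson_filtration_def)

text \<open>The displacement \<alpha>(x) x^-1 is a crossed homomorphism in x, so it becomes additive
  once conjugation is invisible.\<close>

lemma displacement_mult:
  "\<lbrakk>\<alpha> \<in> carrier (AutoGroup G); x \<in> carrier G; y \<in> carrier G\<rbrakk>
    \<Longrightarrow> \<alpha> (x \<otimes> y) \<otimes> inv (x \<otimes> y) = (\<alpha> x \<otimes> inv x) \<otimes> (x \<otimes> (\<alpha> y \<otimes> inv y) \<otimes> inv x)"
  by (simp add: word_simps)

lemma displacement_inv:
  "\<lbrakk>\<alpha> \<in> carrier (AutoGroup G); x \<in> carrier G\<rbrakk>
    \<Longrightarrow> \<alpha> (inv x) \<otimes> inv (inv x) = inv x \<otimes> inv (\<alpha> x \<otimes> inv x) \<otimes> inv (inv x)"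
  by (simp add: word_simps)

lemma displacement_compose:
  "\<lbrakk>\<alpha> \<in> carrier (AutoGroup G); \<beta> \<in> carrier (AutoGroup G); x \<in> carrier G\<rbrakk>
    \<Longrightarrow> (\<alpha> \<otimes>\<^bsub>AutoGroup G\<^esub> \<beta>) x \<otimes> inv x = (\<alpha> (\<beta> x) \<otimes> inv (\<beta> x)) \<otimes> (\<beta> x \<otimes> inv x)"
  by (simp add: word_simps)

text \<open>Evaluating at \<beta>(\<alpha> x) removes the inverse automorphisms: the commutator
  sends this point to \<alpha>(\<beta> x). Comparing \<alpha>(\<beta> x) with \<beta>(\<alpha> x)
  then involves only the displacements of a and b and their commutator.\<close>

lemma displacement_commutator:
  assumes "\<alpha> \<in> carrier (AutoGroup G)" "\<beta> \<in> carrier (AutoGroup G)" "x \<in> carrier G"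
  defines "a \<equiv> \<alpha> x \<otimes> inv x" and "b \<equiv> \<beta> x \<otimes> inv x"
  shows "commutator (AutoGroup G) \<alpha> \<beta> (\<beta> (\<alpha> x)) \<otimes> inv (\<beta> (\<alpha> x))
    = (\<alpha> b \<otimes> inv b) \<otimes> commutator G b a \<otimes> inv (\<beta> a \<otimes> inv a)"
  using assms by (simp add: word_simps commutator_def[of "AutoGroup G"])

text \<open>
  Induction on \<open>t\<close>: with \<open>\<alpha> x = a x\<close> and \<open>\<alpha> g = b g\<close>, expanding the commutator \<open>(a x, b g)\<close>
  leaves \<open>(x, g)\<close> up to commutators involving \<open>a\<close> or \<open>b\<close>.
\<close>

lemma displacement_mem_lower_central:
  assumes \<alpha>F: "\<alpha> \<in> johnson_filtration G s" and "1 \<le> t" "x \<in> lower_central G t"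
  shows "\<alpha> x \<otimes> inv x \<in> lower_central G (s + t)"
  using assms(2,3)
proof (induction t arbitrary: x rule: dec_induct)
  case base
  then show ?case using \<alpha>F by (simp add: johnson_filtration_def)
next
  case (step t)
  have \<alpha>: "\<alpha> \<in> carrier (AutoGroup G)" using \<alpha>F by (rule johnson_filtrationD)
  define N where "N = lower_central G (s + Suc t)"
  have N: "N \<lhd> G" "subgroup N G"
    unfolding N_def by (rule lower_central_normal lower_central_subgroup)+
  note closed = subgroup.m_closed[OF N(2)] subgroup.m_inv_closed[OF N(2)] normal_conj_closed[OF N(1)]
  obtain t' where t': "t = Suc t'" using step.hyps by (cases t) auto
  interpret N_series G "lower_central G" by (rule lower_central_N_series)
  let ?K = "{commutator G x y |x y. x \<in> lower_central G t \<and> y \<in> carrier G}"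
  have K: "?K \<subseteq> carrier G" using lower_central_carrier by auto
  have "x \<in> generate G ?K" using step.prems by (simp add: t')
  then have "\<alpha> x \<otimes> inv x \<in> N"
  proof (induction x rule: generate.induct)
    case one
    then show ?case using \<alpha> subgroup.one_closed[OF N(2)] by simp
  next
    have gen: "\<alpha> h \<otimes> inv h \<in> N" if "h \<in> ?K" for h
    proof -
      from that obtain x g where h: "h = commutator G x g"
        and x: "x \<in> lower_central G t" and g: "g \<in> carrier G" by blast
      define a b where "a = \<alpha> x \<otimes> inv x" and "b = \<alpha> g \<otimes> inv g"
      have xc: "x \<in> carrier G" using x lower_central_carrier by blast
      have a: "a \<in> lower_central G (s + t)"
        unfolding a_def using x by (rule step.IH)
      have b: "b \<in> lower_central G (Suc s)"
        using \<alpha>F g by (simp add: b_def johnson_filtration_def)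
      have ac: "a \<in> carrier G" and bc: "b \<in> carrier G" using a b lower_central_carrier by blast+
      have \<alpha>x: "\<alpha> x = a \<otimes> x" "\<alpha> g = b \<otimes> g"
        using \<alpha> xc g by (simp_all add: a_def b_def word_simps)
      have n1: "commutator G a y \<in> N" if "y \<in> carrier G" for y
        unfolding N_def add_Suc_right using step.hyps a that
        by (intro commutator_mem_lower_central_Suc) auto
      have n2: "commutator G x b \<in> N"
        using commutator_mem_lower_central[OF _ _ x b] step.hyps by (simp add: N_def add.commute)
      have "commutator G b h \<in> lower_central G (Suc s + Suc t)"
        unfolding h by (intro commutator_mem_lower_central commutator_mem_lower_central_Suc b x g) (use step.hyps in auto)
      then have n3: "commutator G b h \<in> N"
        unfolding N_def by (rule Phi_mono) auto
      have hc: "h \<in> carrier G" using h xc g by simp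
      have "\<alpha> h \<otimes> inv h = commutator G a (commutator G x (b \<otimes> g)) \<otimes> (commutator G x b \<otimes> commutator G b h)
        \<otimes> (h \<otimes> commutator G a (b \<otimes> g) \<otimes> inv h)"
        unfolding h aut_commutator[OF \<alpha> xc g] \<alpha>x using xc g ac bc by (simp add: word_simps)
      then show ?thesis
        using closed n1[of "commutator G x (b \<otimes> g)"] n1[of "b \<otimes> g"] n2 n3 hc xc g ac bc by auto
    qed
    { case (incl h) then show ?case by (rule gen) }
    { case (inv h)
      moreover have "h \<in> carrier G" using inv K by blast
      ultimately show ?case
        using displacement_inv[OF \<alpha>, of h] gen[of h]
          closed(3)[of "inv h" "inv (\<alpha> h \<otimes> inv h)"] closed(2)[of "\<alpha> h \<otimes> inv h"] by simp }
    case (eng h1 h2)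
    have "h1 \<in> carrier G" "h2 \<in> carrier G" using eng.hyps generate_in_carrier[OF K] by auto
    then show ?case
      using displacement_mult[OF \<alpha>, of h1 h2] eng.IH closed by auto
  qed
  then show ?case by (simp add: N_def)
qed

lemma johnson_filtration_subgroup: "subgroup (johnson_filtration G s) (AutoGroup G)"
proof
  note S = lower_central_subgroup[of "Suc s"]
  show "johnson_filtration G s \<subseteq> carrier (AutoGroup G)" by (auto simp: johnson_filtration_def)
  show "\<one>\<^bsub>AutoGroup G\<^esub> \<in> johnson_filtration G s"
    using subgroup.one_closed[OF S] by (auto simp: johnson_filtration_def simp del: lower_central.simps)
  show "\<alpha> \<otimes>\<^bsub>AutoGroup G\<^esub> \<beta> \<in> johnson_filtration G s"
    if \<alpha>: "\<alpha> \<in> johnson_filtration G s" and \<beta>: "\<beta> \<in> johnson_filtration G s" for \<alpha> \<beta>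
  proof -
    have "(\<alpha> \<otimes>\<^bsub>AutoGroup G\<^esub> \<beta>) x \<otimes> inv x \<in> lower_central G (Suc s)" if x: "x \<in> carrier G" for x
      unfolding displacement_compose[OF johnson_filtrationD[OF \<alpha>] johnson_filtrationD[OF \<beta>] x]
      by (rule subgroup.m_closed[OF S])
        (use \<alpha> \<beta> x in \<open>auto simp: johnson_filtration_def simp del: lower_central.simps\<close>)
    then show ?thesis using \<alpha> \<beta> by (simp add: johnson_filtration_def)
  qed
  show "inv\<^bsub>AutoGroup G\<^esub> \<alpha> \<in> johnson_filtration G s" if \<alpha>: "\<alpha> \<in> johnson_filtration G s" for \<alpha>
  proof -
    let ?b = "inv\<^bsub>AutoGroup G\<^esub> \<alpha>"
    have A: "\<alpha> \<in> carrier (AutoGroup G)" using \<alpha> by (rule johnson_filtrationD)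
    have "?b x \<otimes> inv x \<in> lower_central G (Suc s)" if x: "x \<in> carrier G" for x
    proof -
      have c: "?b x \<in> carrier G" using A x by simp
      have "?b x \<otimes> inv x = inv (\<alpha> (?b x) \<otimes> inv (?b x))"
        using A x c by (simp add: word_simps)
      then show ?thesis
        using \<alpha> c subgroup.m_inv_closed[OF S] by (simp add: johnson_filtration_def del: lower_central.simps)
    qed
    then show ?thesis using A by (simp add: johnson_filtration_def)
  qed
qed

text \<open>Every y has the form \<beta>(\<alpha> x), where \<open>displacement_commutator\<close>
  applies. Its three factors lie deep enough because a and b lie in the terms s + 1 and t + 1 of the
  lower central series, and \<beta> and \<alpha> displace them by t and s further steps.\<close>

lemma johnson_filtration_commutator:
  assumes \<alpha>: "\<alpha> \<in> johnson_filtration G s" and \<beta>: "\<beta> \<in> johnson_filtration G t"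
  shows "commutator (AutoGroup G) \<alpha> \<beta> \<in> johnson_filtration G (s + t)"
proof -
  interpret A: group "AutoGroup G" by (rule AutoGroup)
  interpret N_series G "lower_central G" by (rule lower_central_N_series)
  have c: "\<alpha> \<in> carrier (AutoGroup G)" "\<beta> \<in> carrier (AutoGroup G)"
    using \<alpha> \<beta> johnson_filtrationD by auto
  let ?\<gamma> = "commutator (AutoGroup G) \<alpha> \<beta>"
  have "?\<gamma> y \<otimes> inv y \<in> lower_central G (Suc (s + t))" if y: "y \<in> carrier G" for y
  proof -
    define x where "x = (inv\<^bsub>AutoGroup G\<^esub> \<alpha>) ((inv\<^bsub>AutoGroup G\<^esub> \<beta>) y)"
    have x: "x \<in> carrier G" and yx: "y = \<beta> (\<alpha> x)" using c y by (simp_all add: x_def)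
    define a b where "a = \<alpha> x \<otimes> inv x" and "b = \<beta> x \<otimes> inv x"
    have a: "a \<in> lower_central G (Suc s)" and b: "b \<in> lower_central G (Suc t)"
      using \<alpha> \<beta> x by (simp_all add: a_def b_def johnson_filtration_def)
    have ab: "\<alpha> b \<otimes> inv b \<in> lower_central G (Suc (s + t))"
      using displacement_mem_lower_central[OF \<alpha> _ b] by simp
    have ba: "inv (\<beta> a \<otimes> inv a) \<in> lower_central G (Suc (s + t))"
      using displacement_mem_lower_central[OF \<beta> _ a] Phi_inv[of "Suc (s+t)"] by (simp add: add.commute)
    have "commutator G b a \<in> lower_central G (Suc (s + t))"
      by (rule Phi_mono[OF Phi_commutator[OF _ _ b a]]) auto
    then show ?thesis
      unfolding yx displacement_commutator[OF c x, folded a_def b_def]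
      using Phi_mult[OF _ Phi_mult[OF _ ab] ba] by simp
  qed
  then show ?thesis using c A.commutator_closed by (simp add: johnson_filtration_def)
qed

lemma johnson_filtration_Suc: "johnson_filtration G (Suc s) \<subseteq> johnson_filtration G s"
  using lower_central_Suc_subset by (fastforce simp: johnson_filtration_def simp del: lower_central.simps)

lemma johnson_filtration_N_series: "N_series (AutoGroup G) (johnson_filtration G)"
  by (intro N_series.intro N_series_axioms.intro AutoGroup johnson_filtration_subgroup
      johnson_filtration_Suc johnson_filtration_commutator)

text \<open>The displacement of \<sigma> \<alpha> \<sigma>^-1 at x is the image under \<sigma> of
  the displacement of \<alpha> at \<sigma>^-1 x, and automorphisms preserve the lower central
  series.\<close>

lemma johnson_filtration_conj:
  assumes \<sigma>: "\<sigma> \<in> carrier (AutoGroup G)" and \<alpha>: "\<alpha> \<in> johnson_filtration G s"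
  shows "\<sigma> \<otimes>\<^bsub>AutoGroup G\<^esub> \<alpha> \<otimes>\<^bsub>AutoGroup G\<^esub> inv\<^bsub>AutoGroup G\<^esub> \<sigma> \<in> johnson_filtration G s"
proof -
  have A: "\<alpha> \<in> carrier (AutoGroup G)" using \<alpha> by (rule johnson_filtrationD)
  have "(\<sigma> \<otimes>\<^bsub>AutoGroup G\<^esub> \<alpha> \<otimes>\<^bsub>AutoGroup G\<^esub> inv\<^bsub>AutoGroup G\<^esub> \<sigma>) x \<otimes> inv x \<in> lower_central G (Suc s)"
    if x: "x \<in> carrier G" for x
  proof -
    let ?y = "(inv\<^bsub>AutoGroup G\<^esub> \<sigma>) x"
    have "\<alpha> ?y \<otimes> inv ?y \<in> lower_central G (Suc s)"
      using \<alpha> \<sigma> x by (simp add: johnson_filtration_def del: lower_central.simps)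
    from aut_lower_central[OF \<sigma> this] show ?thesis using \<sigma> A x by simp
  qed
  then show ?thesis using \<sigma> A by (simp add: johnson_filtration_def)
qed

subsection \<open>Inner automorphisms\<close>

lemma inner_aut_apply [simp]: "x \<in> carrier G \<Longrightarrow> inner_aut G g x = g \<otimes> x \<otimes> inv g"
  by (simp add: inner_aut_def)

lemma inner_aut_closed [simp]:
  assumes "g \<in> carrier G"
  shows "inner_aut G g \<in> carrier (AutoGroup G)"
proof -
  have "bij_betw (\<lambda>x. g \<otimes> x \<otimes> inv g) (carrier G) (carrier G)"
    by (rule bij_betw_byWitness[where f' = "\<lambda>x. inv g \<otimes> x \<otimes> g"]) (use assms in \<open>auto simp: word_simps\<close>)
  then have "bij_betw (inner_aut G g) (carrier G) (carrier G)"
    using bij_betw_cong[of "carrier G" "inner_aut G g" "\<lambda>x. g \<otimes> x \<otimes> inv g"] by simp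
  moreover have "inner_aut G g \<in> hom G G"
    using assms by (auto simp: hom_def word_simps)
  ultimately show ?thesis
    by (simp add: carrier_AutoGroup auto_def Bij_def inner_aut_def)
qed

lemma inner_aut_mult:
  "\<lbrakk>g \<in> carrier G; h \<in> carrier G\<rbrakk> \<Longrightarrow> inner_aut G (g \<otimes> h) = inner_aut G g \<otimes>\<^bsub>AutoGroup G\<^esub> inner_aut G h"
  by (rule AutoGroup_eqI) (simp_all add: word_simps)

lemma inner_aut_hom: "group_hom G (AutoGroup G) (inner_aut G)"
  by (intro group_hom.intro group_hom_axioms.intro homI group_axioms AutoGroup) (simp_all add: inner_aut_mult)

lemma aut_inner_aut:
  assumes "\<alpha> \<in> carrier (AutoGroup G)" "g \<in> carrier G"
  shows "\<alpha> \<otimes>\<^bsub>AutoGroup G\<^esub> inner_aut G g \<otimes>\<^bsub>AutoGroup G\<^esub> inv\<^bsub>AutoGroup G\<^esub> \<alpha> = inner_aut G (\<alpha> g)"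
  using assms by (intro AutoGroup_eqI) simp_all

text \<open>At the level of group elements this is the reason why J turns inner automorphisms into
  inner derivations.\<close>

lemma inner_aut_displacement:
  "x \<in> carrier G \<Longrightarrow> inner_aut G g x \<otimes> inv x = commutator G g x"
  by (simp add: commutator_def)

lemma inner_aut_mem_johnson_filtration:
  assumes "1 \<le> s" "g \<in> lower_central G s"
  shows "inner_aut G g \<in> johnson_filtration G s"
  using assms lower_central_carrier[OF assms(2)] commutator_mem_lower_central_Suc
  by (auto simp: johnson_filtration_def inner_aut_displacement simp del: inner_aut_apply lower_central.simps)

lemma Inn_normal: "Inn G \<lhd> AutoGroup G"
proof -
  interpret A: group "AutoGroup G" by (rule AutoGroup)
  interpret group_hom G "AutoGroup G" "inner_aut G" by (rule inner_aut_hom)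
  show ?thesis
    unfolding Inn_eq A.normal_inv_iff
    using aut_inner_aut subgroup_img_is_subgroup[OF subgroup_self] by auto
qed

lemma Out_proj_hom: "group_hom (AutoGroup G) (Out G) (Out_proj G)"
  unfolding Out_def Out_proj_def[abs_def]
  by (intro group_hom.intro group_hom_axioms.intro AutoGroup normal.factorgroup_is_group
      normal.r_coset_hom_Mod Inn_normal)

lemma Out_proj_eq_iff:
  assumes "\<alpha> \<in> carrier (AutoGroup G)" "\<beta> \<in> carrier (AutoGroup G)"
  shows "Out_proj G \<alpha> = Out_proj G \<beta> \<longleftrightarrow> (\<exists>g\<in>carrier G. \<alpha> = inner_aut G g \<otimes>\<^bsub>AutoGroup G\<^esub> \<beta>)"
proof -
  interpret A: group "AutoGroup G" by (rule AutoGroup)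
  interpret subgroup "Inn G" "AutoGroup G" using Inn_normal normal_imp_subgroup by blast
  have "Out_proj G \<alpha> = Out_proj G \<beta> \<longleftrightarrow> \<alpha> \<in> Inn G #>\<^bsub>AutoGroup G\<^esub> \<beta>"
    unfolding Out_proj_def
    using A.repr_independence A.rcos_self assms subgroup_axioms by metis
  also have "\<dots> \<longleftrightarrow> (\<exists>g\<in>carrier G. \<alpha> = inner_aut G g \<otimes>\<^bsub>AutoGroup G\<^esub> \<beta>)"
    by (auto simp: Inn_eq r_coset_def)
  finally show ?thesis .
qed

lemma outer_johnson_filtration_N_series: "N_series (Out G) (outer_johnson_filtration G)"
  unfolding outer_johnson_filtration_def[abs_def]
  by (rule N_series_image[OF johnson_filtration_N_series Out_proj_hom])

end

section \<open>Graded Lie algebras\<close>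

declare One_nat_def [simp del]

lemma one_le_Suc [simp]: "1 \<le> Suc n"
  by (simp add: One_nat_def)

text \<open>The graded records add \<open>bracket\<close> and \<open>component\<close> to the
  operations of a known group, so they are not literally that group; this transports the group
  axioms to them.\<close>

lemma comm_group_cong:
  assumes "comm_group B"
    and eq: "carrier A = carrier B" "monoid.mult A = monoid.mult B" "one A = one B"
  shows "comm_group A"
proof -
  interpret comm_group B by fact
  show ?thesis
    by (rule comm_groupI) (auto simp: eq m_assoc intro: l_inv_ex m_comm)
qed

section \<open>Internal direct sums\<close>

lemma (in comm_group) gfinprod_induct:
  assumes "f \<in> A \<rightarrow> carrier G" "P \<one>" "\<And>s. s \<in> A \<Longrightarrow> P (f s)"
    and "\<And>x y. \<lbrakk>x \<in> carrier G; y \<in> carrier G; P x; P y\<rbrakk> \<Longrightarrow> P (x \<otimes> y)"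
  shows "P (gfinprod G f A)"
proof -
  have "P (finprod G f B)" if "finite B" "B \<subseteq> A" for B
    using that
  proof (induction B rule: finite_induct)
    case (insert b B)
    then show ?case
      using assms by (subst finprod_insert) (auto intro!: assms(4) finprod_closed)
  qed (use assms in simp)
  then show ?thesis using assms(2) by (simp add: gfinprod_def)
qed

lemma (in comm_group) gfinprod_single:
  assumes "i \<in> A" "x \<in> carrier G"
  shows "gfinprod G (\<lambda>s\<in>A. if s = i then x else \<one>) A = x"
proof -
  have "gfinprod G (\<lambda>s\<in>A. if s = i then x else \<one>) A = gfinprod G (\<lambda>s. x) {i}"
    by (rule gfinprod_mono_neutral_cong_right) (use assms in auto)
  then show ?thesis using assms by (simp add: gfinprod_insert)
qed

lemma (in group_hom) hom_comp_generate_subset: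
  assumes "K \<subseteq> carrier G" "\<And>x. x \<in> K \<Longrightarrow> h x \<in> J" "subgroup J H" "x \<in> generate G K"
  shows "h x \<in> J"
proof -
  have "h ` generate G K = generate H (h ` K)" using generate_img[OF assms(1)] by simp
  also have "\<dots> \<subseteq> J" using assms by (intro H.generate_subgroup_incl) auto
  finally show ?thesis using assms(4) by blast
qed

text \<open>Independence is asked one element at a time: a nontrivial x in \<open>C n\<close> must
  be detected by some homomorphism that kills the other components. The target K is free, so that
  for derivations an evaluation map into the Lie algebra can serve.\<close>

lemma (in comm_group) direct_sum_isoI:
  fixes K :: "('c, 'k) monoid_scheme"
  assumes sub: "\<And>s. 1 \<le> s \<Longrightarrow> subgroup (C s) G"
    and gen: "\<And>H. \<lbrakk>subgroup H G; \<And>s. 1 \<le> s \<Longrightarrow> C s \<subseteq> H\<rbrakk> \<Longrightarrow> carrier G \<subseteq> H"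
    and K: "group K"
    and sep: "\<And>n x. \<lbrakk>1 \<le> n; x \<in> C n; x \<noteq> \<one>\<rbrakk>
      \<Longrightarrow> \<exists>p\<in>hom G K. p x \<noteq> \<one>\<^bsub>K\<^esub> \<and> (\<forall>s\<ge>1. s \<noteq> n \<longrightarrow> p ` C s \<subseteq> {\<one>\<^bsub>K\<^esub>})"
  shows "(\<lambda>f. gfinprod G f {1::nat..}) \<in> iso (sum_group {1..} (\<lambda>s. G\<lparr>carrier := C s\<rparr>)) G"
proof -
  let ?S = "sum_group {1::nat..} (\<lambda>s. G\<lparr>carrier := C s\<rparr>)"
  let ?\<Phi> = "\<lambda>f. gfinprod G f {1::nat..}"
  have gs: "\<And>s. s \<in> {1..} \<Longrightarrow> group (G\<lparr>carrier := C s\<rparr>)"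
    using sub subgroup.subgroup_is_group group_axioms by auto
  have carr: "carrier ?S = {f \<in> \<Pi>\<^sub>E s\<in>{1..}. C s. finite {s \<in> {1..}. f s \<noteq> \<one>}}"
    using gs by (subst carrier_sum_group) auto
  have Cc: "x \<in> carrier G" if "1 \<le> s" "x \<in> C s" for s x
    using sub that subgroup.mem_carrier by metis
  have S: "group ?S" using gs by (rule sum_group)
  have hom: "?\<Phi> \<in> hom ?S G"
  proof (rule homI)
    show "?\<Phi> f \<in> carrier G" if "f \<in> carrier ?S" for f
      using that by (intro gfinprod_closed) (auto simp: carr intro!: Cc)
    fix f g assume f: "f \<in> carrier ?S" and g: "g \<in> carrier ?S"
    have fg: "f s \<in> carrier G" "g s \<in> carrier G" if "1 \<le> s" for s
      using f g that by (auto simp: carr intro!: Cc)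
    have "?\<Phi> (f \<otimes>\<^bsub>?S\<^esub> g) = ?\<Phi> (\<lambda>s. f s \<otimes> g s)"
      using fg by (intro gfinprod_cong) auto
    then show "?\<Phi> (f \<otimes>\<^bsub>?S\<^esub> g) = ?\<Phi> f \<otimes> ?\<Phi> g"
      using f g fg by (subst (asm) gfinprod_distrib) (auto simp: carr)
  qed
  interpret \<Phi>: group_hom ?S G ?\<Phi>
    using S hom group_axioms by (simp add: group_hom_def group_hom_axioms_def)
  have inj: "f = \<one>\<^bsub>?S\<^esub>" if f: "f \<in> carrier ?S" and f1: "?\<Phi> f = \<one>" for f
  proof -
    have "f n = \<one>" if n: "1 \<le> n" for n
    proof (rule ccontr)
      assume ne: "f n \<noteq> \<one>"
      have "f n \<in> C n" using f n by (auto simp: carr)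
      from sep[OF n this ne] obtain p where p: "p \<in> hom G K" and pn: "p (f n) \<noteq> \<one>\<^bsub>K\<^esub>"
        and ps: "\<And>s. \<lbrakk>1 \<le> s; s \<noteq> n\<rbrakk> \<Longrightarrow> p ` C s \<subseteq> {\<one>\<^bsub>K\<^esub>}" by blast
      interpret p: group_hom G K p
        using p K group_axioms by (simp add: group_hom_def group_hom_axioms_def)
      \<comment> \<open>Split off degree n: d carries \<open>f n\<close> and g the rest. As p kills
        the sum of g, triviality of the sum of f forces \<open>p (f n)\<close> to be
        trivial.\<close>
      let ?g = "\<lambda>s\<in>{1..}. if s = n then \<one> else f s" and ?d = "\<lambda>s\<in>{1..}. if s = n then f n else \<one>"
      have fc: "f s \<in> carrier G" if "1 \<le> s" for s using f that Cc by (auto simp: carr)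
      have "?\<Phi> f = ?\<Phi> (\<lambda>s. ?d s \<otimes> ?g s)"
        using fc n by (intro gfinprod_cong) (auto simp: simp_implies_def)
      also have "\<dots> = ?\<Phi> ?d \<otimes> ?\<Phi> ?g"
      proof (rule gfinprod_distrib)
        show "finite {x \<in> {1..}. ?d x \<noteq> \<one>}" by (rule finite_subset[of _ "{n}"]) auto
        show "finite {x \<in> {1..}. ?g x \<noteq> \<one>}"
          by (rule finite_subset[of _ "{s \<in> {1..}. f s \<noteq> \<one>}"]) (use f in \<open>auto simp: carr\<close>)
      qed (use fc n in auto)
      also have "?\<Phi> ?d = f n" using n fc by (intro gfinprod_single) auto
      finally have fg: "?\<Phi> f = f n \<otimes> ?\<Phi> ?g" .
      have gc: "?\<Phi> ?g \<in> carrier G" using fc by (intro gfinprod_closed) auto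
      have "p (f n \<otimes> ?\<Phi> ?g) = p \<one>" by (rule arg_cong[OF trans[OF fg[symmetric] f1]])
      then have "p (f n) \<otimes>\<^bsub>K\<^esub> p (?\<Phi> ?g) = \<one>\<^bsub>K\<^esub>"
        unfolding p.hom_mult[OF fc[OF n] gc] p.hom_one .
      moreover have "p (?\<Phi> ?g) = \<one>\<^bsub>K\<^esub>"
      proof (rule gfinprod_induct)
        show "p (?g s) = \<one>\<^bsub>K\<^esub>" if "s \<in> {1..}" for s
          using that ps[of s] f by (auto simp: carr)
      qed (use fc in auto)
      ultimately show False using pn p.hom_closed[OF fc[OF n]] by (simp only: p.H.r_one)
    qed
    then show ?thesis using f by (intro ext) (auto simp: carr PiE_def extensional_def)
  qed
  have surj: "carrier G \<subseteq> ?\<Phi> ` carrier ?S"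
  proof (rule gen)
    show "subgroup (?\<Phi> ` carrier ?S) G"
      by (rule \<Phi>.img_is_subgroup)
    show "C s \<subseteq> ?\<Phi> ` carrier ?S" if s: "1 \<le> s" for s
    proof
      fix x assume x: "x \<in> C s"
      let ?f = "\<lambda>t\<in>{1..}. if t = s then x else \<one>"
      have "finite {t \<in> {1..}. ?f t \<noteq> \<one>}" by (rule finite_subset[of _ "{s}"]) auto
      moreover have "\<one> \<in> C t" if "1 \<le> t" for t using sub[OF that] subgroup.one_closed by metis
      ultimately have f: "?f \<in> carrier ?S" using s x by (auto simp: carr)
      have "x = ?\<Phi> ?f" using s x Cc by (intro gfinprod_single[symmetric]) auto
      then show "x \<in> ?\<Phi> ` carrier ?S" using f by (rule image_eqI)
    qed
  qed
  show ?thesis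
    unfolding \<Phi>.iso_iff using surj inj by auto
qed

context graded_lie_algebra
begin

lemma component_closed: "\<lbrakk>1 \<le> s; x \<in> component L s\<rbrakk> \<Longrightarrow> x \<in> carrier L"
  using component_subgroup subgroup.mem_carrier by metis

lemma carrier_component_sum:
  "carrier (sum_group {1..} (\<lambda>s. L\<lparr>carrier := component L s\<rparr>))
    = {f \<in> \<Pi>\<^sub>E s\<in>{1..}. component L s. finite {s \<in> {1..}. f s \<noteq> \<one>}}"
  using component_subgroup subgroup.subgroup_is_group is_group by (subst carrier_sum_group) auto

lemma graded_induct [consumes 1, case_names one component mult]:
  assumes "x \<in> carrier L" "P \<one>" "\<And>s x. \<lbrakk>1 \<le> s; x \<in> component L s\<rbrakk> \<Longrightarrow> P x"
    and "\<And>x y. \<lbrakk>x \<in> carrier L; y \<in> carrier L; P x; P y\<rbrakk> \<Longrightarrow> P (x \<otimes> y)"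
  shows "P x"
proof -
  have "x \<in> (\<lambda>f. gfinprod L f {1..}) ` carrier (sum_group {1..} (\<lambda>s. L\<lparr>carrier := component L s\<rparr>))"
    using direct_sum assms(1) by (auto simp: iso_def bij_betw_def)
  then obtain f where x: "x = gfinprod L f {1..}"
    and f: "f \<in> (\<Pi>\<^sub>E s\<in>{1..}. component L s)"
    by (auto simp: carrier_component_sum)
  have fs: "f s \<in> component L s" if "s \<in> {1..}" for s using f that by auto
  show ?thesis
    unfolding x
  proof (rule gfinprod_induct)
    show "f \<in> {1..} \<rightarrow> carrier L" using fs component_closed by auto
    show "P (f s)" if "s \<in> {1..}" for s using fs[OF that] that assms(3)[of s] by auto
  qed (use assms in auto)
qed

text \<open>The n-th coordinate of the inverse of the direct sum isomorphism. Only its values on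
  components are recorded, since these determine it.\<close>

lemma component_projection:
  assumes n: "1 \<le> n"
  obtains p where "p \<in> hom L L" "\<And>x. x \<in> component L n \<Longrightarrow> p x = x"
    "\<And>s x. \<lbrakk>1 \<le> s; s \<noteq> n; x \<in> component L s\<rbrakk> \<Longrightarrow> p x = \<one>"
proof -
  let ?S = "sum_group {1..} (\<lambda>s. L\<lparr>carrier := component L s\<rparr>)"
  let ?\<Phi> = "\<lambda>f. gfinprod L f {1..}"
  define q where "q = inv_into (carrier ?S) ?\<Phi>"
  have "group ?S"
    using component_subgroup subgroup.subgroup_is_group is_group by (intro sum_group) auto
  then have q: "q \<in> iso L ?S" unfolding q_def using direct_sum by (rule group.iso_set_sym)
  then have qh: "q \<in> hom L ?S" by (simp add: iso_def)
  let ?p = "\<lambda>x. q x n"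
  have inj: "inj_on ?\<Phi> (carrier ?S)" using direct_sum by (simp add: iso_def bij_betw_def)
  have *: "q x = (\<lambda>t\<in>{1..}. if t = s then x else \<one>)" if s: "1 \<le> s" and x: "x \<in> component L s" for s x
  proof -
    let ?f = "\<lambda>t\<in>{1..}. if t = s then x else \<one>"
    have "finite {t \<in> {1..}. ?f t \<noteq> \<one>}" by (rule finite_subset[of _ "{s}"]) auto
    moreover have "\<one> \<in> component L t" if "1 \<le> t" for t
      using component_subgroup[OF that] subgroup.one_closed by metis
    ultimately have f: "?f \<in> carrier ?S" using s x by (auto simp: carrier_component_sum)
    have "?\<Phi> ?f = x" using s x component_closed by (intro gfinprod_single) auto
    then show ?thesis using inv_into_f_f[OF inj f] by (simp add: q_def)
  qed
  have "?p \<in> hom L L"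
  proof (rule homI)
    show "?p x \<in> carrier L" if "x \<in> carrier L" for x
      using hom_in_carrier[OF qh that] n component_closed by (auto simp: carrier_component_sum)
    show "?p (x \<otimes> y) = ?p x \<otimes> ?p y" if "x \<in> carrier L" "y \<in> carrier L" for x y
      using hom_mult[OF qh that] n by simp
  qed
  then show thesis
    by (rule that) (use n * in auto)
qed

lemma bracket_hom_left: "z \<in> carrier L \<Longrightarrow> group_hom L L (\<lambda>x. bracket L x z)"
  by (intro group_hom.intro group_hom_axioms.intro homI is_group)
    (auto simp: bracket_closed bracket_add_left)

lemma bracket_hom_right: "x \<in> carrier L \<Longrightarrow> group_hom L L (bracket L x)"
  by (intro group_hom.intro group_hom_axioms.intro homI is_group)
    (auto simp: bracket_closed bracket_add_right)

lemma bracket_inv_left: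
  "\<lbrakk>x \<in> carrier L; z \<in> carrier L\<rbrakk> \<Longrightarrow> bracket L (inv x) z = inv (bracket L x z)"
  using group_hom.hom_inv[OF bracket_hom_left] by auto

lemma bracket_inv_right:
  "\<lbrakk>x \<in> carrier L; z \<in> carrier L\<rbrakk> \<Longrightarrow> bracket L x (inv z) = inv (bracket L x z)"
  using group_hom.hom_inv[OF bracket_hom_right] by auto

lemma bracket_one_left: "z \<in> carrier L \<Longrightarrow> bracket L \<one> z = \<one>"
  using group_hom.hom_one[OF bracket_hom_left] by auto

lemma bracket_one_right: "x \<in> carrier L \<Longrightarrow> bracket L x \<one> = \<one>"
  using group_hom.hom_one[OF bracket_hom_right] by auto

lemma bracket_skew:
  assumes "x \<in> carrier L" "y \<in> carrier L"
  shows "bracket L y x = inv (bracket L x y)"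
proof -
  have "bracket L (x \<otimes> y) (x \<otimes> y) = bracket L x y \<otimes> bracket L y x"
    using assms by (simp add: bracket_add_left bracket_add_right bracket_alternating[of x]
        bracket_alternating[of y] bracket_closed m_comm[OF bracket_closed bracket_closed])
  then have "bracket L y x \<otimes> bracket L x y = \<one>"
    using assms bracket_alternating[of "x \<otimes> y"] bracket_closed m_comm by simp
  then show ?thesis using assms bracket_closed inv_equality by metis
qed

text \<open>Jacobi rearranged by skew-symmetry into the statement that bracketing with x is a
  derivation.\<close>

lemma bracket_leibniz:
  assumes x: "x \<in> carrier L" and y: "y \<in> carrier L" and z: "z \<in> carrier L"
  shows "bracket L x (bracket L y z) = bracket L (bracket L x y) z \<otimes> bracket L y (bracket L x z)"
proof -
  note c = bracket_closed x y z
  have "bracket L y (bracket L z x) = inv (bracket L y (bracket L x z))"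
    using c bracket_skew[OF x z] by (simp add: bracket_inv_right)
  moreover have "bracket L z (bracket L x y) = inv (bracket L (bracket L x y) z)"
    using c bracket_skew[of "bracket L x y" z] by simp
  ultimately have "bracket L x (bracket L y z) \<otimes> inv (bracket L y (bracket L x z))
      \<otimes> inv (bracket L (bracket L x y) z) = \<one>"
    using jacobi[OF x y z] by simp
  then show ?thesis
    using c by (metis (no_types, lifting) inv_closed inv_solve_right l_one m_closed)
qed

end

subsection \<open>Derivations\<close>

text \<open>Leibniz maps without a prescribed degree. This set is closed under sums, so all of
  \<open>carrier (Der L)\<close> lies in it and identities can be proved without splitting into
  degrees.\<close>

definition leibniz_maps :: "('a, 'm) graded_lie_scheme \<Rightarrow> ('a \<Rightarrow> 'a) set" where
  "leibniz_maps L =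
    {\<delta> \<in> hom L L \<inter> extensional (carrier L).
      \<forall>x\<in>carrier L. \<forall>y\<in>carrier L.
        \<delta> (bracket L x y) = bracket L (\<delta> x) y \<otimes>\<^bsub>L\<^esub> bracket L x (\<delta> y)}"

lemma derivations_eq:
  "derivations L s = {\<delta> \<in> leibniz_maps L. \<forall>t\<ge>1. \<delta> ` component L t \<subseteq> component L (s + t)}"
  by (auto simp: derivations_def leibniz_maps_def)

lemma mult_Der: "\<delta> \<otimes>\<^bsub>Der L\<^esub> \<epsilon> = (\<lambda>x\<in>carrier L. \<delta> x \<otimes>\<^bsub>L\<^esub> \<epsilon> x)"
  by (simp add: Der_def Let_def)

lemma one_Der: "\<one>\<^bsub>Der L\<^esub> = (\<lambda>x\<in>carrier L. \<one>\<^bsub>L\<^esub>)"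
  by (simp add: Der_def Let_def)

lemma bracket_Der:
  "bracket (Der L) \<delta> \<epsilon> = (\<lambda>x\<in>carrier L. \<delta> (\<epsilon> x) \<otimes>\<^bsub>L\<^esub> inv\<^bsub>L\<^esub> (\<epsilon> (\<delta> x)))"
  by (simp add: Der_def Let_def)

lemma component_Der: "component (Der L) = derivations L"
  by (simp add: Der_def Let_def)

context comm_group
begin

lemma mult_interchange:
  "\<lbrakk>a \<in> carrier G; b \<in> carrier G; c \<in> carrier G; d \<in> carrier G\<rbrakk>
    \<Longrightarrow> (a \<otimes> b) \<otimes> (c \<otimes> d) = (a \<otimes> c) \<otimes> (b \<otimes> d)"
  by (simp add: m_ac)

text \<open>For derivations \<delta> and \<epsilon>, the letters b and c are the mixed terms
  [\<epsilon> x, \<delta> y] and [\<delta> x, \<epsilon> y], which occur in both compositions and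
  cancel in the commutator.\<close>

lemma commutator_leibniz_aux:
  assumes "a \<in> carrier G" "b \<in> carrier G" "c \<in> carrier G" "d \<in> carrier G" "e \<in> carrier G" "f \<in> carrier G"
  shows "((a \<otimes> b) \<otimes> (c \<otimes> d)) \<otimes> inv ((e \<otimes> c) \<otimes> (b \<otimes> f)) = (a \<otimes> inv e) \<otimes> (d \<otimes> inv f)"
proof -
  \<comment> \<open>Inverses are first replaced by independent elements, so that only commutativity
    and associativity are involved; the inverses are substituted afterwards.\<close>
  have "((a \<otimes> b) \<otimes> (c \<otimes> d)) \<otimes> ((e' \<otimes> c') \<otimes> (b' \<otimes> f'))
    = ((b \<otimes> b') \<otimes> (c \<otimes> c')) \<otimes> ((a \<otimes> e') \<otimes> (d \<otimes> f'))"
    if "b' \<in> carrier G" "c' \<in> carrier G" "e' \<in> carrier G" "f' \<in> carrier G" for b' c' e' f'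
    using assms that by (simp add: m_ac)
  from this[of "inv b" "inv c" "inv e" "inv f"] show ?thesis using assms by (simp add: inv_mult)
qed

text \<open>The six letters are the six triple compositions of three derivations; each occurs twice,
  with opposite signs.\<close>

lemma commutator_jacobi_aux:
  assumes "a \<in> carrier G" "b \<in> carrier G" "c \<in> carrier G" "d \<in> carrier G" "e \<in> carrier G" "f \<in> carrier G"
  shows "((a \<otimes> inv b) \<otimes> inv (c \<otimes> inv d)) \<otimes> ((c \<otimes> inv e) \<otimes> inv (f \<otimes> inv b))
    \<otimes> ((f \<otimes> inv d) \<otimes> inv (a \<otimes> inv e)) = \<one>"
proof -
  have "((a \<otimes> b') \<otimes> (c' \<otimes> d)) \<otimes> ((c \<otimes> e') \<otimes> (f' \<otimes> b)) \<otimes> ((f \<otimes> d') \<otimes> (a' \<otimes> e))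
    = (a \<otimes> a') \<otimes> (b \<otimes> b') \<otimes> (c \<otimes> c') \<otimes> (d \<otimes> d') \<otimes> (e \<otimes> e') \<otimes> (f \<otimes> f')"
    if "a' \<in> carrier G" "b' \<in> carrier G" "c' \<in> carrier G" "d' \<in> carrier G" "e' \<in> carrier G" "f' \<in> carrier G"
    for a' b' c' d' e' f'
    using assms that by (simp add: m_ac)
  from this[of "inv a" "inv b" "inv c" "inv d" "inv e" "inv f"] show ?thesis using assms by (simp add: inv_mult)
qed

end

context graded_lie_algebra
begin

abbreviation (input) maps :: "('a \<Rightarrow> 'a) monoid" where
  "maps \<equiv> product_group (carrier L) (\<lambda>_. L)"

lemma comm_group_maps: "comm_group maps"
  using is_group by (intro group.group_comm_groupI product_group) (auto simp: m_comm PiE_iff)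

lemma leibniz_mapsD:
  assumes "\<delta> \<in> leibniz_maps L"
  shows "group_hom L L \<delta>" "\<And>x. x \<in> carrier L \<Longrightarrow> \<delta> x \<in> carrier L" "\<delta> \<one> = \<one>"
    "\<And>x. x \<in> carrier L \<Longrightarrow> \<delta> (inv x) = inv (\<delta> x)"
    "\<And>x y. \<lbrakk>x \<in> carrier L; y \<in> carrier L\<rbrakk> \<Longrightarrow> \<delta> (x \<otimes> y) = \<delta> x \<otimes> \<delta> y"
    "\<And>x y. \<lbrakk>x \<in> carrier L; y \<in> carrier L\<rbrakk>
      \<Longrightarrow> \<delta> (bracket L x y) = bracket L (\<delta> x) y \<otimes> bracket L x (\<delta> y)"
proof -
  show h: "group_hom L L \<delta>"
    using assms is_group by (simp add: leibniz_maps_def group_hom_def group_hom_axioms_def)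
  show "\<And>x. x \<in> carrier L \<Longrightarrow> \<delta> x \<in> carrier L" using group_hom.hom_closed[OF h] .
  show "\<delta> \<one> = \<one>" using group_hom.hom_one[OF h] .
  show "\<And>x. x \<in> carrier L \<Longrightarrow> \<delta> (inv x) = inv (\<delta> x)" using group_hom.hom_inv[OF h] .
  show "\<And>x y. \<lbrakk>x \<in> carrier L; y \<in> carrier L\<rbrakk> \<Longrightarrow> \<delta> (x \<otimes> y) = \<delta> x \<otimes> \<delta> y"
    using group_hom.hom_mult[OF h] .
qed (use assms in \<open>auto simp: leibniz_maps_def\<close>)

lemma leibniz_mapsI:
  assumes "\<And>x. x \<in> carrier L \<Longrightarrow> f x \<in> carrier L"
    and "\<And>x y. \<lbrakk>x \<in> carrier L; y \<in> carrier L\<rbrakk> \<Longrightarrow> f (x \<otimes> y) = f x \<otimes> f y"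
    and "\<And>x y. \<lbrakk>x \<in> carrier L; y \<in> carrier L\<rbrakk>
      \<Longrightarrow> f (bracket L x y) = bracket L (f x) y \<otimes> bracket L x (f y)"
  shows "(\<lambda>x\<in>carrier L. f x) \<in> leibniz_maps L"
  using assms by (auto simp: leibniz_maps_def hom_def bracket_closed)

lemma leibniz_maps_subgroup: "subgroup (leibniz_maps L) maps"
proof
  show "leibniz_maps L \<subseteq> carrier maps"
    by (auto simp: leibniz_maps_def hom_def PiE_def)
  show "\<one>\<^bsub>maps\<^esub> \<in> leibniz_maps L"
    by (auto intro!: leibniz_mapsI simp: bracket_one_left bracket_one_right)
  show "\<delta> \<otimes>\<^bsub>maps\<^esub> \<epsilon> \<in> leibniz_maps L" if "\<delta> \<in> leibniz_maps L" "\<epsilon> \<in> leibniz_maps L" for \<delta> \<epsilon>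
    using that leibniz_mapsD[OF that(1)] leibniz_mapsD[OF that(2)]
    by (auto intro!: leibniz_mapsI
        simp: bracket_add_left bracket_add_right bracket_closed mult_interchange)
  show "inv\<^bsub>maps\<^esub> \<delta> \<in> leibniz_maps L" if "\<delta> \<in> leibniz_maps L" for \<delta>
  proof -
    have "\<delta> \<in> carrier maps" using that by (auto simp: leibniz_maps_def hom_def PiE_def)
    then have "inv\<^bsub>maps\<^esub> \<delta> = (\<lambda>x\<in>carrier L. inv (\<delta> x))" using is_group by simp
    then show ?thesis
      using leibniz_mapsD[OF that]
      by (auto intro!: leibniz_mapsI simp: bracket_inv_left bracket_inv_right bracket_closed inv_mult)
  qed
qed

lemma derivations_subgroup: "subgroup (derivations L s) maps"
proof
  note S = leibniz_maps_subgroup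
  note C = component_subgroup[THEN subgroup.m_closed] component_subgroup[THEN subgroup.m_inv_closed]
    component_subgroup[THEN subgroup.one_closed]
  show "derivations L s \<subseteq> carrier maps"
    using subgroup.subset[OF S] by (auto simp: derivations_eq)
  show "\<one>\<^bsub>maps\<^esub> \<in> derivations L s"
    using subgroup.one_closed[OF S] C component_closed by (auto simp: derivations_eq)
  show "\<delta> \<otimes>\<^bsub>maps\<^esub> \<epsilon> \<in> derivations L s" if "\<delta> \<in> derivations L s" "\<epsilon> \<in> derivations L s" for \<delta> \<epsilon>
    using that subgroup.m_closed[OF S, of \<delta> \<epsilon>] C component_closed by (auto simp: derivations_eq image_subset_iff)
  show "inv\<^bsub>maps\<^esub> \<delta> \<in> derivations L s" if "\<delta> \<in> derivations L s" for \<delta>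
  proof -
    have "\<delta> \<in> carrier maps" using that subgroup.subset[OF S] by (auto simp: derivations_eq)
    then have "inv\<^bsub>maps\<^esub> \<delta> = (\<lambda>x\<in>carrier L. inv (\<delta> x))" using is_group by simp
    then show ?thesis
      using that subgroup.m_inv_closed[OF S, of \<delta>] C component_closed by (auto simp: derivations_eq image_subset_iff)
  qed
qed

lemma carrier_Der:
  "carrier (Der L) = generate maps (carrier maps \<inter> (\<Union>s\<in>{1..}. derivations L s))"
  by (simp add: Der_def Let_def carrier_subgroup_generated)

lemma comm_group_Der: "comm_group (Der L)"
proof (rule comm_group_cong)
  interpret M: comm_group maps by (rule comm_group_maps)
  show "comm_group (subgroup_generated maps (\<Union>s\<in>{1..}. derivations L s))"
    by (rule M.abelian_subgroup_generated[OF comm_group_maps])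
qed (simp_all add: Der_def Let_def)

lemma derivations_subset_Der: "1 \<le> s \<Longrightarrow> derivations L s \<subseteq> carrier (Der L)"
  unfolding carrier_Der using subgroup.subset[OF derivations_subgroup] by (blast intro: generate.incl)

text \<open>There is no case for inverses because the inverse of a homogeneous derivation is
  homogeneous of the same degree.\<close>

lemma Der_induct [consumes 1, case_names one derivation mult]:
  assumes "\<delta> \<in> carrier (Der L)" "P \<one>\<^bsub>Der L\<^esub>"
    and "\<And>s \<delta>. \<lbrakk>1 \<le> s; \<delta> \<in> derivations L s\<rbrakk> \<Longrightarrow> P \<delta>"
    and "\<And>\<delta> \<epsilon>. \<lbrakk>\<delta> \<in> carrier (Der L); \<epsilon> \<in> carrier (Der L); P \<delta>; P \<epsilon>\<rbrakk> \<Longrightarrow> P (\<delta> \<otimes>\<^bsub>Der L\<^esub> \<epsilon>)"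
  shows "P \<delta>"
proof -
  have "\<delta> \<in> generate maps (carrier maps \<inter> (\<Union>s\<in>{1..}. derivations L s))"
    using assms(1) unfolding carrier_Der .
  then show ?thesis
  proof (induction \<delta> rule: generate.induct)
    case one
    then show ?case using assms(2) unfolding one_Der one_product_group .
  next
    case (incl h)
    then show ?case using assms(3) by auto
  next
    case (inv h)
    then show ?case using assms(3) subgroup.m_inv_closed[OF derivations_subgroup] by blast
  next
    case (eng h1 h2)
    then have "P (h1 \<otimes>\<^bsub>Der L\<^esub> h2)" by (intro assms(4)) (simp_all add: carrier_Der)
    then show ?case unfolding mult_Der mult_product_group .
  qed
qed

lemma Der_subset_leibniz_maps: "carrier (Der L) \<subseteq> leibniz_maps L"
proof
  fix \<delta> assume "\<delta> \<in> carrier (Der L)"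
  then show "\<delta> \<in> leibniz_maps L"
  proof (induction rule: Der_induct)
    case one
    then show ?case using subgroup.one_closed[OF leibniz_maps_subgroup] unfolding one_Der one_product_group .
  next
    case (derivation s \<delta>)
    then show ?case by (simp add: derivations_eq)
  next
    case (mult \<delta> \<epsilon>)
    show ?case
      using subgroup.m_closed[OF leibniz_maps_subgroup mult(3,4)] unfolding mult_Der mult_product_group .
  qed
qed

lemmas DerD = leibniz_mapsD[OF subsetD[OF Der_subset_leibniz_maps]]

lemma Der_eqI:
  assumes "\<delta> \<in> extensional (carrier L)" "\<epsilon> \<in> extensional (carrier L)"
    and "\<And>s x. \<lbrakk>1 \<le> s; x \<in> component L s\<rbrakk> \<Longrightarrow> \<delta> x = \<epsilon> x"
    and "\<delta> \<in> hom L L" "\<epsilon> \<in> hom L L"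
  shows "\<delta> = \<epsilon>"
proof (rule extensionalityI[OF assms(1,2)])
  interpret \<delta>: group_hom L L \<delta> using assms(4) is_group by (simp add: group_hom_def group_hom_axioms_def)
  interpret \<epsilon>: group_hom L L \<epsilon> using assms(5) is_group by (simp add: group_hom_def group_hom_axioms_def)
  fix x assume "x \<in> carrier L"
  then show "\<delta> x = \<epsilon> x"
    by (induction rule: graded_induct) (use assms(3) in auto)
qed

lemma leibniz_maps_commutator:
  assumes \<delta>: "\<delta> \<in> leibniz_maps L" and \<epsilon>: "\<epsilon> \<in> leibniz_maps L"
  shows "bracket (Der L) \<delta> \<epsilon> \<in> leibniz_maps L"
  unfolding bracket_Der
proof (rule leibniz_mapsI)
  note D = leibniz_mapsD(2-)[OF \<delta>] leibniz_mapsD(2-)[OF \<epsilon>]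
  show "\<delta> (\<epsilon> x) \<otimes> inv (\<epsilon> (\<delta> x)) \<in> carrier L" if "x \<in> carrier L" for x
    using that D by simp
  fix x y assume x: "x \<in> carrier L" and y: "y \<in> carrier L"
  show "\<delta> (\<epsilon> (x \<otimes> y)) \<otimes> inv (\<epsilon> (\<delta> (x \<otimes> y))) =
      \<delta> (\<epsilon> x) \<otimes> inv (\<epsilon> (\<delta> x)) \<otimes> (\<delta> (\<epsilon> y) \<otimes> inv (\<epsilon> (\<delta> y)))"
    using x y D by (simp add: inv_mult mult_interchange)
  have "\<delta> (\<epsilon> (bracket L x y)) = (bracket L (\<delta> (\<epsilon> x)) y \<otimes> bracket L (\<epsilon> x) (\<delta> y))
      \<otimes> (bracket L (\<delta> x) (\<epsilon> y) \<otimes> bracket L x (\<delta> (\<epsilon> y)))"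
    using x y D by (simp add: bracket_closed)
  moreover have "\<epsilon> (\<delta> (bracket L x y)) = (bracket L (\<epsilon> (\<delta> x)) y \<otimes> bracket L (\<delta> x) (\<epsilon> y))
      \<otimes> (bracket L (\<epsilon> x) (\<delta> y) \<otimes> bracket L x (\<epsilon> (\<delta> y)))"
    using x y D by (simp add: bracket_closed)
  ultimately show "\<delta> (\<epsilon> (bracket L x y)) \<otimes> inv (\<epsilon> (\<delta> (bracket L x y)))
    = bracket L (\<delta> (\<epsilon> x) \<otimes> inv (\<epsilon> (\<delta> x))) y \<otimes> bracket L x (\<delta> (\<epsilon> y) \<otimes> inv (\<epsilon> (\<delta> y)))"
    using x y D by (simp only: commutator_leibniz_aux bracket_closed)
      (simp add: bracket_add_left bracket_add_right bracket_inv_left bracket_inv_right)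
qed

lemma bracket_Der_add:
  assumes "\<delta> \<in> leibniz_maps L" "\<delta>' \<in> leibniz_maps L" "\<epsilon> \<in> leibniz_maps L"
  shows "bracket (Der L) (\<delta> \<otimes>\<^bsub>Der L\<^esub> \<delta>') \<epsilon> = bracket (Der L) \<delta> \<epsilon> \<otimes>\<^bsub>Der L\<^esub> bracket (Der L) \<delta>' \<epsilon>"
    and "bracket (Der L) \<epsilon> (\<delta> \<otimes>\<^bsub>Der L\<^esub> \<delta>') = bracket (Der L) \<epsilon> \<delta> \<otimes>\<^bsub>Der L\<^esub> bracket (Der L) \<epsilon> \<delta>'"
  using leibniz_mapsD(2-)[OF assms(1)] leibniz_mapsD(2-)[OF assms(2)] leibniz_mapsD(2-)[OF assms(3)]
  by (auto simp: bracket_Der mult_Der inv_mult mult_interchange intro!: restrict_ext)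

lemma derivations_bracket:
  assumes "\<delta> \<in> derivations L s" "\<epsilon> \<in> derivations L t" "1 \<le> s" "1 \<le> t"
  shows "bracket (Der L) \<delta> \<epsilon> \<in> derivations L (s + t)"
proof -
  have l: "\<delta> \<in> leibniz_maps L" "\<epsilon> \<in> leibniz_maps L" using assms by (auto simp: derivations_eq)
  have "bracket (Der L) \<delta> \<epsilon> x \<in> component L (s + t + u)" if u: "1 \<le> u" and x: "x \<in> component L u" for u x
  proof -
    have deg: "\<delta> y \<in> component L (s + v)" "\<epsilon> y \<in> component L (t + v)" if "1 \<le> v" "y \<in> component L v" for v y
      using assms that unfolding derivations_eq by blast+
    have "\<delta> (\<epsilon> x) \<in> component L (s + (t + u))" "\<epsilon> (\<delta> x) \<in> component L (t + (s + u))"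
      using u x by (auto intro!: deg)
    moreover have "t + (s + u) = s + t + u" "s + (t + u) = s + t + u" by auto
    ultimately show ?thesis
      using subgroup.m_closed[OF component_subgroup] subgroup.m_inv_closed[OF component_subgroup]
        component_closed[OF u x] u by (auto simp: bracket_Der)
  qed
  then show ?thesis
    using leibniz_maps_commutator[OF l] by (auto simp: derivations_eq)
qed

lemma Der_bracket_closed:
  assumes "\<delta> \<in> carrier (Der L)" "\<epsilon> \<in> carrier (Der L)"
  shows "bracket (Der L) \<delta> \<epsilon> \<in> carrier (Der L)"
proof -
  interpret D: comm_group "Der L" by (rule comm_group_Der)
  note l = subsetD[OF Der_subset_leibniz_maps]
  show ?thesis using assms
  proof (induction \<delta> rule: Der_induct)
    case one
    have "bracket (Der L) \<one>\<^bsub>Der L\<^esub> \<epsilon> = \<one>\<^bsub>Der L\<^esub>"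
      using DerD[OF one] by (auto simp: bracket_Der one_Der intro!: restrict_ext)
    then show ?case by simp
  next
    case (derivation s \<delta>)
    have \<delta>: "\<delta> \<in> carrier (Der L)" using derivation derivations_subset_Der by blast
    from derivation(3) show ?case
    proof (induction \<epsilon> rule: Der_induct)
      case one
      have "bracket (Der L) \<delta> \<one>\<^bsub>Der L\<^esub> = \<one>\<^bsub>Der L\<^esub>"
        using DerD[OF \<delta>] by (auto simp: bracket_Der one_Der intro!: restrict_ext)
      then show ?case by simp
    next
      case (derivation t \<epsilon>)
      then show ?case
        using derivations_bracket[of \<delta> s \<epsilon> t] derivations_subset_Der[of "s + t"] \<open>1 \<le> s\<close> \<open>\<delta> \<in> derivations L s\<close>
        by auto
    next
      case (mult \<epsilon> \<epsilon>')
      then show ?case using \<delta> by (simp add: bracket_Der_add l)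
    qed
  next
    case (mult \<delta> \<delta>')
    then show ?case by (simp add: bracket_Der_add l)
  qed
qed

lemma graded_lie_algebra_Der: "graded_lie_algebra (Der L)"
proof -
  interpret D: comm_group "Der L" by (rule comm_group_Der)
  note l = subsetD[OF Der_subset_leibniz_maps]
  show ?thesis
  proof (intro graded_lie_algebra.intro graded_lie_algebra_axioms.intro comm_group_Der Der_bracket_closed)
    show "bracket (Der L) (x \<otimes>\<^bsub>Der L\<^esub> y) z = bracket (Der L) x z \<otimes>\<^bsub>Der L\<^esub> bracket (Der L) y z"
      "bracket (Der L) x (y \<otimes>\<^bsub>Der L\<^esub> z) = bracket (Der L) x y \<otimes>\<^bsub>Der L\<^esub> bracket (Der L) x z"
      if "x \<in> carrier (Der L)" "y \<in> carrier (Der L)" "z \<in> carrier (Der L)" for x y z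
      using that by (auto intro!: bracket_Der_add l)
    show "bracket (Der L) x x = \<one>\<^bsub>Der L\<^esub>" if "x \<in> carrier (Der L)" for x
      using DerD[OF that] by (auto simp: bracket_Der one_Der intro!: restrict_ext)
    show "bracket (Der L) x (bracket (Der L) y z) \<otimes>\<^bsub>Der L\<^esub> bracket (Der L) y (bracket (Der L) z x)
        \<otimes>\<^bsub>Der L\<^esub> bracket (Der L) z (bracket (Der L) x y) = \<one>\<^bsub>Der L\<^esub>"
      if x: "x \<in> carrier (Der L)" and y: "y \<in> carrier (Der L)" and z: "z \<in> carrier (Der L)" for x y z
      unfolding bracket_Der mult_Der one_Der
      using DerD(2)[OF x] DerD(2)[OF y] DerD(2)[OF z]
      by (intro restrict_ext) (simp add: DerD(4-5)[OF x] DerD(4-5)[OF y] DerD(4-5)[OF z] commutator_jacobi_aux)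
    show sub: "subgroup (component (Der L) s) (Der L)" if s: "1 \<le> s" for s
      unfolding component_Der
    proof (rule D.subgroupI)
      note S = derivations_subgroup
      show "derivations L s \<subseteq> carrier (Der L)" using s by (rule derivations_subset_Der)
      show "derivations L s \<noteq> {}" using subgroup.one_closed[OF S] by blast
      show "x \<otimes>\<^bsub>Der L\<^esub> y \<in> derivations L s" if "x \<in> derivations L s" "y \<in> derivations L s" for x y
        using subgroup.m_closed[OF S that] unfolding mult_Der mult_product_group .
      show "inv\<^bsub>Der L\<^esub> x \<in> derivations L s" if x: "x \<in> derivations L s" for x
      proof -
        interpret M: comm_group maps by (rule comm_group_maps)
        have "inv\<^bsub>maps\<^esub> x \<otimes>\<^bsub>Der L\<^esub> x = \<one>\<^bsub>Der L\<^esub>"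
          using M.l_inv[of x] x subgroup.subset[OF S]
          unfolding mult_Der one_Der mult_product_group one_product_group by blast
        moreover have i: "inv\<^bsub>maps\<^esub> x \<in> derivations L s" using subgroup.m_inv_closed[OF S x] .
        moreover note i x[THEN subsetD[OF derivations_subset_Der[OF s]]]
          i[THEN subsetD[OF derivations_subset_Der[OF s]]]
        ultimately have "inv\<^bsub>Der L\<^esub> x = inv\<^bsub>maps\<^esub> x" by (intro D.inv_equality)
        then show ?thesis using i by (simp only:)
      qed
    qed
    show "bracket (Der L) x y \<in> component (Der L) (s + t)"
      if "1 \<le> s" "1 \<le> t" "x \<in> component (Der L) s" "y \<in> component (Der L) t" for s t x y
      using that derivations_bracket by (simp add: component_Der)
    show "(\<lambda>f. gfinprod (Der L) f {1..}) \<in> iso (sum_group {1..} (\<lambda>s. Der L\<lparr>carrier := component (Der L) s\<rparr>)) (Der L)"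
    proof (rule D.direct_sum_isoI[where K = L])
      show "subgroup (component (Der L) s) (Der L)" if "1 \<le> s" for s using that by (rule sub)
      show "carrier (Der L) \<subseteq> H" if H: "subgroup H (Der L)" and "\<And>s. 1 \<le> s \<Longrightarrow> component (Der L) s \<subseteq> H" for H
      proof
        fix \<delta> assume "\<delta> \<in> carrier (Der L)"
        then show "\<delta> \<in> H"
          by (induction rule: Der_induct)
            (use that subgroup.one_closed[OF H] subgroup.m_closed[OF H] in \<open>auto simp: component_Der\<close>)
      qed
      fix n \<delta>
      assume n: "1 \<le> n" and "\<delta> \<in> component (Der L) n" and \<delta>1: "\<delta> \<noteq> \<one>\<^bsub>Der L\<^esub>"
      then have \<delta>: "\<delta> \<in> derivations L n" by (simp add: component_Der)
      then have \<delta>l: "\<delta> \<in> leibniz_maps L" by (simp add: derivations_eq)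
      \<comment> \<open>Homogeneous elements generate L, so a nonzero derivation is nontrivial on
        one of them.\<close>
      have "\<exists>t y. 1 \<le> t \<and> y \<in> component L t \<and> \<delta> y \<noteq> \<one>"
      proof (rule ccontr)
        assume *: "\<not> ?thesis"
        have "\<one>\<^bsub>Der L\<^esub> \<in> leibniz_maps L" using D.one_closed Der_subset_leibniz_maps by blast
        then have "\<delta> = \<one>\<^bsub>Der L\<^esub>"
          using \<delta>l * component_closed by (intro Der_eqI) (auto simp: leibniz_maps_def one_Der)
        then show False using \<delta>1 by simp
      qed
      then obtain t y where t: "1 \<le> t" and y: "y \<in> component L t" and \<delta>y: "\<delta> y \<noteq> \<one>" by blast
      obtain p where p: "p \<in> hom L L" "\<And>x. x \<in> component L (n + t) \<Longrightarrow> p x = x"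
        "\<And>s x. \<lbrakk>1 \<le> s; s \<noteq> n + t; x \<in> component L s\<rbrakk> \<Longrightarrow> p x = \<one>"
        using component_projection[of "n + t"] n by auto
      have yc: "y \<in> carrier L" using component_closed[OF t y] .
      \<comment> \<open>Evaluate at y and project to degree n + t: a derivation of degree s sends y
        to degree s + t, so every s other than n is killed while \<delta> y survives.\<close>
      have "(\<lambda>\<epsilon>. p (\<epsilon> y)) \<in> hom (Der L) L"
        using yc DerD(2) p(1) by (intro homI) (auto simp: mult_Der hom_mult hom_in_carrier)
      moreover have "\<delta> y \<in> component L (n + t)" using \<delta> t y by (auto simp: derivations_eq)
      then have "p (\<delta> y) \<noteq> \<one>" using \<delta>y p(2) by simp
      moreover have "p (\<epsilon> y) = \<one>" if "1 \<le> s" "s \<noteq> n" "\<epsilon> \<in> derivations L s" for s \<epsilon>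
        using that t y p(3)[of "s + t"] by (auto simp: derivations_eq)
      ultimately show "\<exists>p\<in>hom (Der L) L. p \<delta> \<noteq> \<one> \<and> (\<forall>s\<ge>1. s \<noteq> n \<longrightarrow> p ` component (Der L) s \<subseteq> {\<one>})"
        by (intro bexI[of _ "\<lambda>\<epsilon>. p (\<epsilon> y)"]) (auto simp: component_Der)
    qed (rule is_group)
  qed
qed

end

subsection \<open>Quotients by homogeneous ideals\<close>

text \<open>Generation by homogeneous elements makes \<open>I\<close> stable under projections to a
  single degree, which gives the quotient its direct sum decomposition. Brackets from the other side
  are covered by skew-symmetry.\<close>

locale homogeneous_ideal = graded_lie_algebra L for L :: "('a, 'm) graded_lie_scheme" (structure) +
  fixes I :: "'a set"
  assumes ideal_subgroup: "subgroup I L"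
    and ideal_bracket: "\<lbrakk>x \<in> carrier L; i \<in> I\<rbrakk> \<Longrightarrow> bracket L x i \<in> I"
    and ideal_homogeneous: "I \<subseteq> generate L (\<Union>s\<in>{1..}. I \<inter> component L s)"
begin

abbreviation (input) coset :: "'a \<Rightarrow> 'a set" where
  "coset x \<equiv> I #> x"

lemma ideal_closed: "i \<in> I \<Longrightarrow> i \<in> carrier L"
  using ideal_subgroup subgroup.mem_carrier by metis

lemma ideal_normal: "I \<lhd> L"
  using ideal_subgroup normal_iff_subgroup by blast

lemma coset_eq_iff:
  assumes "x \<in> carrier L" "y \<in> carrier L"
  shows "I #> x = I #> y \<longleftrightarrow> x \<otimes> inv y \<in> I"
proof -
  have "I #> x = I #> y \<longleftrightarrow> x \<in> I #> y"
    using repr_independence rcos_self assms ideal_subgroup by metis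
  also have "\<dots> \<longleftrightarrow> x \<otimes> inv y \<in> I"
  proof
    show "x \<otimes> inv y \<in> I" if "x \<in> I #> y"
      using that assms by (auto simp: r_coset_def m_assoc ideal_closed)
    show "x \<in> I #> y" if "x \<otimes> inv y \<in> I"
      using that assms by (auto simp: r_coset_def m_assoc intro!: bexI[OF _ that])
  qed
  finally show ?thesis .
qed

lemma carrier_quotient_lie: "carrier (quotient_lie L I) = (\<lambda>x. I #> x) ` carrier L"
  by (simp add: quotient_lie_def carrier_FactGroup)

lemma one_quotient_lie: "\<one>\<^bsub>quotient_lie L I\<^esub> = I"
  by (simp add: quotient_lie_def)

lemma mult_quotient_lie:
  "\<lbrakk>x \<in> carrier L; y \<in> carrier L\<rbrakk> \<Longrightarrow> (I #> x) \<otimes>\<^bsub>quotient_lie L I\<^esub> (I #> y) = I #> (x \<otimes> y)"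
  by (simp add: quotient_lie_def normal.rcos_sum[OF ideal_normal])

lemma component_quotient_lie: "component (quotient_lie L I) s = (\<lambda>x. I #> x) ` component L s"
  by (simp add: quotient_lie_def)

lemma comm_group_quotient_lie: "comm_group (quotient_lie L I)"
  by (rule comm_group_cong[OF abelian_FactGroup[OF ideal_subgroup]]) (simp_all add: quotient_lie_def)

lemma coset_hom: "group_hom L (quotient_lie L I) coset"
  using comm_group_quotient_lie comm_group.axioms(2) is_group
  by (intro group_hom.intro group_hom_axioms.intro homI) (auto simp: carrier_quotient_lie mult_quotient_lie)

lemma coset_eq_ideal_iff: "x \<in> carrier L \<Longrightarrow> I #> x = I \<longleftrightarrow> x \<in> I"
  using coset_join1 coset_join2 ideal_subgroup by metis

text \<open>This is how operations defined as unions over representatives are evaluated: invariance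
  under translation by \<open>I\<close> makes all members of the union equal, and the coset is
  nonempty.\<close>

lemma Union_coset:
  assumes "x \<in> carrier L" "\<And>i. i \<in> I \<Longrightarrow> f (i \<otimes> x) = f x"
  shows "(\<Union>z\<in>I #> x. f z) = f x"
proof -
  have "\<And>z. z \<in> I #> x \<Longrightarrow> f z = f x" using assms by (auto simp: r_coset_def)
  then show ?thesis using rcos_self[OF assms(1) ideal_subgroup] by blast
qed

lemma bracket_quotient_lie:
  assumes x: "x \<in> carrier L" and y: "y \<in> carrier L"
  shows "bracket (quotient_lie L I) (I #> x) (I #> y) = I #> bracket L x y"
proof -
  have left: "I #> bracket L (i \<otimes> z) w = I #> bracket L z w"
    if "i \<in> I" "z \<in> carrier L" "w \<in> carrier L" for i z w
  proof -
    have "bracket L i w = inv (bracket L w i)" using that ideal_closed bracket_skew by blast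
    then have "bracket L i w \<in> I"
      using that ideal_bracket subgroup.m_inv_closed[OF ideal_subgroup] by simp
    then show ?thesis
      using that ideal_closed bracket_closed by (simp add: coset_eq_iff bracket_add_left m_assoc)
  qed
  have right: "I #> bracket L w (i \<otimes> z) = I #> bracket L w z"
    if "i \<in> I" "z \<in> carrier L" "w \<in> carrier L" for i z w
    using that ideal_closed bracket_closed ideal_bracket by (simp add: coset_eq_iff bracket_add_right m_assoc)
  have "(\<Union>u\<in>I #> x. \<Union>v\<in>I #> y. I #> bracket L u v) = (\<Union>v\<in>I #> y. I #> bracket L x v)"
    using x y left r_coset_subset_G[OF subgroup.subset[OF ideal_subgroup] y]
    by (intro Union_coset SUP_cong) auto
  also have "\<dots> = I #> bracket L x y"
    using x y right by (intro Union_coset) auto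
  finally show ?thesis by (simp add: quotient_lie_def)
qed

text \<open>A homogeneous generator of \<open>I\<close> is either kept or killed by p, and both
  results lie in \<open>I\<close>; hence p maps the subgroup generated by them into
  \<open>I\<close>.\<close>

lemma projection_ideal:
  assumes p: "group_hom L L p" and i: "i \<in> I"
    and pc: "\<And>s x. \<lbrakk>1 \<le> s; x \<in> component L s\<rbrakk> \<Longrightarrow> p x = x \<or> p x = \<one>"
  shows "p i \<in> I"
proof (rule group_hom.hom_comp_generate_subset[OF p])
  show "i \<in> generate L (\<Union>s\<in>{1..}. I \<inter> component L s)" using i ideal_homogeneous by blast
  show "p x \<in> I" if "x \<in> (\<Union>s\<in>{1..}. I \<inter> component L s)" for x
    using that pc subgroup.one_closed[OF ideal_subgroup] by force
qed (use ideal_closed ideal_subgroup in auto)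

lemma graded_lie_algebra_quotient: "graded_lie_algebra (quotient_lie L I)"
proof -
  let ?Q = "quotient_lie L I"
  interpret Q: comm_group ?Q by (rule comm_group_quotient_lie)
  interpret q: group_hom L ?Q coset by (rule coset_hom)
  note [simp] = bracket_quotient_lie mult_quotient_lie bracket_closed
  note [simp del] = q.hom_mult
  show ?thesis
  proof (intro graded_lie_algebra.intro graded_lie_algebra_axioms.intro comm_group_quotient_lie)
    show "bracket ?Q x y \<in> carrier ?Q" if "x \<in> carrier ?Q" "y \<in> carrier ?Q" for x y
      using that by (auto simp: carrier_quotient_lie)
    show "bracket ?Q (x \<otimes>\<^bsub>?Q\<^esub> y) z = bracket ?Q x z \<otimes>\<^bsub>?Q\<^esub> bracket ?Q y z"
      "bracket ?Q x (y \<otimes>\<^bsub>?Q\<^esub> z) = bracket ?Q x y \<otimes>\<^bsub>?Q\<^esub> bracket ?Q x z"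
      "bracket ?Q x (bracket ?Q y z) \<otimes>\<^bsub>?Q\<^esub> bracket ?Q y (bracket ?Q z x)
        \<otimes>\<^bsub>?Q\<^esub> bracket ?Q z (bracket ?Q x y) = \<one>\<^bsub>?Q\<^esub>"
      if "x \<in> carrier ?Q" "y \<in> carrier ?Q" "z \<in> carrier ?Q" for x y z
      using that subgroup.subset[OF ideal_subgroup]
      by (auto simp: carrier_quotient_lie bracket_add_left bracket_add_right jacobi one_quotient_lie)
    show "bracket ?Q x x = \<one>\<^bsub>?Q\<^esub>" if "x \<in> carrier ?Q" for x
      using that subgroup.subset[OF ideal_subgroup]
      by (auto simp: carrier_quotient_lie bracket_alternating one_quotient_lie)
    show sub: "subgroup (component ?Q s) ?Q" if "1 \<le> s" for s
      unfolding component_quotient_lie using component_subgroup[OF that] by (rule q.subgroup_img_is_subgroup)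
    show "bracket ?Q x y \<in> component ?Q (s + t)"
      if "1 \<le> s" "1 \<le> t" "x \<in> component ?Q s" "y \<in> component ?Q t" for s t x y
      using that component_bracket component_closed by (auto simp: component_quotient_lie)
    show "(\<lambda>f. gfinprod ?Q f {1..}) \<in> iso (sum_group {1..} (\<lambda>s. ?Q\<lparr>carrier := component ?Q s\<rparr>)) ?Q"
    proof (rule Q.direct_sum_isoI[where K = ?Q])
      show "subgroup (component ?Q s) ?Q" if "1 \<le> s" for s using that by (rule sub)
      show "carrier ?Q \<subseteq> H" if H: "subgroup H ?Q" and c: "\<And>s. 1 \<le> s \<Longrightarrow> component ?Q s \<subseteq> H" for H
      proof -
        have "I #> x \<in> H" if "x \<in> carrier L" for x
          using that
        proof (induction rule: graded_induct)
          case one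
          then show ?case using subgroup.one_closed[OF H] subgroup.subset[OF ideal_subgroup]
            by (simp add: one_quotient_lie)
        next
          case (component s x)
          then show ?case using c[of s] by (auto simp: component_quotient_lie)
        next
          case (mult x y)
          then show ?case using subgroup.m_closed[OF H mult(3,4)] by simp
        qed
        then show ?thesis by (auto simp: carrier_quotient_lie)
      qed
      fix n U
      assume n: "1 \<le> n" and "U \<in> component ?Q n" and U1: "U \<noteq> \<one>\<^bsub>?Q\<^esub>"
      then obtain x where x: "x \<in> component L n" and U: "U = I #> x" by (auto simp: component_quotient_lie)
      obtain p where p: "p \<in> hom L L" "\<And>x. x \<in> component L n \<Longrightarrow> p x = x"
        "\<And>s x. \<lbrakk>1 \<le> s; s \<noteq> n; x \<in> component L s\<rbrakk> \<Longrightarrow> p x = \<one>"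
        using component_projection[OF n] by blast
      interpret p: group_hom L L p using p(1) is_group by (simp add: group_hom_def group_hom_axioms_def)
      have pI: "p i \<in> I" if "i \<in> I" for i
        by (rule projection_ideal[OF p.group_hom_axioms that]) (use p(2,3) in metis)
      \<comment> \<open>The endomorphism of the quotient induced by p, well defined by
        \<open>pI\<close>; it fixes classes from degree n and kills the other degrees, as the direct
        sum criterion asks.\<close>
      define P where "P = (\<lambda>U. \<Union>z\<in>U. I #> p z)"
      have P: "P (I #> z) = I #> p z" if "z \<in> carrier L" for z
        unfolding P_def using that pI ideal_closed by (intro Union_coset) (auto simp: coset_eq_iff m_assoc)
      have "P \<in> hom ?Q ?Q"
        by (rule homI) (auto simp: carrier_quotient_lie P)
      moreover have "P U \<noteq> \<one>\<^bsub>?Q\<^esub>"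
        using U1 p(2)[OF x] component_closed[OF n x] by (simp add: U P)
      moreover have "P V = \<one>\<^bsub>?Q\<^esub>" if "1 \<le> s" "s \<noteq> n" "V \<in> component ?Q s" for s V
        using that p(3) component_closed subgroup.subset[OF ideal_subgroup]
        by (auto simp: component_quotient_lie P one_quotient_lie)
      ultimately show "\<exists>p\<in>hom ?Q ?Q. p U \<noteq> \<one>\<^bsub>?Q\<^esub> \<and> (\<forall>s\<ge>1. s \<noteq> n \<longrightarrow> p ` component ?Q s \<subseteq> {\<one>\<^bsub>?Q\<^esub>})"
        by blast
    qed (rule Q.is_group)
  qed
qed

lemma graded_lie_algebra_hom_coset: "graded_lie_algebra_hom L (quotient_lie L I) coset"
  using group_hom.homh[OF coset_hom]
  by (intro graded_lie_algebra_hom.intro graded_lie_algebra_hom_axioms.intro graded_lie_algebra_axioms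
      graded_lie_algebra_quotient) (auto simp: bracket_quotient_lie component_quotient_lie)

end

subsection \<open>Outer derivations\<close>

context graded_lie_algebra
begin

lemma ad_mem_derivations:
  assumes "1 \<le> s" "x \<in> component L s"
  shows "ad L x \<in> derivations L s"
proof -
  have x: "x \<in> carrier L" using assms by (rule component_closed)
  have "ad L x \<in> leibniz_maps L"
    unfolding ad_def using x by (intro leibniz_mapsI bracket_closed bracket_add_right bracket_leibniz)
  then show ?thesis
    using assms component_bracket component_closed by (auto simp: derivations_eq ad_def)
qed

lemma ad_mult: "\<lbrakk>x \<in> carrier L; y \<in> carrier L\<rbrakk> \<Longrightarrow> ad L (x \<otimes> y) = ad L x \<otimes>\<^bsub>Der L\<^esub> ad L y"
  by (auto simp: ad_def mult_Der bracket_add_left intro!: restrict_ext)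

lemma ad_one: "ad L \<one> = \<one>\<^bsub>Der L\<^esub>"
  by (auto simp: ad_def one_Der bracket_one_left intro!: restrict_ext)

lemma ad_closed:
  assumes "x \<in> carrier L"
  shows "ad L x \<in> carrier (Der L)"
proof -
  interpret D: comm_group "Der L" by (rule comm_group_Der)
  show ?thesis using assms
  proof (induction rule: graded_induct)
    case (component s x)
    then show ?case using ad_mem_derivations derivations_subset_Der by blast
  qed (simp_all add: ad_one ad_mult)
qed

lemma bracket_Der_ad:
  assumes "\<delta> \<in> carrier (Der L)" "x \<in> carrier L"
  shows "bracket (Der L) \<delta> (ad L x) = ad L (\<delta> x)"
  unfolding ad_def bracket_Der
proof (rule restrict_ext)
  fix y assume y: "y \<in> carrier L"
  have "\<delta> (bracket L x y) = bracket L (\<delta> x) y \<otimes> bracket L x (\<delta> y)"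
    using DerD(6) assms y by blast
  then show "\<delta> ((\<lambda>y\<in>carrier L. bracket L x y) y) \<otimes> inv ((\<lambda>y\<in>carrier L. bracket L x y) (\<delta> y)) = bracket L (\<delta> x) y"
    using y DerD(2)[OF assms(1)] assms bracket_closed by (simp add: m_assoc)
qed

text \<open>The ideal property is [\<delta>, ad x] = ad (\<delta> x); homogeneity holds because ad
  carries elements of degree s to derivations of degree s.\<close>

lemma homogeneous_ideal_ad: "homogeneous_ideal (Der L) (ad L ` carrier L)"
proof -
  interpret D: graded_lie_algebra "Der L" by (rule graded_lie_algebra_Der)
  interpret h: group_hom L "Der L" "ad L"
    using is_group D.is_group
    by (intro group_hom.intro group_hom_axioms.intro homI) (auto simp: ad_closed ad_mult)
  show ?thesis
  proof (intro homogeneous_ideal.intro homogeneous_ideal_axioms.intro graded_lie_algebra_Der)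
    show "subgroup (ad L ` carrier L) (Der L)" by (rule h.img_is_subgroup)
    show "bracket (Der L) \<delta> i \<in> ad L ` carrier L" if "\<delta> \<in> carrier (Der L)" "i \<in> ad L ` carrier L" for \<delta> i
      using that DerD(2) by (auto simp: bracket_Der_ad)
    have "ad L x \<in> generate (Der L) (\<Union>s\<in>{1..}. ad L ` carrier L \<inter> component (Der L) s)"
      if "x \<in> carrier L" for x
      using that
    proof (induction rule: graded_induct)
      case one
      then show ?case by (simp add: ad_one generate.one)
    next
      case (component s x)
      then show ?case using ad_mem_derivations component_closed
        by (intro generate.incl) (auto simp: component_Der)
    next
      case (mult x y)
      then show ?case by (simp add: ad_mult generate.eng)
    qed
    then show "ad L ` carrier L \<subseteq> generate (Der L) (\<Union>s\<in>{1..}. ad L ` carrier L \<inter> component (Der L) s)"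
      by blast
  qed
qed

lemma graded_lie_algebra_hom_outer_Der_proj:
  "graded_lie_algebra_hom (Der L) (outer_Der L) (outer_Der_proj L)"
  unfolding outer_Der_def outer_Der_proj_def[abs_def]
  by (rule homogeneous_ideal.graded_lie_algebra_hom_coset[OF homogeneous_ideal_ad])

lemma outer_Der_proj_eq_one_iff:
  "\<delta> \<in> carrier (Der L) \<Longrightarrow> outer_Der_proj L \<delta> = \<one>\<^bsub>outer_Der L\<^esub> \<longleftrightarrow> \<delta> \<in> ad L ` carrier L"
  unfolding outer_Der_def outer_Der_proj_def
  using homogeneous_ideal.coset_eq_ideal_iff[OF homogeneous_ideal_ad]
    homogeneous_ideal.one_quotient_lie[OF homogeneous_ideal_ad] by metis

end

lemma graded_lie_algebra_hom_compose:
  assumes "graded_lie_algebra_hom L M f" "graded_lie_algebra_hom M N g"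
  shows "graded_lie_algebra_hom L N (\<lambda>x. g (f x))"
proof -
  interpret f: graded_lie_algebra_hom L M f by fact
  interpret g: graded_lie_algebra_hom M N g by fact
  show ?thesis
    using hom_in_carrier[OF f.hom] hom_in_carrier[OF g.hom]
    by unfold_locales
      (auto simp: f.hom_bracket g.hom_bracket hom_mult[OF f.hom] hom_mult[OF g.hom] f.hom_component g.hom_component intro!: homI)
qed

text \<open>Equality of kernels supplies both directions at once: p x = p y implies k x = k y, so h
  is well defined, and the converse makes h injective. Surjectivity on components yields homogeneous
  preimages, through which h is seen to preserve degrees.\<close>

lemma graded_lie_algebra_hom_factor:
  assumes p: "graded_lie_algebra_hom L M p" and k: "graded_lie_algebra_hom L N k"
    and surj: "p ` carrier L = carrier M"
    and surj_component: "\<And>s. 1 \<le> s \<Longrightarrow> component M s \<subseteq> p ` component L s"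
    and kernel: "\<And>x. x \<in> carrier L \<Longrightarrow> p x = \<one>\<^bsub>M\<^esub> \<longleftrightarrow> k x = \<one>\<^bsub>N\<^esub>"
  obtains h where "graded_lie_algebra_hom M N h" "inj_on h (carrier M)"
    "\<And>x. x \<in> carrier L \<Longrightarrow> h (p x) = k x"
proof -
  interpret p: graded_lie_algebra_hom L M p by fact
  interpret k: graded_lie_algebra_hom L N k by fact
  interpret pg: group_hom L M p
    using p.L.is_group p.M.is_group p.hom by (simp add: group_hom_def group_hom_axioms_def)
  interpret kg: group_hom L N k
    using p.L.is_group k.M.is_group k.hom by (simp add: group_hom_def group_hom_axioms_def)
  have eq_iff: "p x = p y \<longleftrightarrow> k x = k y" if x: "x \<in> carrier L" and y: "y \<in> carrier L" for x y
  proof -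
    have "p x = p y \<longleftrightarrow> p (x \<otimes>\<^bsub>L\<^esub> inv\<^bsub>L\<^esub> y) = \<one>\<^bsub>M\<^esub>"
      using x y p.M.inv_solve_right'[of "\<one>\<^bsub>M\<^esub>" "p x" "p y"] by auto
    also have "\<dots> \<longleftrightarrow> k (x \<otimes>\<^bsub>L\<^esub> inv\<^bsub>L\<^esub> y) = \<one>\<^bsub>N\<^esub>"
      using x y by (intro kernel) simp
    also have "\<dots> \<longleftrightarrow> k x = k y"
      using x y k.M.inv_solve_right'[of "\<one>\<^bsub>N\<^esub>" "k x" "k y"] by auto
    finally show ?thesis .
  qed
  \<comment> \<open>An arbitrary preimage is chosen; \<open>eq_iff\<close> makes the value
    independent of the choice.\<close>
  define h where "h = (\<lambda>z. k (SOME x. x \<in> carrier L \<and> p x = z))"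
  have h: "h (p x) = k x" if x: "x \<in> carrier L" for x
  proof -
    let ?x = "SOME x'. x' \<in> carrier L \<and> p x' = p x"
    have "?x \<in> carrier L \<and> p ?x = p x" by (rule someI[of _ x]) (use x in simp)
    then show ?thesis using eq_iff[of ?x x] x by (simp add: h_def)
  qed
  have rep: "\<exists>x\<in>carrier L. p x = z" if "z \<in> carrier M" for z
    using that unfolding surj[symmetric] by blast
  have "graded_lie_algebra_hom M N h"
  proof (intro graded_lie_algebra_hom.intro graded_lie_algebra_hom_axioms.intro
      p.M.graded_lie_algebra_axioms k.M.graded_lie_algebra_axioms homI)
    show "h z \<in> carrier N" if "z \<in> carrier M" for z using rep[OF that] h by auto
    show "h (z \<otimes>\<^bsub>M\<^esub> w) = h z \<otimes>\<^bsub>N\<^esub> h w" if "z \<in> carrier M" "w \<in> carrier M" for z w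
    proof -
      from that rep obtain x y where "x \<in> carrier L" "y \<in> carrier L" "z = p x" "w = p y" by metis
      then show ?thesis using h[of "x \<otimes>\<^bsub>L\<^esub> y"] h by simp
    qed
    show "h (bracket M z w) = bracket N (h z) (h w)" if "z \<in> carrier M" "w \<in> carrier M" for z w
    proof -
      from that rep obtain x y where "x \<in> carrier L" "y \<in> carrier L" "z = p x" "w = p y" by metis
      then show ?thesis
        using h[of "bracket L x y"] h by (simp add: p.L.bracket_closed p.hom_bracket k.hom_bracket)
    qed
    show "h z \<in> component N s" if s: "1 \<le> s" and z: "z \<in> component M s" for s z
    proof -
      obtain x where x: "x \<in> component L s" "z = p x" using surj_component[OF s] z by blast
      then show ?thesis using h p.L.component_closed[OF s] k.hom_component[OF s] by simp
    qed
  qed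
  moreover have "inj_on h (carrier M)"
  proof (rule inj_onI)
    fix z w assume "z \<in> carrier M" "w \<in> carrier M" and e: "h z = h w"
    then obtain x y where "x \<in> carrier L" "y \<in> carrier L" "z = p x" "w = p y" using rep by metis
    then show "z = w" using e h eq_iff by simp
  qed
  ultimately show thesis using h by (rule that)
qed

section \<open>The graded Lie algebra of an N-series\<close>

definition gr_class :: "('a, 'm) monoid_scheme \<Rightarrow> (nat \<Rightarrow> 'a set) \<Rightarrow> nat \<Rightarrow> 'a \<Rightarrow> 'a set" where
  "gr_class G \<Phi> s x = \<Phi> (Suc s) #>\<^bsub>G\<^esub> x"

text \<open>Test elements: they generate the graded sum additively, and on them the operations
  become plain group operations on representatives.\<close>

definition homog :: "('a, 'm) monoid_scheme \<Rightarrow> (nat \<Rightarrow> 'a set) \<Rightarrow> nat \<Rightarrow> 'a \<Rightarrow> nat \<Rightarrow> 'a set" where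
  "homog G \<Phi> s x = (\<lambda>n\<in>{1..}. if n = s then gr_class G \<Phi> s x else \<one>\<^bsub>gr_degree G \<Phi> n\<^esub>)"

text \<open>The Cauchy product with m as multiplication. With \<open>commutator\<close> it is the
  bracket of \<open>gr\<close>, with displacements it is the formula of \<open>johnson\<close>, so
  both inherit bilinearity from one argument.\<close>

definition gr_convolution ::
    "('c, 'k) monoid_scheme \<Rightarrow> (nat \<Rightarrow> 'c set) \<Rightarrow> ('a \<Rightarrow> 'b \<Rightarrow> 'c)
      \<Rightarrow> (nat \<Rightarrow> 'a set) \<Rightarrow> (nat \<Rightarrow> 'b set) \<Rightarrow> nat \<Rightarrow> 'c set" where
  "gr_convolution K \<Theta> m f g = (\<lambda>n\<in>{1..}. finprod (gr_degree K \<Theta> n)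
    (\<lambda>s. \<Union>x\<in>f s. \<Union>y\<in>g (n - s). \<Theta> (Suc n) #>\<^bsub>K\<^esub> m x y) {1..<n})"

context N_series
begin

lemma Phi_Suc_normal: "1 \<le> s \<Longrightarrow> \<Phi> (Suc s) \<lhd> G\<lparr>carrier := \<Phi> s\<rparr>"
proof (rule group.normalI)
  assume s: "1 \<le> s"
  show gs: "group (G\<lparr>carrier := \<Phi> s\<rparr>)"
    using subgroup_Phi[OF s] subgroup.subgroup_is_group is_group by blast
  show "subgroup (\<Phi> (Suc s)) (G\<lparr>carrier := \<Phi> s\<rparr>)"
    using subgroup_Phi s Phi_Suc by (intro subgroup_incl) auto
  show "\<forall>x\<in>carrier (G\<lparr>carrier := \<Phi> s\<rparr>). \<Phi> (Suc s) #>\<^bsub>G\<lparr>carrier := \<Phi> s\<rparr>\<^esub> x = x <#\<^bsub>G\<lparr>carrier := \<Phi> s\<rparr>\<^esub> \<Phi> (Suc s)"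
  proof
    fix x assume "x \<in> carrier (G\<lparr>carrier := \<Phi> s\<rparr>)"
    then have x: "x \<in> \<Phi> s" and xc: "x \<in> carrier G" using Phi_carrier[OF s] by auto
    have "\<Phi> (Suc s) #> x = x <# \<Phi> (Suc s)"
    proof safe
      fix z assume "z \<in> \<Phi> (Suc s) #> x"
      then obtain h where h: "h \<in> \<Phi> (Suc s)" and z: "z = h \<otimes> x" by (auto simp: r_coset_def)
      have hc: "h \<in> carrier G" using Phi_carrier[OF _ h] by simp
      have "inv x \<otimes> h \<otimes> inv (inv x) \<in> \<Phi> (Suc s)"
        using Phi_conj[OF s _ Phi_inv[OF s x] h] by simp
      then have "inv x \<otimes> h \<otimes> x \<in> \<Phi> (Suc s)" using xc by simp
      moreover have "z = x \<otimes> (inv x \<otimes> h \<otimes> x)" using z hc xc by (simp add: m_assoc inv_mult_cancel)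
      ultimately show "z \<in> x <# \<Phi> (Suc s)" by (auto simp: l_coset_def)
    next
      fix z assume "z \<in> x <# \<Phi> (Suc s)"
      then obtain h where h: "h \<in> \<Phi> (Suc s)" and z: "z = x \<otimes> h" by (auto simp: l_coset_def)
      have hc: "h \<in> carrier G" using Phi_carrier[OF _ h] by simp
      have "x \<otimes> h \<otimes> inv x \<in> \<Phi> (Suc s)"
        using Phi_conj[OF s _ x h] by simp
      moreover have "z = (x \<otimes> h \<otimes> inv x) \<otimes> x" using z hc xc by (simp add: m_assoc inv_mult_cancel)
      ultimately show "z \<in> \<Phi> (Suc s) #> x" by (auto simp: r_coset_def)
    qed
    then show "\<Phi> (Suc s) #>\<^bsub>G\<lparr>carrier := \<Phi> s\<rparr>\<^esub> x = x <#\<^bsub>G\<lparr>carrier := \<Phi> s\<rparr>\<^esub> \<Phi> (Suc s)"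
      by (simp add: r_coset_def l_coset_def)
  qed
qed

lemma carrier_gr_degree: "carrier (gr_degree G \<Phi> s) = gr_class G \<Phi> s ` \<Phi> s"
  by (simp add: gr_degree_def carrier_FactGroup gr_class_def r_coset_def)

lemma gr_class_closed: "x \<in> \<Phi> s \<Longrightarrow> gr_class G \<Phi> s x \<in> carrier (gr_degree G \<Phi> s)"
  by (simp add: carrier_gr_degree)

lemma one_gr_degree: "\<one>\<^bsub>gr_degree G \<Phi> s\<^esub> = \<Phi> (Suc s)"
  by (simp add: gr_degree_def)

lemma gr_class_mult:
  "\<lbrakk>1 \<le> s; x \<in> \<Phi> s; y \<in> \<Phi> s\<rbrakk>
    \<Longrightarrow> gr_class G \<Phi> s x \<otimes>\<^bsub>gr_degree G \<Phi> s\<^esub> gr_class G \<Phi> s y = gr_class G \<Phi> s (x \<otimes> y)"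
  using normal.rcos_sum[OF Phi_Suc_normal, of s x y]
  by (simp add: gr_degree_def gr_class_def r_coset_def)

lemma gr_class_eq_iff:
  assumes s: "1 \<le> s" and x: "x \<in> \<Phi> s" and y: "y \<in> \<Phi> s"
  shows "gr_class G \<Phi> s x = gr_class G \<Phi> s y \<longleftrightarrow> x \<otimes> inv y \<in> \<Phi> (Suc s)"
proof -
  have c: "x \<in> carrier G" "y \<in> carrier G" using assms Phi_carrier by auto
  have S: "subgroup (\<Phi> (Suc s)) G" using subgroup_Phi by simp
  have "gr_class G \<Phi> s x = gr_class G \<Phi> s y \<longleftrightarrow> x \<in> \<Phi> (Suc s) #> y"
    unfolding gr_class_def using repr_independence rcos_self c S by metis
  also have "\<dots> \<longleftrightarrow> x \<otimes> inv y \<in> \<Phi> (Suc s)"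
  proof
    show "x \<otimes> inv y \<in> \<Phi> (Suc s)" if "x \<in> \<Phi> (Suc s) #> y"
      using that c by (auto simp: r_coset_def m_assoc subgroup.mem_carrier[OF S])
    show "x \<in> \<Phi> (Suc s) #> y" if "x \<otimes> inv y \<in> \<Phi> (Suc s)"
      using that c by (auto simp: r_coset_def m_assoc intro!: bexI[OF _ that])
  qed
  finally show ?thesis .
qed

lemma gr_class_one: "1 \<le> s \<Longrightarrow> gr_class G \<Phi> s \<one> = \<one>\<^bsub>gr_degree G \<Phi> s\<^esub>"
  using subgroup.subset[OF subgroup_Phi[of "Suc s"]] by (simp add: gr_class_def one_gr_degree)

lemma gr_class_eq_one_iff:
  assumes "1 \<le> s" "x \<in> \<Phi> s"
  shows "gr_class G \<Phi> s x = \<one>\<^bsub>gr_degree G \<Phi> s\<^esub> \<longleftrightarrow> x \<in> \<Phi> (Suc s)"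
  using gr_class_eq_iff[OF assms(1,2), of \<one>] assms Phi_carrier[OF assms] by (simp add: gr_class_one)

text \<open>Commutators of elements of step s lie in step 2 s, and s \<ge> 1 gives 2 s \<ge> s +
  1.\<close>

lemma comm_group_gr_degree:
  assumes s: "1 \<le> s"
  shows "comm_group (gr_degree G \<Phi> s)"
proof (rule group.group_comm_groupI)
  show "group (gr_degree G \<Phi> s)"
    unfolding gr_degree_def by (rule normal.factorgroup_is_group[OF Phi_Suc_normal[OF s]])
  fix U V assume "U \<in> carrier (gr_degree G \<Phi> s)" "V \<in> carrier (gr_degree G \<Phi> s)"
  then obtain x y where U: "U = gr_class G \<Phi> s x" and x: "x \<in> \<Phi> s"
    and V: "V = gr_class G \<Phi> s y" and y: "y \<in> \<Phi> s" by (auto simp: carrier_gr_degree)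
  have c: "x \<in> carrier G" "y \<in> carrier G" using x y s Phi_carrier by auto
  have "commutator G x y \<in> \<Phi> (Suc s)"
    using Phi_mono[OF Phi_commutator[OF s s x y], of "Suc s"] s by simp
  moreover have "(x \<otimes> y) \<otimes> inv (y \<otimes> x) = commutator G x y" using c by (simp add: word_simps)
  ultimately have "gr_class G \<Phi> s (x \<otimes> y) = gr_class G \<Phi> s (y \<otimes> x)"
    using s x y Phi_mult by (simp add: gr_class_eq_iff)
  then show "U \<otimes>\<^bsub>gr_degree G \<Phi> s\<^esub> V = V \<otimes>\<^bsub>gr_degree G \<Phi> s\<^esub> U"
    using U V x y s by (simp add: gr_class_mult)
qed

lemma group_gr_degree: "1 \<le> s \<Longrightarrow> group (gr_degree G \<Phi> s)"
  using comm_group_gr_degree comm_group.axioms(2) by blast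

lemma gr_class_inv:
  assumes s: "1 \<le> s" and x: "x \<in> \<Phi> s"
  shows "inv\<^bsub>gr_degree G \<Phi> s\<^esub> gr_class G \<Phi> s x = gr_class G \<Phi> s (inv x)"
proof (rule group.inv_equality[OF group_gr_degree[OF s]])
  show "gr_class G \<Phi> s (inv x) \<otimes>\<^bsub>gr_degree G \<Phi> s\<^esub> gr_class G \<Phi> s x = \<one>\<^bsub>gr_degree G \<Phi> s\<^esub>"
    using assms Phi_inv Phi_carrier by (simp add: gr_class_mult gr_class_one)
qed (use assms Phi_inv gr_class_closed in auto)

text \<open>Conjugation changes y by (x,y) of degree s + t, which is beyond t because s \<ge> 1. In
  particular, conjugation by Torelli elements is trivial on the graded pieces of the Johnson
  filtration.\<close>

lemma gr_class_conj:
  assumes s: "1 \<le> s" and t: "1 \<le> t" and x: "x \<in> \<Phi> s" and y: "y \<in> \<Phi> t"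
  shows "gr_class G \<Phi> t (x \<otimes> y \<otimes> inv x) = gr_class G \<Phi> t y"
proof -
  have c: "x \<in> carrier G" "y \<in> carrier G" using assms Phi_carrier by auto
  have "commutator G x y \<in> \<Phi> (Suc t)"
    using Phi_mono[OF Phi_commutator[OF s t x y], of "Suc t"] s by simp
  moreover have "x \<otimes> y \<otimes> inv x \<otimes> inv y = commutator G x y" by (simp add: commutator_def)
  ultimately show ?thesis
    using t y Phi_conj[OF s t x y] by (simp add: gr_class_eq_iff)
qed

lemma Union_gr_class:
  assumes "1 \<le> s" "x \<in> \<Phi> s" "\<And>i. i \<in> \<Phi> (Suc s) \<Longrightarrow> f (i \<otimes> x) = f x"
  shows "(\<Union>z\<in>gr_class G \<Phi> s x. f z) = f x"
proof -
  have "\<And>z. z \<in> gr_class G \<Phi> s x \<Longrightarrow> f z = f x" using assms by (auto simp: gr_class_def r_coset_def)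
  moreover have "x \<in> gr_class G \<Phi> s x"
    unfolding gr_class_def using assms Phi_carrier subgroup_Phi[of "Suc s"] by (intro rcos_self) auto
  ultimately show ?thesis by blast
qed

lemma carrier_gr:
  "carrier (gr G \<Phi>) = {f \<in> \<Pi>\<^sub>E s\<in>{1..}. carrier (gr_degree G \<Phi> s). finite {s \<in> {1..}. f s \<noteq> \<one>\<^bsub>gr_degree G \<Phi> s\<^esub>}}"
proof -
  have "carrier (gr G \<Phi>) = carrier (sum_group {1..} (gr_degree G \<Phi>))" by (simp add: gr_def graded_sum_def)
  also have "\<dots> = {f \<in> \<Pi>\<^sub>E s\<in>{1..}. carrier (gr_degree G \<Phi> s). finite {s \<in> {1..}. f s \<noteq> \<one>\<^bsub>gr_degree G \<Phi> s\<^esub>}}"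
    by (rule carrier_sum_group) (simp add: group_gr_degree)
  finally show ?thesis .
qed

lemma gr_apply_closed: "\<lbrakk>f \<in> carrier (gr G \<Phi>); 1 \<le> s\<rbrakk> \<Longrightarrow> f s \<in> carrier (gr_degree G \<Phi> s)"
  by (auto simp: carrier_gr)

lemma gr_extensional: "f \<in> carrier (gr G \<Phi>) \<Longrightarrow> f \<in> extensional {1..}"
  by (auto simp: carrier_gr PiE_def)

lemma mult_gr: "f \<otimes>\<^bsub>gr G \<Phi>\<^esub> g = (\<lambda>s\<in>{1..}. f s \<otimes>\<^bsub>gr_degree G \<Phi> s\<^esub> g s)"
  by (simp add: gr_def graded_sum_def)

lemma one_gr: "\<one>\<^bsub>gr G \<Phi>\<^esub> = (\<lambda>s\<in>{1..}. \<one>\<^bsub>gr_degree G \<Phi> s\<^esub>)"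
  by (simp add: gr_def graded_sum_def)

lemma comm_group_gr: "comm_group (gr G \<Phi>)"
proof (rule comm_group_cong[OF group.group_comm_groupI])
  let ?S = "sum_group {1..} (gr_degree G \<Phi>)"
  show "group ?S" using group_gr_degree by (intro sum_group) auto
  have S: "carrier ?S = carrier (gr G \<Phi>)" by (simp add: gr_def graded_sum_def)
  show "x \<otimes>\<^bsub>?S\<^esub> y = y \<otimes>\<^bsub>?S\<^esub> x" if "x \<in> carrier ?S" "y \<in> carrier ?S" for x y
    unfolding mult_sum_group
  proof (rule restrict_ext)
    fix i :: nat assume "i \<in> {1..}"
    then have i: "1 \<le> i" by simp
    interpret A: comm_group "gr_degree G \<Phi> i" using i by (rule comm_group_gr_degree)
    show "x i \<otimes>\<^bsub>gr_degree G \<Phi> i\<^esub> y i = y i \<otimes>\<^bsub>gr_degree G \<Phi> i\<^esub> x i"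
      using that gr_apply_closed i unfolding S by (intro A.m_comm) auto
  qed
qed (simp_all add: gr_def graded_sum_def)

lemma homog_closed:
  assumes "1 \<le> s" "x \<in> \<Phi> s"
  shows "homog G \<Phi> s x \<in> carrier (gr G \<Phi>)"
proof -
  have "finite {n \<in> {1..}. homog G \<Phi> s x n \<noteq> \<one>\<^bsub>gr_degree G \<Phi> n\<^esub>}"
    by (rule finite_subset[of _ "{s}"]) (auto simp: homog_def)
  then show ?thesis
    using assms group_gr_degree gr_class_closed group.is_monoid[OF group_gr_degree]
    by (auto simp: carrier_gr homog_def monoid.one_closed)
qed

lemma homog_mult:
  assumes "1 \<le> s" "x \<in> \<Phi> s" "y \<in> \<Phi> s"
  shows "homog G \<Phi> s x \<otimes>\<^bsub>gr G \<Phi>\<^esub> homog G \<Phi> s y = homog G \<Phi> s (x \<otimes> y)"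
proof -
  have "\<one>\<^bsub>gr_degree G \<Phi> n\<^esub> \<otimes>\<^bsub>gr_degree G \<Phi> n\<^esub> \<one>\<^bsub>gr_degree G \<Phi> n\<^esub> = \<one>\<^bsub>gr_degree G \<Phi> n\<^esub>" if "1 \<le> n" for n
    using group.is_monoid[OF group_gr_degree[OF that]] by (simp add: monoid.one_closed monoid.r_one)
  then show ?thesis
    using assms unfolding mult_gr homog_def by (intro restrict_ext) (simp add: gr_class_mult)
qed

lemma homog_one: "1 \<le> s \<Longrightarrow> homog G \<Phi> s \<one> = \<one>\<^bsub>gr G \<Phi>\<^esub>"
  unfolding homog_def one_gr by (intro restrict_ext) (simp add: gr_class_one)

lemma homog_eq_iff:
  assumes "1 \<le> s" "x \<in> \<Phi> s" "y \<in> \<Phi> s"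
  shows "homog G \<Phi> s x = homog G \<Phi> s y \<longleftrightarrow> x \<otimes> inv y \<in> \<Phi> (Suc s)"
proof
  assume "homog G \<Phi> s x = homog G \<Phi> s y"
  then have "homog G \<Phi> s x s = homog G \<Phi> s y s" by simp
  then show "x \<otimes> inv y \<in> \<Phi> (Suc s)" using assms by (simp add: homog_def gr_class_eq_iff)
next
  assume "x \<otimes> inv y \<in> \<Phi> (Suc s)"
  then have "gr_class G \<Phi> s x = gr_class G \<Phi> s y" using assms by (simp add: gr_class_eq_iff)
  then show "homog G \<Phi> s x = homog G \<Phi> s y"
    unfolding homog_def by (intro restrict_ext) simp
qed

lemma component_gr:
  assumes s: "1 \<le> s"
  shows "component (gr G \<Phi>) s = homog G \<Phi> s ` \<Phi> s"
proof
  have e: "component (gr G \<Phi>) s = {x \<in> carrier (gr G \<Phi>). \<forall>t\<ge>1. t \<noteq> s \<longrightarrow> x t = \<one>\<^bsub>gr_degree G \<Phi> t\<^esub>}"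
    by (simp add: gr_def graded_sum_def)
  show "homog G \<Phi> s ` \<Phi> s \<subseteq> component (gr G \<Phi>) s"
    using homog_closed[OF s] by (auto simp: e homog_def)
  show "component (gr G \<Phi>) s \<subseteq> homog G \<Phi> s ` \<Phi> s"
  proof
    fix f assume f: "f \<in> component (gr G \<Phi>) s"
    then have fc: "f \<in> carrier (gr G \<Phi>)" and f1: "\<And>t. \<lbrakk>1 \<le> t; t \<noteq> s\<rbrakk> \<Longrightarrow> f t = \<one>\<^bsub>gr_degree G \<Phi> t\<^esub>" by (auto simp: e)
    obtain x where x: "x \<in> \<Phi> s" "f s = gr_class G \<Phi> s x"
      using gr_apply_closed[OF fc s] by (auto simp: carrier_gr_degree)
    have "f = homog G \<Phi> s x"
      using f1 x by (intro extensionalityI[OF gr_extensional[OF fc], of "homog G \<Phi> s x"]) (auto simp: homog_def)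
    then show "f \<in> homog G \<Phi> s ` \<Phi> s" using x by blast
  qed
qed

text \<open>Induction on a finite set containing the support, removing one degree at a time. The
  zero element is covered by \<open>homog\<close>, as the class of the unit in degree 1.\<close>

lemma gr_induct [consumes 1, case_names homog mult]:
  assumes f: "f \<in> carrier (gr G \<Phi>)"
    and hom: "\<And>s x. \<lbrakk>1 \<le> s; x \<in> \<Phi> s\<rbrakk> \<Longrightarrow> P (homog G \<Phi> s x)"
    and mult: "\<And>f g. \<lbrakk>f \<in> carrier (gr G \<Phi>); g \<in> carrier (gr G \<Phi>); P f; P g\<rbrakk> \<Longrightarrow> P (f \<otimes>\<^bsub>gr G \<Phi>\<^esub> g)"
  shows "P f"
proof -
  have "P f" if "finite S" "f \<in> carrier (gr G \<Phi>)" "\<And>s. \<lbrakk>1 \<le> s; f s \<noteq> \<one>\<^bsub>gr_degree G \<Phi> s\<^esub>\<rbrakk> \<Longrightarrow> s \<in> S" for S f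
    using that
  proof (induction S arbitrary: f rule: finite_induct)
    case empty
    then have "f = \<one>\<^bsub>gr G \<Phi>\<^esub>"
      by (intro extensionalityI[OF gr_extensional[OF empty(1)], of "\<one>\<^bsub>gr G \<Phi>\<^esub>"]) (auto simp: one_gr)
    then show ?case using hom[of 1 \<one>] by (simp add: homog_one)
  next
    case (insert n S)
    show ?case
    proof (cases "1 \<le> n")
      case False
      then show ?thesis using insert by (metis insertE)
    next
      case n: True
      note fc = insert.prems(1)
      obtain x where x: "x \<in> \<Phi> n" "f n = gr_class G \<Phi> n x"
        using gr_apply_closed[OF fc n] by (auto simp: carrier_gr_degree)
      \<comment> \<open>f with its degree n part erased, so that its support lies in S.\<close>
      define g where "g = (\<lambda>s\<in>{1..}. if s = n then \<one>\<^bsub>gr_degree G \<Phi> n\<^esub> else f s)"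
      note mon = group.is_monoid[OF group_gr_degree]
      have "finite {s \<in> {1..}. g s \<noteq> \<one>\<^bsub>gr_degree G \<Phi> s\<^esub>}"
        by (rule finite_subset[of _ "{s \<in> {1..}. f s \<noteq> \<one>\<^bsub>gr_degree G \<Phi> s\<^esub>}"])
          (use fc in \<open>auto simp: g_def carrier_gr\<close>)
      then have g: "g \<in> carrier (gr G \<Phi>)"
        using gr_apply_closed[OF fc] monoid.one_closed[OF mon] by (auto simp: carrier_gr g_def)
      have "P g"
        by (rule insert.IH[OF g]) (use insert.prems(2) in \<open>auto simp: g_def split: if_splits\<close>)
      moreover have "f = homog G \<Phi> n x \<otimes>\<^bsub>gr G \<Phi>\<^esub> g"
        using x gr_apply_closed[OF fc] gr_class_closed monoid.r_one[OF mon] monoid.l_one[OF mon]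
        by (intro extensionalityI[OF gr_extensional[OF fc], of "homog G \<Phi> n x \<otimes>\<^bsub>gr G \<Phi>\<^esub> g"])
          (auto simp: mult_gr homog_def g_def)
      ultimately show ?thesis using mult[OF homog_closed[OF n x(1)] g] hom[OF n x(1)] by simp
    qed
  qed
  from this[of "{s \<in> {1..}. f s \<noteq> \<one>\<^bsub>gr_degree G \<Phi> s\<^esub>}" f] f show ?thesis by (auto simp: carrier_gr)
qed

lemma gr_eqI:
  assumes "f \<in> carrier (gr G \<Phi>)" "g \<in> carrier (gr G \<Phi>)" "\<And>n. 1 \<le> n \<Longrightarrow> f n = g n"
  shows "f = g"
  using assms by (intro extensionalityI[OF gr_extensional gr_extensional]) auto

end

section \<open>Pairings of filtered groups and their convolution\<close>

locale filtered_pairing = H: N_series H \<Phi> + M: N_series M \<Psi> + K: N_series K \<Theta>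
  for H :: "('a, 'h) monoid_scheme" and \<Phi> and M :: "('b, 'm) monoid_scheme" and \<Psi>
    and K :: "('c, 'k) monoid_scheme" and \<Theta> +
  fixes m :: "'a \<Rightarrow> 'b \<Rightarrow> 'c"
  assumes pair_closed: "\<lbrakk>1 \<le> s; 1 \<le> t; x \<in> \<Phi> s; y \<in> \<Psi> t\<rbrakk> \<Longrightarrow> m x y \<in> \<Theta> (s + t)"
    and pair_left: "\<lbrakk>1 \<le> s; 1 \<le> t; x \<in> \<Phi> s; x' \<in> \<Phi> s; y \<in> \<Psi> t\<rbrakk>
      \<Longrightarrow> gr_class K \<Theta> (s + t) (m (x \<otimes>\<^bsub>H\<^esub> x') y) = gr_class K \<Theta> (s + t) (m x y \<otimes>\<^bsub>K\<^esub> m x' y)"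
    and pair_right: "\<lbrakk>1 \<le> s; 1 \<le> t; x \<in> \<Phi> s; y \<in> \<Psi> t; y' \<in> \<Psi> t\<rbrakk>
      \<Longrightarrow> gr_class K \<Theta> (s + t) (m x (y \<otimes>\<^bsub>M\<^esub> y')) = gr_class K \<Theta> (s + t) (m x y \<otimes>\<^bsub>K\<^esub> m x y')"
begin

definition pair_class :: "nat \<Rightarrow> 'a set \<Rightarrow> 'b set \<Rightarrow> 'c set" where
  "pair_class n U V = (\<Union>x\<in>U. \<Union>y\<in>V. \<Theta> (Suc n) #>\<^bsub>K\<^esub> m x y)"

text \<open>Additivity modulo the next step also gives independence of representatives: a factor i
  one step deeper contributes m i y in step s + t + 1, which vanishes in degree s + t.\<close>

lemma pair_class_eq:
  assumes s: "1 \<le> s" and t: "1 \<le> t" and x: "x \<in> \<Phi> s" and y: "y \<in> \<Psi> t"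
  shows "pair_class (s + t) (gr_class H \<Phi> s x) (gr_class M \<Psi> t y) = gr_class K \<Theta> (s + t) (m x y)"
proof -
  have st: "1 \<le> s + t" using s by simp
  have pc: "m x y \<in> \<Theta> (s + t)" using s t x y by (rule pair_closed)
  interpret A: comm_group "gr_degree K \<Theta> (s + t)" using st by (rule K.comm_group_gr_degree)
  have l: "gr_class K \<Theta> (s + t) (m (i \<otimes>\<^bsub>H\<^esub> x) z) = gr_class K \<Theta> (s + t) (m x z)"
    if i: "i \<in> \<Phi> (Suc s)" and z: "z \<in> \<Psi> t" for i z
  proof -
    have i': "i \<in> \<Phi> s" using H.Phi_Suc[OF s] i by blast
    have "m i z \<in> \<Theta> (Suc (s + t))" using pair_closed[OF _ t i z] by simp
    moreover have c: "m i z \<in> \<Theta> (s + t)" "m x z \<in> \<Theta> (s + t)" using pair_closed s t x i' z by auto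
    ultimately have "gr_class K \<Theta> (s + t) (m i z) = \<one>\<^bsub>gr_degree K \<Theta> (s + t)\<^esub>"
      using st by (simp add: K.gr_class_eq_one_iff)
    then show ?thesis
      using pair_left[OF s t i' x z] c st K.gr_class_closed by (simp flip: K.gr_class_mult)
  qed
  have r: "gr_class K \<Theta> (s + t) (m x (i \<otimes>\<^bsub>M\<^esub> y)) = gr_class K \<Theta> (s + t) (m x y)"
    if i: "i \<in> \<Psi> (Suc t)" for i
  proof -
    have it: "i \<in> \<Psi> t" using M.Phi_Suc[OF t] i by blast
    have "m x i \<in> \<Theta> (Suc (s + t))" using pair_closed[OF s _ x i] by simp
    moreover have c: "m x i \<in> \<Theta> (s + t)" using pair_closed s t x it by auto
    ultimately have "gr_class K \<Theta> (s + t) (m x i) = \<one>\<^bsub>gr_degree K \<Theta> (s + t)\<^esub>"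
      using st by (simp add: K.gr_class_eq_one_iff)
    then show ?thesis
      using pair_right[OF s t x it y] c pc st K.gr_class_closed by (simp flip: K.gr_class_mult)
  qed
  \<comment> \<open>The left union is collapsed while the right variable still runs over its whole
    class, so the invariance \<open>l\<close> is applied at all members of that class.\<close>
  have sub: "gr_class M \<Psi> t y \<subseteq> \<Psi> t"
    using M.Phi_Suc[OF t] y M.Phi_mult[OF t] by (auto simp: gr_class_def r_coset_def)
  have "pair_class (s + t) (gr_class H \<Phi> s x) (gr_class M \<Psi> t y)
      = (\<Union>x\<in>gr_class H \<Phi> s x. \<Union>y\<in>gr_class M \<Psi> t y. gr_class K \<Theta> (s + t) (m x y))"
    by (simp add: pair_class_def gr_class_def)
  also have "\<dots> = (\<Union>y\<in>gr_class M \<Psi> t y. gr_class K \<Theta> (s + t) (m x y))"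
    using s x l sub by (intro H.Union_gr_class SUP_cong) auto
  also have "\<dots> = gr_class K \<Theta> (s + t) (m x y)"
    using t y r by (intro M.Union_gr_class) auto
  finally show ?thesis .
qed

lemma pair_class_closed:
  assumes "1 \<le> s" "1 \<le> t" "U \<in> carrier (gr_degree H \<Phi> s)" "V \<in> carrier (gr_degree M \<Psi> t)"
  shows "pair_class (s + t) U V \<in> carrier (gr_degree K \<Theta> (s + t))"
  using assms pair_closed[OF assms(1,2)]
  by (auto simp: H.carrier_gr_degree M.carrier_gr_degree pair_class_eq K.gr_class_closed)

lemma pair_class_mult_left:
  assumes s: "1 \<le> s" and t: "1 \<le> t" and U: "U \<in> carrier (gr_degree H \<Phi> s)"
    and U': "U' \<in> carrier (gr_degree H \<Phi> s)" and V: "V \<in> carrier (gr_degree M \<Psi> t)"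
  shows "pair_class (s + t) (U \<otimes>\<^bsub>gr_degree H \<Phi> s\<^esub> U') V
    = pair_class (s + t) U V \<otimes>\<^bsub>gr_degree K \<Theta> (s + t)\<^esub> pair_class (s + t) U' V"
proof -
  obtain x x' y where e: "x \<in> \<Phi> s" "x' \<in> \<Phi> s" "y \<in> \<Psi> t"
    and "U = gr_class H \<Phi> s x" "U' = gr_class H \<Phi> s x'" "V = gr_class M \<Psi> t y"
    using U U' V by (auto simp: H.carrier_gr_degree M.carrier_gr_degree)
  then show ?thesis
    using s t H.Phi_mult pair_closed[OF s t] pair_left[OF s t e]
    by (simp add: H.gr_class_mult pair_class_eq K.gr_class_mult)
qed

lemma pair_class_mult_right:
  assumes s: "1 \<le> s" and t: "1 \<le> t" and U: "U \<in> carrier (gr_degree H \<Phi> s)"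
    and V: "V \<in> carrier (gr_degree M \<Psi> t)" and V': "V' \<in> carrier (gr_degree M \<Psi> t)"
  shows "pair_class (s + t) U (V \<otimes>\<^bsub>gr_degree M \<Psi> t\<^esub> V')
    = pair_class (s + t) U V \<otimes>\<^bsub>gr_degree K \<Theta> (s + t)\<^esub> pair_class (s + t) U V'"
proof -
  obtain x y y' where e: "x \<in> \<Phi> s" "y \<in> \<Psi> t" "y' \<in> \<Psi> t"
    and "U = gr_class H \<Phi> s x" "V = gr_class M \<Psi> t y" "V' = gr_class M \<Psi> t y'"
    using U V V' by (auto simp: H.carrier_gr_degree M.carrier_gr_degree)
  then show ?thesis
    using s t M.Phi_mult pair_closed[OF s t] pair_right[OF s t e]
    by (simp add: M.gr_class_mult pair_class_eq K.gr_class_mult)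
qed

abbreviation conv :: "(nat \<Rightarrow> 'a set) \<Rightarrow> (nat \<Rightarrow> 'b set) \<Rightarrow> nat \<Rightarrow> 'c set" where
  "conv \<equiv> gr_convolution K \<Theta> m"

lemma conv_apply:
  "1 \<le> n \<Longrightarrow> conv f g n = finprod (gr_degree K \<Theta> n) (\<lambda>s. pair_class n (f s) (g (n - s))) {1..<n}"
  by (simp add: gr_convolution_def pair_class_def)

lemma conv_summand_closed:
  assumes "f \<in> carrier (gr H \<Phi>)" "g \<in> carrier (gr M \<Psi>)" "s \<in> {1..<n}"
  shows "pair_class n (f s) (g (n - s)) \<in> carrier (gr_degree K \<Theta> n)"
  using pair_class_closed[of s "n - s"] assms H.gr_apply_closed M.gr_apply_closed by auto

lemma conv_mult_left:
  assumes f: "f \<in> carrier (gr H \<Phi>)" and f': "f' \<in> carrier (gr H \<Phi>)" and g: "g \<in> carrier (gr M \<Psi>)"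
  shows "conv (f \<otimes>\<^bsub>gr H \<Phi>\<^esub> f') g = conv f g \<otimes>\<^bsub>gr K \<Theta>\<^esub> conv f' g"
proof (rule extensionalityI)
  show "conv (f \<otimes>\<^bsub>gr H \<Phi>\<^esub> f') g \<in> extensional {1..}" by (simp add: gr_convolution_def)
  show "conv f g \<otimes>\<^bsub>gr K \<Theta>\<^esub> conv f' g \<in> extensional {1..}" by (simp add: K.mult_gr)
  fix n :: nat assume "n \<in> {1..}"
  then have n: "1 \<le> n" by simp
  interpret A: comm_group "gr_degree K \<Theta> n" using n by (rule K.comm_group_gr_degree)
  have "conv (f \<otimes>\<^bsub>gr H \<Phi>\<^esub> f') g n = finprod (gr_degree K \<Theta> n)
    (\<lambda>s. pair_class n (f s) (g (n - s)) \<otimes>\<^bsub>gr_degree K \<Theta> n\<^esub> pair_class n (f' s) (g (n - s))) {1..<n}"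
    unfolding conv_apply[OF n]
  proof (rule A.finprod_cong')
    fix s assume s: "s \<in> {1..<n}"
    then show "pair_class n ((f \<otimes>\<^bsub>gr H \<Phi>\<^esub> f') s) (g (n - s)) =
        pair_class n (f s) (g (n - s)) \<otimes>\<^bsub>gr_degree K \<Theta> n\<^esub> pair_class n (f' s) (g (n - s))"
      using pair_class_mult_left[of s "n - s" "f s" "f' s" "g (n - s)"] f f' g H.gr_apply_closed M.gr_apply_closed
      by (auto simp: H.mult_gr)
  qed (use f f' g conv_summand_closed in auto)
  also have "\<dots> = (conv f g \<otimes>\<^bsub>gr K \<Theta>\<^esub> conv f' g) n"
    using f f' g conv_summand_closed n by (subst A.finprod_multf) (auto simp: K.mult_gr conv_apply)
  finally show "conv (f \<otimes>\<^bsub>gr H \<Phi>\<^esub> f') g n = (conv f g \<otimes>\<^bsub>gr K \<Theta>\<^esub> conv f' g) n" .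
qed

lemma conv_mult_right:
  assumes f: "f \<in> carrier (gr H \<Phi>)" and g: "g \<in> carrier (gr M \<Psi>)" and g': "g' \<in> carrier (gr M \<Psi>)"
  shows "conv f (g \<otimes>\<^bsub>gr M \<Psi>\<^esub> g') = conv f g \<otimes>\<^bsub>gr K \<Theta>\<^esub> conv f g'"
proof (rule extensionalityI)
  show "conv f (g \<otimes>\<^bsub>gr M \<Psi>\<^esub> g') \<in> extensional {1..}" by (simp add: gr_convolution_def)
  show "conv f g \<otimes>\<^bsub>gr K \<Theta>\<^esub> conv f g' \<in> extensional {1..}" by (simp add: K.mult_gr)
  fix n :: nat assume "n \<in> {1..}"
  then have n: "1 \<le> n" by simp
  interpret A: comm_group "gr_degree K \<Theta> n" using n by (rule K.comm_group_gr_degree)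
  have "conv f (g \<otimes>\<^bsub>gr M \<Psi>\<^esub> g') n = finprod (gr_degree K \<Theta> n)
    (\<lambda>s. pair_class n (f s) (g (n - s)) \<otimes>\<^bsub>gr_degree K \<Theta> n\<^esub> pair_class n (f s) (g' (n - s))) {1..<n}"
    unfolding conv_apply[OF n]
  proof (rule A.finprod_cong')
    fix s assume s: "s \<in> {1..<n}"
    then show "pair_class n (f s) ((g \<otimes>\<^bsub>gr M \<Psi>\<^esub> g') (n - s)) =
        pair_class n (f s) (g (n - s)) \<otimes>\<^bsub>gr_degree K \<Theta> n\<^esub> pair_class n (f s) (g' (n - s))"
      using pair_class_mult_right[of s "n - s" "f s" "g (n - s)" "g' (n - s)"] f g g' H.gr_apply_closed M.gr_apply_closed
      by (auto simp: M.mult_gr)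
  qed (use f g g' conv_summand_closed in auto)
  also have "\<dots> = (conv f g \<otimes>\<^bsub>gr K \<Theta>\<^esub> conv f g') n"
    using f g g' conv_summand_closed n by (subst A.finprod_multf) (auto simp: K.mult_gr conv_apply)
  finally show "conv f (g \<otimes>\<^bsub>gr M \<Psi>\<^esub> g') n = (conv f g \<otimes>\<^bsub>gr K \<Theta>\<^esub> conv f g') n" .
qed

lemma pair_class_one:
  assumes "1 \<le> s" "1 \<le> t" "U \<in> carrier (gr_degree H \<Phi> s)"
  shows "pair_class (s + t) U \<one>\<^bsub>gr_degree M \<Psi> t\<^esub> = \<one>\<^bsub>gr_degree K \<Theta> (s + t)\<^esub>"
proof -
  interpret A: comm_group "gr_degree K \<Theta> (s + t)" using assms by (intro K.comm_group_gr_degree) simp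
  interpret B: comm_group "gr_degree M \<Psi> t" using assms by (intro M.comm_group_gr_degree)
  have "pair_class (s + t) U \<one>\<^bsub>gr_degree M \<Psi> t\<^esub> \<otimes>\<^bsub>gr_degree K \<Theta> (s + t)\<^esub> pair_class (s + t) U \<one>\<^bsub>gr_degree M \<Psi> t\<^esub>
    = pair_class (s + t) U \<one>\<^bsub>gr_degree M \<Psi> t\<^esub>"
    using pair_class_mult_right[OF assms B.one_closed B.one_closed] by simp
  then show ?thesis using pair_class_closed[OF assms B.one_closed] by simp
qed

text \<open>The first argument is kept arbitrary: only the splitting n = (n - t) + t contributes, so
  pairing with a homogeneous element isolates a single degree of f. Injectivity of J is read off
  from this.\<close>

lemma conv_homog_right:
  assumes f: "f \<in> carrier (gr H \<Phi>)" and t: "1 \<le> t" and y: "y \<in> \<Psi> t" and n: "1 \<le> n"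
  shows "conv f (homog M \<Psi> t y) n =
    (if t < n then pair_class n (f (n - t)) (gr_class M \<Psi> t y) else \<one>\<^bsub>gr_degree K \<Theta> n\<^esub>)"
proof -
  interpret A: comm_group "gr_degree K \<Theta> n" using n by (rule K.comm_group_gr_degree)
  have g: "homog M \<Psi> t y \<in> carrier (gr M \<Psi>)" using t y by (rule M.homog_closed)
  have zero: "pair_class n (f s) (homog M \<Psi> t y (n - s)) = \<one>\<^bsub>gr_degree K \<Theta> n\<^esub>"
    if s: "s \<in> {1..<n}" "n - s \<noteq> t" for s
  proof -
    have "1 \<le> n - s" using s by auto
    then show ?thesis
      using pair_class_one[of s "n - s" "f s"] s H.gr_apply_closed[OF f] by (simp add: homog_def)
  qed
  show ?thesis
  proof (cases "t < n")
    case True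
    have "pair_class n (f (n - t)) (homog M \<Psi> t y t) \<in> carrier (gr_degree K \<Theta> n)"
      using conv_summand_closed[OF f g, of "n - t" n] True t by simp
    then have "conv f (homog M \<Psi> t y) n = finprod (gr_degree K \<Theta> n)
      (\<lambda>s. if s = n - t then pair_class n (f s) (homog M \<Psi> t y (n - s)) else \<one>\<^bsub>gr_degree K \<Theta> n\<^esub>) {1..<n}"
      unfolding conv_apply[OF n] using zero True conv_summand_closed[OF f g]
      by (intro A.finprod_cong') auto
    also have "\<dots> = pair_class n (f (n - t)) (homog M \<Psi> t y (n - (n - t)))"
      using True t conv_summand_closed[OF f g] by (intro A.finprod_singleton_swap) auto
    finally show ?thesis using True t by (simp add: homog_def)
  next
    case False
    then show ?thesis
      unfolding conv_apply[OF n] if_not_P[OF False]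
      by (intro A.finprod_one_eqI zero) auto
  qed
qed

lemma conv_homog:
  assumes s: "1 \<le> s" and t: "1 \<le> t" and x: "x \<in> \<Phi> s" and y: "y \<in> \<Psi> t"
  shows "conv (homog H \<Phi> s x) (homog M \<Psi> t y) = homog K \<Theta> (s + t) (m x y)"
proof (rule extensionalityI)
  show "conv (homog H \<Phi> s x) (homog M \<Psi> t y) \<in> extensional {1..}" by (simp add: gr_convolution_def)
  show "homog K \<Theta> (s + t) (m x y) \<in> extensional {1..}" by (simp add: homog_def)
  fix n :: nat assume "n \<in> {1..}"
  then have n: "1 \<le> n" by simp
  have f: "homog H \<Phi> s x \<in> carrier (gr H \<Phi>)" using s x by (rule H.homog_closed)
  have "pair_class n \<one>\<^bsub>gr_degree H \<Phi> (n - t)\<^esub> (gr_class M \<Psi> t y) = \<one>\<^bsub>gr_degree K \<Theta> n\<^esub>" if "t < n"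
  proof -
    interpret A: comm_group "gr_degree K \<Theta> n" using n by (rule K.comm_group_gr_degree)
    interpret B: comm_group "gr_degree H \<Phi> (n - t)" using that by (intro H.comm_group_gr_degree) simp
    let ?P = "pair_class n \<one>\<^bsub>gr_degree H \<Phi> (n - t)\<^esub> (gr_class M \<Psi> t y)"
    have V: "gr_class M \<Psi> t y \<in> carrier (gr_degree M \<Psi> t)" using y by (rule M.gr_class_closed)
    have "?P \<otimes>\<^bsub>gr_degree K \<Theta> n\<^esub> ?P = ?P"
      using pair_class_mult_left[OF _ t B.one_closed B.one_closed V] that by simp
    moreover have "?P \<in> carrier (gr_degree K \<Theta> n)"
      using pair_class_closed[OF _ t B.one_closed V] that by simp
    ultimately show ?thesis by simp
  qed
  note zero = this
  show "conv (homog H \<Phi> s x) (homog M \<Psi> t y) n = homog K \<Theta> (s + t) (m x y) n"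
  proof (cases "n = s + t")
    case True
    then show ?thesis
      unfolding conv_homog_right[OF f t y n]
      using n s t pair_class_eq[OF s t x y] by (simp add: homog_def)
  next
    case False
    then have "homog H \<Phi> s x (n - t) = \<one>\<^bsub>gr_degree H \<Phi> (n - t)\<^esub>" if "t < n"
      using that by (auto simp: homog_def)
    then show ?thesis
      unfolding conv_homog_right[OF f t y n]
      using False n zero by (simp add: homog_def[of K])
  qed
qed

text \<open>The point is finite support. Bilinearity reduces it to homogeneous arguments, whose
  product is homogeneous.\<close>

lemma conv_closed:
  assumes "f \<in> carrier (gr H \<Phi>)" "g \<in> carrier (gr M \<Psi>)"
  shows "conv f g \<in> carrier (gr K \<Theta>)"
proof -
  interpret R: comm_group "gr K \<Theta>" by (rule K.comm_group_gr)
  show ?thesis using assms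
  proof (induction f rule: H.gr_induct)
    case (homog s x)
    from homog(3) show ?case
    proof (induction g rule: M.gr_induct)
      case (homog t y)
      then show ?case
        using \<open>1 \<le> s\<close> \<open>x \<in> \<Phi> s\<close> by (simp add: conv_homog K.homog_closed pair_closed)
    next
      case (mult g g')
      then show ?case
        using H.homog_closed[OF \<open>1 \<le> s\<close> \<open>x \<in> \<Phi> s\<close>] by (simp add: conv_mult_right)
    qed
  next
    case (mult f f')
    then show ?case by (simp add: conv_mult_left)
  qed
qed

end

section \<open>The commutator bracket on the associated graded\<close>

context N_series
begin

lemma homog_class_cong: "gr_class G \<Phi> s x = gr_class G \<Phi> s y \<Longrightarrow> homog G \<Phi> s x = homog G \<Phi> s y"
  by (simp only: homog_def)

text \<open>The expansions of (x x', y) and (x, y y') are additive up to one conjugated factor and,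
  in the first, up to the order of the factors. Both defects vanish in an abelian graded piece on
  which conjugation is trivial.\<close>

lemma filtered_pairing_commutator: "filtered_pairing G \<Phi> G \<Phi> G \<Phi> (commutator G)"
proof (intro filtered_pairing.intro filtered_pairing_axioms.intro N_series_axioms)
  fix s t x y assume s: "1 \<le> s" and t: "1 \<le> t" and x: "x \<in> \<Phi> s" and y: "y \<in> \<Phi> t"
  then show c: "commutator G x y \<in> \<Phi> (s + t)" by (rule Phi_commutator)
  have xc: "x \<in> carrier G" and yc: "y \<in> carrier G" using s t x y Phi_carrier by auto
  have st: "1 \<le> s + t" using s by simp
  interpret A: comm_group "gr_degree G \<Phi> (s + t)" using st by (rule comm_group_gr_degree)
  show "gr_class G \<Phi> (s + t) (commutator G (x \<otimes> x') y)
      = gr_class G \<Phi> (s + t) (commutator G x y \<otimes> commutator G x' y)" if x': "x' \<in> \<Phi> s" for x'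
  proof -
    have c': "commutator G x' y \<in> \<Phi> (s + t)" using s t x' y by (rule Phi_commutator)
    have "commutator G (x \<otimes> x') y = (x \<otimes> commutator G x' y \<otimes> inv x) \<otimes> commutator G x y"
      using xc yc x' s Phi_carrier by (intro commutator_mult_left) auto
    then have "gr_class G \<Phi> (s + t) (commutator G (x \<otimes> x') y)
        = gr_class G \<Phi> (s + t) (commutator G x' y) \<otimes>\<^bsub>gr_degree G \<Phi> (s + t)\<^esub> gr_class G \<Phi> (s + t) (commutator G x y)"
      using gr_class_conj[OF s st x c'] Phi_conj[OF s st x c'] c st by (simp flip: gr_class_mult)
    then show ?thesis
      using c c' st gr_class_closed A.m_comm by (simp flip: gr_class_mult)
  qed
  show "gr_class G \<Phi> (s + t) (commutator G x (y \<otimes> y'))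
      = gr_class G \<Phi> (s + t) (commutator G x y \<otimes> commutator G x y')" if y': "y' \<in> \<Phi> t" for y'
  proof -
    have c': "commutator G x y' \<in> \<Phi> (s + t)" using s t x y' by (rule Phi_commutator)
    have "commutator G x (y \<otimes> y') = commutator G x y \<otimes> (y \<otimes> commutator G x y' \<otimes> inv y)"
      using xc yc y' t Phi_carrier by (intro commutator_mult_right) auto
    then show ?thesis
      using gr_class_conj[OF t st y c'] Phi_conj[OF t st y c'] c c' st by (simp flip: gr_class_mult)
  qed
qed

end

sublocale N_series \<subseteq> comm: filtered_pairing G \<Phi> G \<Phi> G \<Phi> "commutator G"
  by (rule filtered_pairing_commutator)

context N_series
begin

lemma bracket_gr:
  assumes f: "f \<in> carrier (gr G \<Phi>)" and g: "g \<in> carrier (gr G \<Phi>)"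
  shows "bracket (gr G \<Phi>) f g = gr_convolution G \<Phi> (commutator G) f g"
  unfolding gr_def graded_sum_def gr_convolution_def graded_lie.simps
proof (rule restrict_ext)
  fix n :: nat assume "n \<in> {1..}"
  then interpret A: comm_group "gr_degree G \<Phi> n" by (intro comm_group_gr_degree) simp
  show "finprod (gr_degree G \<Phi> n)
      (\<lambda>s. \<Union>x\<in>f s. \<Union>y\<in>g (n - s). \<Phi> (Suc (s + (n - s))) #> commutator G x y) {1..<n}
    = finprod (gr_degree G \<Phi> n) (\<lambda>s. \<Union>x\<in>f s. \<Union>y\<in>g (n - s). \<Phi> (Suc n) #> commutator G x y) {1..<n}"
    using comm.conv_summand_closed[OF f g] by (intro A.finprod_cong') (auto simp: comm.pair_class_def)
qed

lemma bracket_gr_homog: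
  assumes "1 \<le> s" "1 \<le> t" "x \<in> \<Phi> s" "y \<in> \<Phi> t"
  shows "bracket (gr G \<Phi>) (homog G \<Phi> s x) (homog G \<Phi> t y) = homog G \<Phi> (s + t) (commutator G x y)"
  using assms by (simp add: bracket_gr homog_closed comm.conv_homog)

text \<open>Removes the conjugations from Hall-Witt: y z y^-1 = (y,z) z, and (w,(y,z)) lies in
  degree p + q + r, beyond p + r since q \<ge> 1.\<close>

lemma gr_class_commutator_conj:
  assumes p: "1 \<le> p" and q: "1 \<le> q" and r: "1 \<le> r" and w: "w \<in> \<Phi> p" and y: "y \<in> \<Phi> q" and z: "z \<in> \<Phi> r"
  shows "gr_class G \<Phi> (p + r) (commutator G w (y \<otimes> z \<otimes> inv y)) = gr_class G \<Phi> (p + r) (commutator G w z)"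
proof -
  have pr: "1 \<le> p + r" using p by simp
  interpret A: comm_group "gr_degree G \<Phi> (p + r)" using pr by (rule comm_group_gr_degree)
  have yz: "commutator G y z \<in> \<Phi> (Suc r)" using Phi_mono[OF Phi_commutator[OF q r y z], of "Suc r"] q by simp
  have yz': "commutator G y z \<in> \<Phi> r" using yz Phi_Suc[OF r] by blast
  have 1: "commutator G w (commutator G y z) \<in> \<Phi> (Suc (p + r))" using Phi_commutator[OF p _ w yz] by simp
  have 2: "commutator G w (commutator G y z) \<in> \<Phi> (p + r)" "commutator G w z \<in> \<Phi> (p + r)"
    using Phi_commutator p r w yz' z by auto
  have "y \<otimes> z \<otimes> inv y = commutator G y z \<otimes> z" using q r y z Phi_carrier by (intro conj_eq_commutator) auto
  then have "gr_class G \<Phi> (p + r) (commutator G w (y \<otimes> z \<otimes> inv y))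
      = gr_class G \<Phi> (p + r) (commutator G w (commutator G y z) \<otimes> commutator G w z)"
    using comm.pair_right[OF p r w yz' z] by simp
  also have "\<dots> = gr_class G \<Phi> (p + r) (commutator G w (commutator G y z))
      \<otimes>\<^bsub>gr_degree G \<Phi> (p + r)\<^esub> gr_class G \<Phi> (p + r) (commutator G w z)"
    using 2 pr by (simp add: gr_class_mult)
  also have "gr_class G \<Phi> (p + r) (commutator G w (commutator G y z)) = \<one>\<^bsub>gr_degree G \<Phi> (p + r)\<^esub>"
    using 1 2 pr by (simp add: gr_class_eq_one_iff)
  finally show ?thesis using 2 gr_class_closed by simp
qed

text \<open>Hall-Witt has commutators of the form ((x,y),z), while Jacobi has their inverses
  (z,(x,y)); the Jacobi sum is thus the inverse of the Hall-Witt sum in the abelian group of degree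
  s + t + u.\<close>

lemma homog_jacobi:
  assumes s: "1 \<le> s" and t: "1 \<le> t" and u: "1 \<le> u" and x: "x \<in> \<Phi> s" and y: "y \<in> \<Phi> t" and z: "z \<in> \<Phi> u"
  shows "homog G \<Phi> (s + (t + u)) (commutator G x (commutator G y z))
    \<otimes>\<^bsub>gr G \<Phi>\<^esub> homog G \<Phi> (t + (u + s)) (commutator G y (commutator G z x))
    \<otimes>\<^bsub>gr G \<Phi>\<^esub> homog G \<Phi> (u + (s + t)) (commutator G z (commutator G x y)) = \<one>\<^bsub>gr G \<Phi>\<^esub>"
proof -
  define n where "n = s + t + u"
  have n: "1 \<le> n" "s + (t + u) = n" "t + (u + s) = n" "u + (s + t) = n"
    "s + t + u = n" "t + u + s = n" "u + s + t = n"
    using s by (auto simp: n_def)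
  interpret A: comm_group "gr_degree G \<Phi> n" using n(1) by (rule comm_group_gr_degree)
  let ?c = "gr_class G \<Phi> n"
  note c = Phi_carrier[OF s x] Phi_carrier[OF t y] Phi_carrier[OF u z]
  have xy: "commutator G x y \<in> \<Phi> (s + t)" and yz: "commutator G y z \<in> \<Phi> (t + u)" and zx: "commutator G z x \<in> \<Phi> (u + s)"
    using Phi_commutator s t u x y z by auto
  let ?A = "commutator G (commutator G x y) z" and ?B = "commutator G (commutator G y z) x"
    and ?C = "commutator G (commutator G z x) y"
  let ?A' = "commutator G (commutator G x y) (y \<otimes> z \<otimes> inv y)" and ?B' = "commutator G (commutator G y z) (z \<otimes> x \<otimes> inv z)"
    and ?C' = "commutator G (commutator G z x) (x \<otimes> y \<otimes> inv x)"
  have ABC: "?A \<in> \<Phi> n" "?B \<in> \<Phi> n" "?C \<in> \<Phi> n"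
    using Phi_commutator[OF _ u xy z] Phi_commutator[OF _ s yz x] Phi_commutator[OF _ t zx y] s t u n by simp_all
  have ABC': "?A' \<in> \<Phi> n" "?B' \<in> \<Phi> n" "?C' \<in> \<Phi> n"
    using Phi_commutator[OF _ u xy Phi_conj[OF t u y z]] Phi_commutator[OF _ s yz Phi_conj[OF u s z x]]
      Phi_commutator[OF _ t zx Phi_conj[OF s t x y]] s t u n by simp_all
  have "?c ?A' = ?c ?A" "?c ?B' = ?c ?B" "?c ?C' = ?c ?C"
    using gr_class_commutator_conj[OF _ t u xy y z] gr_class_commutator_conj[OF _ u s yz z x]
      gr_class_commutator_conj[OF _ s t zx x y] s t u n by simp_all
  moreover have "?c (?A' \<otimes> ?B' \<otimes> ?C') = \<one>\<^bsub>gr_degree G \<Phi> n\<^esub>"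
    unfolding hall_witt[OF c] using n(1) by (rule gr_class_one)
  ultimately have 1: "?c ?A \<otimes>\<^bsub>gr_degree G \<Phi> n\<^esub> ?c ?B \<otimes>\<^bsub>gr_degree G \<Phi> n\<^esub> ?c ?C = \<one>\<^bsub>gr_degree G \<Phi> n\<^esub>"
    using ABC' n(1) Phi_mult by (simp flip: gr_class_mult)
  have inv: "commutator G x (commutator G y z) = inv ?B" "commutator G y (commutator G z x) = inv ?C"
    "commutator G z (commutator G x y) = inv ?A"
    using c by (simp_all add: inv_commutator)
  have "?c (inv ?B \<otimes> inv ?C \<otimes> inv ?A)
      = inv\<^bsub>gr_degree G \<Phi> n\<^esub> (?c ?A \<otimes>\<^bsub>gr_degree G \<Phi> n\<^esub> ?c ?B \<otimes>\<^bsub>gr_degree G \<Phi> n\<^esub> ?c ?C)"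
    using ABC gr_class_closed[of _ n] n(1) Phi_inv[OF n(1)] Phi_mult[OF n(1)]
    by (simp add: A.inv_mult A.m_ac gr_class_inv flip: gr_class_mult)
  also have "\<dots> = ?c \<one>" unfolding 1 using n(1) by (simp add: gr_class_one)
  finally have "homog G \<Phi> n (inv ?B \<otimes> inv ?C \<otimes> inv ?A) = homog G \<Phi> n \<one>" by (rule homog_class_cong)
  then show ?thesis
    unfolding n(2-4) inv using ABC n(1) Phi_inv[OF n(1)] Phi_mult[OF n(1)] by (simp add: homog_mult homog_one)
qed

lemma graded_lie_algebra_gr: "graded_lie_algebra (gr G \<Phi>)"
proof -
  let ?L = "gr G \<Phi>"
  interpret L: comm_group ?L by (rule comm_group_gr)
  have closed: "bracket ?L x y \<in> carrier ?L" if "x \<in> carrier ?L" "y \<in> carrier ?L" for x y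
    using that by (simp add: bracket_gr comm.conv_closed)
  have left: "bracket ?L (x \<otimes>\<^bsub>?L\<^esub> y) z = bracket ?L x z \<otimes>\<^bsub>?L\<^esub> bracket ?L y z"
    if "x \<in> carrier ?L" "y \<in> carrier ?L" "z \<in> carrier ?L" for x y z
    using that by (simp add: bracket_gr comm.conv_mult_left)
  have right: "bracket ?L x (y \<otimes>\<^bsub>?L\<^esub> z) = bracket ?L x y \<otimes>\<^bsub>?L\<^esub> bracket ?L x z"
    if "x \<in> carrier ?L" "y \<in> carrier ?L" "z \<in> carrier ?L" for x y z
    using that by (simp add: bracket_gr comm.conv_mult_right)
  \<comment> \<open>Needed before alternation: the map sending x to [x,x] is not additive, and its
    expansion on x + y leaves [x,y] + [y,x].\<close>
  have skew: "bracket ?L x y \<otimes>\<^bsub>?L\<^esub> bracket ?L y x = \<one>\<^bsub>?L\<^esub>" if "x \<in> carrier ?L" "y \<in> carrier ?L" for x y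
    using that
  proof (induction x rule: gr_induct)
    case (homog s x)
    from homog(3) show ?case
    proof (induction y rule: gr_induct)
      case (homog t y)
      have "commutator G x y \<otimes> commutator G y x = \<one>"
        using inv_commutator[of y x] homog Phi_carrier \<open>1 \<le> s\<close> \<open>x \<in> \<Phi> s\<close> by (metis commutator_closed l_inv)
      then show ?case
        using homog \<open>1 \<le> s\<close> \<open>x \<in> \<Phi> s\<close> Phi_commutator[of s t x y] Phi_commutator[of t s y x]
        by (simp add: bracket_gr_homog add.commute[of t s] homog_mult homog_one)
    next
      case (mult y z)
      then show ?case
        using homog_closed[OF homog(1,2)] L.mult_interchange
        by (simp add: left right closed)
    qed
  next
    case (mult x z)
    then show ?case by (simp add: left right closed L.mult_interchange)
  qed
  have alt: "bracket ?L x x = \<one>\<^bsub>?L\<^esub>" if "x \<in> carrier ?L" for x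
    using that
  proof (induction x rule: gr_induct)
    case (homog s x)
    then show ?case using Phi_carrier by (simp add: bracket_gr_homog commutator_self homog_one)
  next
    case (mult x y)
    then show ?case by (simp add: left right closed skew)
  qed
  have interchange: "(a \<otimes>\<^bsub>?L\<^esub> a') \<otimes>\<^bsub>?L\<^esub> (b \<otimes>\<^bsub>?L\<^esub> b') \<otimes>\<^bsub>?L\<^esub> (c \<otimes>\<^bsub>?L\<^esub> c')
      = (a \<otimes>\<^bsub>?L\<^esub> b \<otimes>\<^bsub>?L\<^esub> c) \<otimes>\<^bsub>?L\<^esub> (a' \<otimes>\<^bsub>?L\<^esub> b' \<otimes>\<^bsub>?L\<^esub> c')"
    if "a \<in> carrier ?L" "b \<in> carrier ?L" "c \<in> carrier ?L" "a' \<in> carrier ?L" "b' \<in> carrier ?L" "c' \<in> carrier ?L"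
    for a b c a' b' c'
    using that by (simp add: L.m_ac)
  have jac: "bracket ?L x (bracket ?L y z) \<otimes>\<^bsub>?L\<^esub> bracket ?L y (bracket ?L z x)
      \<otimes>\<^bsub>?L\<^esub> bracket ?L z (bracket ?L x y) = \<one>\<^bsub>?L\<^esub>"
    if "x \<in> carrier ?L" "y \<in> carrier ?L" "z \<in> carrier ?L" for x y z
    using that
  proof (induction x rule: gr_induct)
    case x: (homog s x)
    note xc = homog_closed[OF x(1,2)]
    from x(3,4) show ?case
    proof (induction y rule: gr_induct)
      case y: (homog t y)
      note yc = homog_closed[OF y(1,2)]
      from y(3) show ?case
      proof (induction z rule: gr_induct)
        case z: (homog u z)
        show ?case
          using x(1,2) y(1,2) z homog_jacobi[OF x(1) y(1) z(1) x(2) y(2) z(2)]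
          by (simp add: bracket_gr_homog Phi_commutator)
      next
        case (mult z z')
        then show ?case using xc yc by (simp add: left right closed interchange)
      qed
    next
      case (mult y y')
      then show ?case using xc by (simp add: left right closed interchange)
    qed
  next
    case (mult x x')
    then show ?case by (simp add: left right closed interchange)
  qed
  show ?thesis
  proof (intro graded_lie_algebra.intro graded_lie_algebra_axioms.intro comm_group_gr closed left right alt jac)
    show sub: "subgroup (component ?L s) ?L" if s: "1 \<le> s" for s
      unfolding component_gr[OF s]
    proof (rule L.subgroupI)
      show "homog G \<Phi> s ` \<Phi> s \<subseteq> carrier ?L" using homog_closed[OF s] by blast
      show "homog G \<Phi> s ` \<Phi> s \<noteq> {}" using Phi_one[OF s] by blast
      show "inv\<^bsub>?L\<^esub> f \<in> homog G \<Phi> s ` \<Phi> s" if f: "f \<in> homog G \<Phi> s ` \<Phi> s" for f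
      proof -
        obtain x where x: "x \<in> \<Phi> s" "f = homog G \<Phi> s x" using f by blast
        have "inv\<^bsub>?L\<^esub> f = homog G \<Phi> s (inv x)"
          unfolding x(2) using s x(1) Phi_inv homog_closed Phi_carrier
          by (intro L.inv_equality) (auto simp: homog_mult homog_one)
        then show ?thesis using Phi_inv[OF s x(1)] by blast
      qed
      show "f \<otimes>\<^bsub>?L\<^esub> g \<in> homog G \<Phi> s ` \<Phi> s" if "f \<in> homog G \<Phi> s ` \<Phi> s" "g \<in> homog G \<Phi> s ` \<Phi> s" for f g
        using that s Phi_mult by (auto simp: homog_mult)
    qed
    show "bracket ?L f g \<in> component ?L (s + t)"
      if "1 \<le> s" "1 \<le> t" "f \<in> component ?L s" "g \<in> component ?L t" for s t f g
      using that Phi_commutator by (auto simp: component_gr bracket_gr_homog)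
    show "(\<lambda>f. gfinprod ?L f {1..}) \<in> iso (sum_group {1..} (\<lambda>s. ?L\<lparr>carrier := component ?L s\<rparr>)) ?L"
    proof (rule L.direct_sum_isoI[where K = ?L])
      show "subgroup (component ?L s) ?L" if "1 \<le> s" for s using that by (rule sub)
      show "carrier ?L \<subseteq> H" if H: "subgroup H ?L" and c: "\<And>s. 1 \<le> s \<Longrightarrow> component ?L s \<subseteq> H" for H
      proof
        fix f assume "f \<in> carrier ?L"
        then show "f \<in> H"
        proof (induction rule: gr_induct)
          case (homog s x)
          then show ?case using c[of s] by (auto simp: component_gr)
        next
          case (mult f g)
          then show ?case using subgroup.m_closed[OF H] by simp
        qed
      qed
      fix n f assume n: "1 \<le> n" and f: "f \<in> component ?L n" and f1: "f \<noteq> \<one>\<^bsub>?L\<^esub>"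
      interpret A: comm_group "gr_degree G \<Phi> n" using n by (rule comm_group_gr_degree)
      \<comment> \<open>The projection to degree n, which serves as the detecting
        homomorphism.\<close>
      let ?p = "\<lambda>g. \<lambda>m\<in>{1..}. if m = n then g n else \<one>\<^bsub>gr_degree G \<Phi> m\<^esub>"
      have p: "?p g = homog G \<Phi> n x" if "g n = gr_class G \<Phi> n x" for g x
        unfolding homog_def that ..
      have rep: "\<exists>x\<in>\<Phi> n. g n = gr_class G \<Phi> n x" if "g \<in> carrier ?L" for g
        using gr_apply_closed[OF that n] by (auto simp: carrier_gr_degree)
      have "?p \<in> hom ?L ?L"
      proof (rule homI)
        show "?p g \<in> carrier ?L" if "g \<in> carrier ?L" for g
          using rep[OF that] p homog_closed[OF n] by metis
        fix g h assume g: "g \<in> carrier ?L" and h: "h \<in> carrier ?L"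
        obtain x y where x: "x \<in> \<Phi> n" "g n = gr_class G \<Phi> n x" and y: "y \<in> \<Phi> n" "h n = gr_class G \<Phi> n y"
          using rep g h by metis
        have "(g \<otimes>\<^bsub>?L\<^esub> h) n = gr_class G \<Phi> n (x \<otimes> y)" using n x y by (simp add: mult_gr gr_class_mult)
        then have "?p (g \<otimes>\<^bsub>?L\<^esub> h) = homog G \<Phi> n (x \<otimes> y)" by (rule p)
        moreover have "?p g = homog G \<Phi> n x" using x(2) by (rule p)
        moreover have "?p h = homog G \<Phi> n y" using y(2) by (rule p)
        ultimately show "?p (g \<otimes>\<^bsub>?L\<^esub> h) = ?p g \<otimes>\<^bsub>?L\<^esub> ?p h"
          using n x y by (simp only: homog_mult)
      qed
      moreover obtain x where x: "x \<in> \<Phi> n" "f = homog G \<Phi> n x" using f component_gr[OF n] by blast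
      then have "?p f = f" using n p[of f x] by (simp add: homog_def[of _ _ n x])
      then have "?p f \<noteq> \<one>\<^bsub>?L\<^esub>" using f1 by (simp only: not_False_eq_True)
      moreover have "?p g = \<one>\<^bsub>?L\<^esub>" if "1 \<le> s" "s \<noteq> n" "g \<in> component ?L s" for s g
        using that n p[of g \<one>] by (auto simp: component_gr homog_one gr_class_one) (auto simp: homog_def)
      ultimately show "\<exists>p\<in>hom ?L ?L. p f \<noteq> \<one>\<^bsub>?L\<^esub> \<and> (\<forall>s\<ge>1. s \<noteq> n \<longrightarrow> p ` component ?L s \<subseteq> {\<one>\<^bsub>?L\<^esub>})"
        by (intro bexI[of _ ?p]) blast+
    qed (rule L.is_group)
  qed
qed

end

section \<open>Functoriality of the associated graded\<close>

definition gr_map ::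
    "('b, 'n) monoid_scheme \<Rightarrow> (nat \<Rightarrow> 'b set) \<Rightarrow> ('a \<Rightarrow> 'b) \<Rightarrow> (nat \<Rightarrow> 'a set) \<Rightarrow> nat \<Rightarrow> 'b set" where
  "gr_map H \<Psi> h f = (\<lambda>s\<in>{1..}. \<Union>x\<in>f s. \<Psi> (Suc s) #>\<^bsub>H\<^esub> h x)"

text \<open>Four instances carry the proof: the projection to \<open>Out G\<close>, the map from G
  to \<open>AutoGroup G\<close> by conjugation, a single automorphism of G, and conjugation by it on
  \<open>AutoGroup G\<close>.\<close>

locale filtered_hom = N: N_series G \<Phi> + M: N_series H \<Psi> + group_hom G H h
  for G :: "('a, 'm) monoid_scheme" (structure) and \<Phi> and H :: "('b, 'n) monoid_scheme" (structure) and \<Psi> and h +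
  assumes filtered: "\<lbrakk>1 \<le> s; x \<in> \<Phi> s\<rbrakk> \<Longrightarrow> h x \<in> \<Psi> s"
begin

lemma Union_gr_class_hom:
  assumes "1 \<le> s" "x \<in> \<Phi> s"
  shows "(\<Union>z\<in>gr_class G \<Phi> s x. \<Psi> (Suc s) #>\<^bsub>H\<^esub> h z) = gr_class H \<Psi> s (h x)"
  unfolding gr_class_def[of H, symmetric]
proof (rule N.Union_gr_class[OF assms])
  fix i assume i: "i \<in> \<Phi> (Suc s)"
  have is': "i \<in> \<Phi> s" using i N.Phi_Suc[OF assms(1)] by blast
  have c: "i \<in> carrier G" "x \<in> carrier G" using is' assms N.Phi_carrier by auto
  interpret A: comm_group "gr_degree H \<Psi> s" using assms(1) by (rule M.comm_group_gr_degree)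
  have "gr_class H \<Psi> s (h (i \<otimes> x)) = gr_class H \<Psi> s (h i) \<otimes>\<^bsub>gr_degree H \<Psi> s\<^esub> gr_class H \<Psi> s (h x)"
    using c assms is' filtered by (simp add: M.gr_class_mult)
  moreover have "gr_class H \<Psi> s (h i) = \<one>\<^bsub>gr_degree H \<Psi> s\<^esub>"
    using assms is' filtered[OF _ i] filtered by (simp add: M.gr_class_eq_one_iff)
  ultimately show "gr_class H \<Psi> s (h (i \<otimes> x)) = gr_class H \<Psi> s (h x)"
    using assms filtered M.gr_class_closed by simp
qed

lemma gr_map_homog:
  assumes s: "1 \<le> s" and x: "x \<in> \<Phi> s"
  shows "gr_map H \<Psi> h (homog G \<Phi> s x) = homog H \<Psi> s (h x)"
  unfolding gr_map_def homog_def
proof (rule restrict_ext)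
  fix n :: nat assume "n \<in> {1..}"
  then have n: "1 \<le> n" by simp
  show "(\<Union>z\<in>(\<lambda>n\<in>{1..}. if n = s then gr_class G \<Phi> s x else \<one>\<^bsub>gr_degree G \<Phi> n\<^esub>) n. \<Psi> (Suc n) #>\<^bsub>H\<^esub> h z)
      = (if n = s then gr_class H \<Psi> s (h x) else \<one>\<^bsub>gr_degree H \<Psi> n\<^esub>)"
    using n Union_gr_class_hom[OF s x] Union_gr_class_hom[OF n N.Phi_one[OF n]]
    by (simp add: N.gr_class_one M.gr_class_one)
qed

lemma gr_map_mult:
  assumes f: "f \<in> carrier (gr G \<Phi>)" and g: "g \<in> carrier (gr G \<Phi>)"
  shows "gr_map H \<Psi> h (f \<otimes>\<^bsub>gr G \<Phi>\<^esub> g) = gr_map H \<Psi> h f \<otimes>\<^bsub>gr H \<Psi>\<^esub> gr_map H \<Psi> h g"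
  unfolding M.mult_gr
proof (rule extensionalityI[of _ "{1..}"])
  show "gr_map H \<Psi> h (f \<otimes>\<^bsub>gr G \<Phi>\<^esub> g) \<in> extensional {1..}" by (simp add: gr_map_def)
  fix n :: nat assume "n \<in> {1..}"
  then have n: "1 \<le> n" by simp
  obtain x y where x: "x \<in> \<Phi> n" "f n = gr_class G \<Phi> n x" and y: "y \<in> \<Phi> n" "g n = gr_class G \<Phi> n y"
    using N.gr_apply_closed[OF f n] N.gr_apply_closed[OF g n] by (auto simp: N.carrier_gr_degree)
  have "x \<in> carrier G" "y \<in> carrier G" using n x y N.Phi_carrier by auto
  then show "gr_map H \<Psi> h (f \<otimes>\<^bsub>gr G \<Phi>\<^esub> g) n
      = (\<lambda>s\<in>{1..}. gr_map H \<Psi> h f s \<otimes>\<^bsub>gr_degree H \<Psi> s\<^esub> gr_map H \<Psi> h g s) n"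
    using n x y N.Phi_mult[OF n] filtered[OF n]
    by (simp add: gr_map_def N.mult_gr N.gr_class_mult Union_gr_class_hom M.gr_class_mult)
qed simp

lemma gr_map_closed:
  assumes "f \<in> carrier (gr G \<Phi>)"
  shows "gr_map H \<Psi> h f \<in> carrier (gr H \<Psi>)"
proof -
  interpret R: comm_group "gr H \<Psi>" by (rule M.comm_group_gr)
  show ?thesis using assms
    by (induction rule: N.gr_induct) (simp_all add: gr_map_homog gr_map_mult M.homog_closed filtered)
qed

lemma graded_lie_algebra_hom_gr_map: "graded_lie_algebra_hom (gr G \<Phi>) (gr H \<Psi>) (gr_map H \<Psi> h)"
proof (intro graded_lie_algebra_hom.intro graded_lie_algebra_hom_axioms.intro N.graded_lie_algebra_gr
    M.graded_lie_algebra_gr homI gr_map_closed gr_map_mult)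
  interpret L: graded_lie_algebra "gr G \<Phi>" by (rule N.graded_lie_algebra_gr)
  interpret L': graded_lie_algebra "gr H \<Psi>" by (rule M.graded_lie_algebra_gr)
  show "gr_map H \<Psi> h (bracket (gr G \<Phi>) f g) = bracket (gr H \<Psi>) (gr_map H \<Psi> h f) (gr_map H \<Psi> h g)"
    if "f \<in> carrier (gr G \<Phi>)" "g \<in> carrier (gr G \<Phi>)" for f g
    using that
  proof (induction f rule: N.gr_induct)
    case x: (homog s x)
    from x(3) show ?case
    proof (induction g rule: N.gr_induct)
      case y: (homog t y)
      have "h (commutator G x y) = commutator H (h x) (h y)"
        using x(1,2) y N.Phi_carrier by (simp add: commutator_def)
      then show ?case
        using x(1,2) y filtered N.Phi_commutator
        by (simp add: N.bracket_gr_homog M.bracket_gr_homog gr_map_homog)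
    next
      case (mult g g')
      then show ?case
        using N.homog_closed[OF x(1,2)] gr_map_closed
        by (simp add: L.bracket_add_right L'.bracket_add_right L.bracket_closed gr_map_mult)
    qed
  next
    case (mult f f')
    then show ?case
      using gr_map_closed by (simp add: L.bracket_add_left L'.bracket_add_left L.bracket_closed gr_map_mult)
  qed
  show "gr_map H \<Psi> h f \<in> component (gr H \<Psi>) s" if "1 \<le> s" "f \<in> component (gr G \<Phi>) s" for s f
    using that filtered by (auto simp: N.component_gr M.component_gr gr_map_homog)
qed

end

section \<open>The Johnson homomorphism\<close>

context group
begin

abbreviation (input) \<Gamma> :: "nat \<Rightarrow> 'a set" where "\<Gamma> \<equiv> lower_central G"
abbreviation (input) \<A> :: "('a \<Rightarrow> 'a) monoid" where "\<A> \<equiv> AutoGroup G"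
abbreviation (input) \<F> :: "nat \<Rightarrow> ('a \<Rightarrow> 'a) set" where "\<F> \<equiv> johnson_filtration G"
abbreviation (input) \<O> :: "nat \<Rightarrow> ('a \<Rightarrow> 'a) set set" where "\<O> \<equiv> outer_johnson_filtration G"

interpretation LC: N_series G "\<Gamma>" by (rule lower_central_N_series)
interpretation F: N_series "\<A>" "\<F>" by (rule johnson_filtration_N_series)
interpretation O: N_series "Out G" "\<O>" by (rule outer_johnson_filtration_N_series)

interpretation L: graded_lie_algebra "gr_Gamma G" by (rule LC.graded_lie_algebra_gr)
interpretation LF: graded_lie_algebra "gr_F G" by (rule F.graded_lie_algebra_gr)
interpretation LO: graded_lie_algebra "gr_outer_F G" by (rule O.graded_lie_algebra_gr)
interpretation D: graded_lie_algebra "Der (gr_Gamma G)" by (rule L.graded_lie_algebra_Der)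

text \<open>Displacements of the deeper element c fall into step s + u + 1. This allows a
  displacement to be taken at a nearby point of the group, as is needed because products and
  commutators of automorphisms lead to values at \<beta> x or \<beta>(\<alpha> x).\<close>

lemma gr_class_displacement_perturb:
  assumes s: "1 \<le> s" and u: "1 \<le> u" and \<alpha>: "\<alpha> \<in> \<F> s"
    and c: "c \<in> \<Gamma> (Suc u)" and x: "x \<in> \<Gamma> u"
  shows "gr_class G \<Gamma> (s + u) (\<alpha> (c \<otimes> x) \<otimes> inv (c \<otimes> x))
    = gr_class G \<Gamma> (s + u) (\<alpha> x \<otimes> inv x)"
proof -
  have su: "1 \<le> s + u" using s by simp
  interpret A: comm_group "gr_degree G \<Gamma> (s + u)" using su by (rule LC.comm_group_gr_degree)
  have A: "\<alpha> \<in> carrier \<A>" using \<alpha> by (rule johnson_filtrationD)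
  have cc: "c \<in> carrier G" "x \<in> carrier G" using c x lower_central_carrier by blast+
  have a: "\<alpha> x \<otimes> inv x \<in> \<Gamma> (s + u)" using displacement_mem_lower_central[OF \<alpha> u x] .
  have b: "\<alpha> c \<otimes> inv c \<in> \<Gamma> (Suc (s + u))" using displacement_mem_lower_central[OF \<alpha> _ c] by simp
  have b': "\<alpha> c \<otimes> inv c \<in> \<Gamma> (s + u)" using b lower_central_Suc_subset by blast
  have conj: "c \<otimes> (\<alpha> x \<otimes> inv x) \<otimes> inv c \<in> \<Gamma> (s + u)"
    using LC.Phi_conj[OF _ su c a] by simp
  have "gr_class G \<Gamma> (s + u) (\<alpha> (c \<otimes> x) \<otimes> inv (c \<otimes> x))
      = gr_class G \<Gamma> (s + u) (\<alpha> c \<otimes> inv c) \<otimes>\<^bsub>gr_degree G \<Gamma> (s + u)\<^esub>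
        gr_class G \<Gamma> (s + u) (c \<otimes> (\<alpha> x \<otimes> inv x) \<otimes> inv c)"
    unfolding displacement_mult[OF A cc] using su b' conj by (simp only: LC.gr_class_mult)
  also have "gr_class G \<Gamma> (s + u) (c \<otimes> (\<alpha> x \<otimes> inv x) \<otimes> inv c)
      = gr_class G \<Gamma> (s + u) (\<alpha> x \<otimes> inv x)"
    using LC.gr_class_conj[OF _ su c a] by simp
  also have "gr_class G \<Gamma> (s + u) (\<alpha> c \<otimes> inv c) = \<one>\<^bsub>gr_degree G \<Gamma> (s + u)\<^esub>"
    using b LC.gr_class_eq_one_iff[OF su b'] by blast
  finally show ?thesis using LC.gr_class_closed[OF a] by simp
qed

text \<open>In \<alpha>: the displacement of \<alpha> \<beta> at x involves that of \<alpha> at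
  \<beta> x = b x, and b lies in step t + 1 because s \<ge> 1. In x: the conjugation in
  \<open>displacement_mult\<close> is trivial on the graded piece.\<close>

lemma filtered_pairing_displacement:
  "filtered_pairing \<A> \<F> G \<Gamma> G \<Gamma> (\<lambda>\<alpha> x. \<alpha> x \<otimes> inv x)"
proof (intro filtered_pairing.intro filtered_pairing_axioms.intro F.N_series_axioms LC.N_series_axioms)
  fix s t \<alpha> x assume s: "1 \<le> s" and t: "1 \<le> t" and \<alpha>: "\<alpha> \<in> \<F> s" and x: "x \<in> \<Gamma> t"
  let ?c = "gr_class G \<Gamma> (s + t)"
  have st: "1 \<le> s + t" using s by simp
  have A: "\<alpha> \<in> carrier \<A>" using \<alpha> by (rule johnson_filtrationD)
  have xc: "x \<in> carrier G" using x by (rule lower_central_carrier)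
  show a: "\<alpha> x \<otimes> inv x \<in> \<Gamma> (s + t)" using displacement_mem_lower_central[OF \<alpha> t x] .
  show "?c ((\<alpha> \<otimes>\<^bsub>\<A>\<^esub> \<beta>) x \<otimes> inv x) = ?c ((\<alpha> x \<otimes> inv x) \<otimes> (\<beta> x \<otimes> inv x))"
    if \<beta>: "\<beta> \<in> \<F> s" for \<beta>
  proof -
    have B: "\<beta> \<in> carrier \<A>" using \<beta> by (rule johnson_filtrationD)
    define b where "b = \<beta> x \<otimes> inv x"
    have b: "b \<in> \<Gamma> (s + t)" unfolding b_def using displacement_mem_lower_central[OF \<beta> t x] .
    have b': "b \<in> \<Gamma> (Suc t)" using LC.Phi_mono[OF b, of "Suc t"] s by simp
    have \<beta>x: "\<beta> x = b \<otimes> x" using B xc by (simp add: b_def m_assoc)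
    have "b \<otimes> x \<in> \<Gamma> t" using aut_lower_central[OF B x] by (simp add: \<beta>x)
    then have m: "\<alpha> (b \<otimes> x) \<otimes> inv (b \<otimes> x) \<in> \<Gamma> (s + t)" by (rule displacement_mem_lower_central[OF \<alpha> t])
    have "?c ((\<alpha> \<otimes>\<^bsub>\<A>\<^esub> \<beta>) x \<otimes> inv x)
        = ?c (\<alpha> (b \<otimes> x) \<otimes> inv (b \<otimes> x)) \<otimes>\<^bsub>gr_degree G \<Gamma> (s + t)\<^esub> ?c b"
      unfolding displacement_compose[OF A B xc] b_def[symmetric] unfolding \<beta>x LC.gr_class_mult[OF st m b] ..
    also have "\<dots> = ?c ((\<alpha> x \<otimes> inv x) \<otimes> b)"
      unfolding gr_class_displacement_perturb[OF s t \<alpha> b' x] by (rule LC.gr_class_mult[OF st a b])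
    finally show ?thesis by (simp add: b_def)
  qed
  show "?c (\<alpha> (x \<otimes> y) \<otimes> inv (x \<otimes> y)) = ?c ((\<alpha> x \<otimes> inv x) \<otimes> (\<alpha> y \<otimes> inv y))"
    if y: "y \<in> \<Gamma> t" for y
  proof -
    have yc: "y \<in> carrier G" using y by (rule lower_central_carrier)
    have a': "\<alpha> y \<otimes> inv y \<in> \<Gamma> (s + t)" using displacement_mem_lower_central[OF \<alpha> t y] .
    show ?thesis
      unfolding displacement_mult[OF A xc yc]
      using LC.gr_class_conj[OF t st x a'] LC.Phi_conj[OF t st x a'] a a' st
      by (simp only: LC.gr_class_mult[symmetric])
  qed
qed

interpretation disp: filtered_pairing "\<A>" "\<F>" G "\<Gamma>" G "\<Gamma>"
  "\<lambda>\<alpha> x. \<alpha> x \<otimes> inv x"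
  by (rule filtered_pairing_displacement)

lemma johnson_eq: "johnson G f = (\<lambda>y\<in>carrier (gr_Gamma G). disp.conv f y)"
  by (simp add: johnson_def gr_convolution_def)

lemma johnson_apply: "y \<in> carrier (gr_Gamma G) \<Longrightarrow> johnson G f y = disp.conv f y"
  by (simp add: johnson_eq)

lemma johnson_homog:
  assumes "1 \<le> s" "1 \<le> t" "\<alpha> \<in> \<F> s" "x \<in> \<Gamma> t"
  shows "johnson G (homog \<A> \<F> s \<alpha>) (homog G \<Gamma> t x)
    = homog G \<Gamma> (s + t) (\<alpha> x \<otimes> inv x)"
  using assms by (simp add: johnson_apply LC.homog_closed disp.conv_homog)

text \<open>With \<alpha> x = a x and \<alpha> y = b y, the word (a x, b y) (x,y)^-1 consists of
  (a,y), (x,b) and error terms. The errors (a,(x,b y)), (b,(x,y)) and (a,b) exceed the degree s + t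
  + u by at least t, u and s respectively, all positive.\<close>

lemma gr_class_displacement_leibniz:
  assumes s: "1 \<le> s" and t: "1 \<le> t" and u: "1 \<le> u" and \<alpha>: "\<alpha> \<in> \<F> s"
    and x: "x \<in> \<Gamma> t" and y: "y \<in> \<Gamma> u"
  shows "gr_class G \<Gamma> (s + t + u) (\<alpha> (commutator G x y) \<otimes> inv (commutator G x y))
    = gr_class G \<Gamma> (s + t + u)
        (commutator G (\<alpha> x \<otimes> inv x) y \<otimes> commutator G x (\<alpha> y \<otimes> inv y))"
proof -
  define n where "n = s + t + u"
  let ?c = "gr_class G \<Gamma> n"
  let ?A = "gr_degree G \<Gamma> n"
  have n: "1 \<le> n" using s by (simp add: n_def)
  interpret A: comm_group ?A using n by (rule LC.comm_group_gr_degree)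
  have A: "\<alpha> \<in> carrier \<A>" using \<alpha> by (rule johnson_filtrationD)
  define a b h where "a = \<alpha> x \<otimes> inv x" and "b = \<alpha> y \<otimes> inv y" and "h = commutator G x y"
  have xc: "x \<in> carrier G" and yc: "y \<in> carrier G" using x y lower_central_carrier by blast+
  have a: "a \<in> \<Gamma> (s + t)" and b: "b \<in> \<Gamma> (s + u)"
    using displacement_mem_lower_central[OF \<alpha> t x] displacement_mem_lower_central[OF \<alpha> u y]
    by (simp_all add: a_def b_def)
  have h: "h \<in> \<Gamma> (t + u)" unfolding h_def using LC.Phi_commutator[OF t u x y] .
  have c: "a \<in> carrier G" "b \<in> carrier G" "h \<in> carrier G" using a b h lower_central_carrier by blast+
  have \<alpha>x: "\<alpha> x = a \<otimes> x" "\<alpha> y = b \<otimes> y" using A xc yc by (simp_all add: a_def b_def m_assoc)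
  have by': "b \<otimes> y \<in> \<Gamma> u" using aut_lower_central[OF A y] by (simp add: \<alpha>x)
  have b': "b \<in> \<Gamma> u" using LC.Phi_mono[OF b u] by simp
  note mono = LC.Phi_mono[where s = "Suc n"] LC.Phi_mono[where s = n]
  have 1: "commutator G a (commutator G x (b \<otimes> y)) \<in> \<Gamma> (s + t + (t + u))"
    using LC.Phi_commutator[OF _ _ a LC.Phi_commutator[OF t u x by']] s t by simp
  have 2: "commutator G b h \<in> \<Gamma> (s + u + (t + u))"
    using LC.Phi_commutator[OF _ _ b h] s t by simp
  have 3: "commutator G a b \<in> \<Gamma> (s + t + (s + u))"
    using LC.Phi_commutator[OF _ _ a b] s by simp
  have one: "?c (commutator G a (commutator G x (b \<otimes> y))) = \<one>\<^bsub>?A\<^esub>" "?c (commutator G b h) = \<one>\<^bsub>?A\<^esub>"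
    "?c (commutator G a b) = \<one>\<^bsub>?A\<^esub>"
    using mono[OF 1] mono[OF 2] mono[OF 3] LC.gr_class_eq_one_iff[OF n] s t u n by (auto simp: n_def)
  have mem: "commutator G a (commutator G x (b \<otimes> y)) \<in> \<Gamma> n" "commutator G b h \<in> \<Gamma> n"
    "commutator G a b \<in> \<Gamma> n"
    using mono(2)[OF 1] mono(2)[OF 2] mono(2)[OF 3] n by (auto simp: n_def)
  have xb: "commutator G x b \<in> \<Gamma> n"
    using LC.Phi_commutator[OF t _ x b] s by (simp add: n_def add.commute add.left_commute)
  have ay: "commutator G a y \<in> \<Gamma> n" and aby: "commutator G a (b \<otimes> y) \<in> \<Gamma> n"
    using LC.Phi_commutator[OF _ u a] s y by' by (auto simp: n_def)
  have conj: "h \<otimes> commutator G a (b \<otimes> y) \<otimes> inv h \<in> \<Gamma> n"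
    "?c (h \<otimes> commutator G a (b \<otimes> y) \<otimes> inv h) = ?c (commutator G a (b \<otimes> y))"
    using LC.Phi_conj[OF _ n h aby] LC.gr_class_conj[OF _ n h aby] t by auto
  have "?c (commutator G a (b \<otimes> y)) = ?c (commutator G a b \<otimes> commutator G a y)"
    using LC.comm.pair_right[OF _ u a b' y] s by (simp add: n_def)
  also have "\<dots> = ?c (commutator G a y)"
    using mem ay n one LC.gr_class_closed by (simp flip: LC.gr_class_mult)
  finally have 4: "?c (commutator G a (b \<otimes> y)) = ?c (commutator G a y)" .
  have "\<alpha> h \<otimes> inv h = commutator G a (commutator G x (b \<otimes> y)) \<otimes> (commutator G x b \<otimes> commutator G b h)
      \<otimes> (h \<otimes> commutator G a (b \<otimes> y) \<otimes> inv h)"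
    unfolding h_def aut_commutator[OF A xc yc] \<alpha>x using xc yc c by (simp add: word_simps)
  then have "?c (\<alpha> h \<otimes> inv h) = ?c (commutator G a (commutator G x (b \<otimes> y)))
      \<otimes>\<^bsub>?A\<^esub> (?c (commutator G x b) \<otimes>\<^bsub>?A\<^esub> ?c (commutator G b h))
      \<otimes>\<^bsub>?A\<^esub> ?c (h \<otimes> commutator G a (b \<otimes> y) \<otimes> inv h)"
    using mem xb conj(1) n LC.Phi_mult[OF n] by (simp only: LC.gr_class_mult)
  also have "\<dots> = ?c (commutator G a y) \<otimes>\<^bsub>?A\<^esub> ?c (commutator G x b)"
    unfolding one conj(2) 4 using xb ay LC.gr_class_closed A.m_comm by simp
  also have "\<dots> = ?c (commutator G a y \<otimes> commutator G x b)"
    using n ay xb by (rule LC.gr_class_mult)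
  finally show ?thesis unfolding n_def a_def b_def h_def .
qed

lemma conv_displacement_leibniz:
  assumes s: "1 \<le> s" and \<alpha>: "\<alpha> \<in> \<F> s"
    and "y \<in> carrier (gr_Gamma G)" "z \<in> carrier (gr_Gamma G)"
  defines "f \<equiv> homog \<A> \<F> s \<alpha>"
  shows "disp.conv f (bracket (gr_Gamma G) y z)
    = bracket (gr_Gamma G) (disp.conv f y) z \<otimes>\<^bsub>gr_Gamma G\<^esub> bracket (gr_Gamma G) y (disp.conv f z)"
  using assms(3,4)
proof (induction y rule: LC.gr_induct)
  have f: "f \<in> carrier (gr_F G)" unfolding f_def using s \<alpha> by (rule F.homog_closed)
  {
    case x: (homog t x)
    from x(3) show ?case
    proof (induction z rule: LC.gr_induct)
      case y: (homog u y)
      have a: "\<alpha> x \<otimes> inv x \<in> \<Gamma> (s + t)" and b: "\<alpha> y \<otimes> inv y \<in> \<Gamma> (s + u)"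
        using displacement_mem_lower_central[OF \<alpha>] x(1,2) y by auto
      have eq: "t + (s + u) = s + t + u" "s + (t + u) = s + t + u" by auto
      have "homog G \<Gamma> (s + t + u) (\<alpha> (commutator G x y) \<otimes> inv (commutator G x y))
        = homog G \<Gamma> (s + t + u) (commutator G (\<alpha> x \<otimes> inv x) y \<otimes> commutator G x (\<alpha> y \<otimes> inv y))"
        by (rule LC.homog_class_cong[OF gr_class_displacement_leibniz[OF s x(1) y(1) \<alpha> x(2) y(2)]])
      moreover have "commutator G (\<alpha> x \<otimes> inv x) y \<in> \<Gamma> (s + t + u)"
        "commutator G x (\<alpha> y \<otimes> inv y) \<in> \<Gamma> (s + t + u)"
        using LC.Phi_commutator[OF _ y(1) a y(2)] LC.Phi_commutator[OF x(1) _ x(2) b] s by (simp_all add: eq)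
      moreover have "commutator G x y \<in> \<Gamma> (t + u)"
        using LC.Phi_commutator[OF x(1) y(1) x(2) y(2)] .
      ultimately show ?case
        using s \<alpha> x(1,2) y a b
        by (simp add: f_def LC.bracket_gr_homog disp.conv_homog eq LC.homog_mult)
    next
      case (mult y z)
      then show ?case
        using f LC.homog_closed[OF x(1,2)] disp.conv_closed[OF f]
        by (simp add: L.bracket_add_right disp.conv_mult_right L.bracket_closed L.mult_interchange)
    qed
  }
  case (mult y y')
  then show ?case
    using f disp.conv_closed[OF f]
    by (simp add: L.bracket_add_left disp.conv_mult_right L.bracket_closed L.mult_interchange)
qed

lemma johnson_homog_mem_derivations:
  assumes s: "1 \<le> s" and \<alpha>: "\<alpha> \<in> \<F> s"
  shows "johnson G (homog \<A> \<F> s \<alpha>) \<in> derivations (gr_Gamma G) s"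
proof -
  let ?f = "homog \<A> \<F> s \<alpha>"
  have f: "?f \<in> carrier (gr_F G)" using s \<alpha> by (rule F.homog_closed)
  have "johnson G ?f \<in> leibniz_maps (gr_Gamma G)"
    unfolding johnson_eq
    by (intro L.leibniz_mapsI disp.conv_closed[OF f] disp.conv_mult_right[OF f] conv_displacement_leibniz[OF s \<alpha>])
  moreover have "johnson G ?f y \<in> component (gr_Gamma G) (s + t)"
    if "1 \<le> t" "y \<in> component (gr_Gamma G) t" for t y
    using that s \<alpha> displacement_mem_lower_central[OF \<alpha>] by (auto simp: LC.component_gr johnson_homog)
  ultimately show ?thesis by (auto simp: derivations_eq)
qed

section \<open>J as an injective morphism of graded Lie algebras\<close>

lemma johnson_mult:
  assumes "f \<in> carrier (gr_F G)" "g \<in> carrier (gr_F G)"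
  shows "johnson G (f \<otimes>\<^bsub>gr_F G\<^esub> g) = johnson G f \<otimes>\<^bsub>Der (gr_Gamma G)\<^esub> johnson G g"
  unfolding mult_Der johnson_eq using assms by (intro restrict_ext) (simp add: disp.conv_mult_left)

lemma johnson_closed:
  assumes "f \<in> carrier (gr_F G)"
  shows "johnson G f \<in> carrier (Der (gr_Gamma G))"
  using assms
proof (induction rule: F.gr_induct)
  case (homog s \<alpha>)
  then show ?case using johnson_homog_mem_derivations L.derivations_subset_Der by blast
next
  case (mult f g)
  then show ?case by (simp add: johnson_mult)
qed

text \<open>The commutator of \<alpha> and \<beta> is easy to evaluate at w = \<beta>(\<alpha> x),
  whereas its displacement at x is wanted. The two points differ by an element of step u + 1, which
  is invisible; the remaining factor (b,a) has degree s + t + 2 u.\<close>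

lemma homog_displacement_commutator:
  assumes s: "1 \<le> s" and t: "1 \<le> t" and u: "1 \<le> u" and \<alpha>: "\<alpha> \<in> \<F> s"
    and \<beta>: "\<beta> \<in> \<F> t" and x: "x \<in> \<Gamma> u"
  defines "a \<equiv> \<alpha> x \<otimes> inv x" and "b \<equiv> \<beta> x \<otimes> inv x" and "n \<equiv> s + t + u"
  shows "homog G \<Gamma> n (commutator \<A> \<alpha> \<beta> x \<otimes> inv x)
    = homog G \<Gamma> n (\<alpha> b \<otimes> inv b) \<otimes>\<^bsub>gr_Gamma G\<^esub>
        inv\<^bsub>gr_Gamma G\<^esub> homog G \<Gamma> n (\<beta> a \<otimes> inv a)"
proof -
  let ?c = "gr_class G \<Gamma> n"
  let ?\<gamma> = "commutator \<A> \<alpha> \<beta>"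
  have n: "1 \<le> n" using s by (simp add: n_def)
  interpret A: comm_group "gr_degree G \<Gamma> n" using n by (rule LC.comm_group_gr_degree)
  have A: "\<alpha> \<in> carrier \<A>" "\<beta> \<in> carrier \<A>" using \<alpha> \<beta> johnson_filtrationD by auto
  have xc: "x \<in> carrier G" using x by (rule lower_central_carrier)
  have \<gamma>: "?\<gamma> \<in> \<F> (s + t)" using \<alpha> \<beta> by (rule johnson_filtration_commutator)
  have a: "a \<in> \<Gamma> (s + u)" and b: "b \<in> \<Gamma> (t + u)"
    unfolding a_def b_def using displacement_mem_lower_central[OF \<alpha> u x] displacement_mem_lower_central[OF \<beta> u x] by auto
  have ab: "\<alpha> b \<otimes> inv b \<in> \<Gamma> n" and ba: "\<beta> a \<otimes> inv a \<in> \<Gamma> n"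
    using displacement_mem_lower_central[OF \<alpha> _ b] displacement_mem_lower_central[OF \<beta> _ a] s t
    by (simp_all add: n_def add.commute add.left_commute)
  have comm: "commutator G b a \<in> \<Gamma> (t + u + (s + u))"
    using LC.Phi_commutator[OF _ _ b a] s t by simp
  have comm_n: "commutator G b a \<in> \<Gamma> n" and comm1: "commutator G b a \<in> \<Gamma> (Suc n)"
    using LC.Phi_mono[OF comm, of n] LC.Phi_mono[OF comm, of "Suc n"] n u by (auto simp: n_def)
  define w where "w = \<beta> (\<alpha> x)"
  define c where "c = w \<otimes> inv x"
  \<comment> \<open>Both factors lie in the Torelli group as s, t \<ge> 1, so this composition moves
    x by an element of step u + 1.\<close>
  have "\<beta> \<otimes>\<^bsub>\<A>\<^esub> \<alpha> \<in> \<F> 1"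
    using F.Phi_mult[of 1 \<beta> \<alpha>] F.Phi_mono[OF \<alpha> _ s] F.Phi_mono[OF \<beta> _ t] by simp
  from displacement_mem_lower_central[OF this u x]
  have c: "c \<in> \<Gamma> (Suc u)" using A xc
    by (simp add: c_def w_def Suc_eq_plus1_left[of u])
  have w: "w = c \<otimes> x" using A xc by (simp add: c_def w_def m_assoc)
  have "?c (?\<gamma> x \<otimes> inv x) = ?c (?\<gamma> w \<otimes> inv w)"
    unfolding w n_def using gr_class_displacement_perturb[OF _ u \<gamma> c x] s by simp
  also have "\<dots> = ?c ((\<alpha> b \<otimes> inv b) \<otimes> commutator G b a \<otimes> inv (\<beta> a \<otimes> inv a))"
    unfolding w_def a_def b_def displacement_commutator[OF A xc] ..
  also have "\<dots> = ?c (\<alpha> b \<otimes> inv b) \<otimes>\<^bsub>gr_degree G \<Gamma> n\<^esub> ?c (commutator G b a)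
      \<otimes>\<^bsub>gr_degree G \<Gamma> n\<^esub> ?c (inv (\<beta> a \<otimes> inv a))"
    using ab ba comm_n n LC.Phi_mult[OF n] LC.Phi_inv[OF n] by (simp only: LC.gr_class_mult)
  also have "?c (commutator G b a) = \<one>\<^bsub>gr_degree G \<Gamma> n\<^esub>"
    using LC.gr_class_eq_one_iff[OF n comm_n] comm1 by blast
  also have "?c (\<alpha> b \<otimes> inv b) \<otimes>\<^bsub>gr_degree G \<Gamma> n\<^esub> \<one>\<^bsub>gr_degree G \<Gamma> n\<^esub>
      \<otimes>\<^bsub>gr_degree G \<Gamma> n\<^esub> ?c (inv (\<beta> a \<otimes> inv a))
    = ?c ((\<alpha> b \<otimes> inv b) \<otimes> inv (\<beta> a \<otimes> inv a))"
    unfolding A.r_one[OF LC.gr_class_closed[OF ab]] by (rule LC.gr_class_mult[OF n ab LC.Phi_inv[OF n ba]])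
  finally have 1: "homog G \<Gamma> n (?\<gamma> x \<otimes> inv x)
      = homog G \<Gamma> n ((\<alpha> b \<otimes> inv b) \<otimes> inv (\<beta> a \<otimes> inv a))"
    by (rule LC.homog_class_cong)
  have "inv\<^bsub>gr_Gamma G\<^esub> homog G \<Gamma> n (\<beta> a \<otimes> inv a) = homog G \<Gamma> n (inv (\<beta> a \<otimes> inv a))"
  proof (rule L.inv_equality)
    have "\<beta> a \<otimes> inv a \<in> carrier G" using ba by (rule lower_central_carrier)
    then show "homog G \<Gamma> n (inv (\<beta> a \<otimes> inv a)) \<otimes>\<^bsub>gr_Gamma G\<^esub> homog G \<Gamma> n (\<beta> a \<otimes> inv a)
      = \<one>\<^bsub>gr_Gamma G\<^esub>"
      using LC.homog_mult[OF n LC.Phi_inv[OF n ba] ba] LC.homog_one[OF n] by (simp only: l_inv)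
  qed (rule LC.homog_closed[OF n ba] LC.homog_closed[OF n LC.Phi_inv[OF n ba]])+
  then show ?thesis
    unfolding 1 using LC.homog_mult[OF n ab LC.Phi_inv[OF n ba]] by simp
qed

lemma johnson_bracket:
  assumes "f \<in> carrier (gr_F G)" "g \<in> carrier (gr_F G)"
  shows "johnson G (bracket (gr_F G) f g) = bracket (Der (gr_Gamma G)) (johnson G f) (johnson G g)"
  using assms
proof (induction f rule: F.gr_induct)
  case \<alpha>: (homog s \<alpha>)
  let ?f = "homog \<A> \<F> s \<alpha>"
  have f: "?f \<in> carrier (gr_F G)" using \<alpha>(1,2) by (rule F.homog_closed)
  from \<alpha>(3) show ?case
  proof (induction g rule: F.gr_induct)
    case \<beta>: (homog t \<beta>)
    let ?g = "homog \<A> \<F> t \<beta>"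
    have g: "?g \<in> carrier (gr_F G)" using \<beta>(1,2) by (rule F.homog_closed)
    have c: "johnson G (bracket (gr_F G) ?f ?g) \<in> leibniz_maps (gr_Gamma G)"
      "bracket (Der (gr_Gamma G)) (johnson G ?f) (johnson G ?g) \<in> leibniz_maps (gr_Gamma G)"
      using johnson_closed f g LF.bracket_closed D.bracket_closed L.Der_subset_leibniz_maps by blast+
    show ?case
    proof (rule L.Der_eqI)
      fix u y assume u: "1 \<le> u" and "y \<in> component (gr_Gamma G) u"
      then obtain x where x: "x \<in> \<Gamma> u" and y: "y = homog G \<Gamma> u x"
        by (auto simp: LC.component_gr)
      have yc: "y \<in> carrier (gr_Gamma G)" unfolding y using u x by (rule LC.homog_closed)
      have a: "\<alpha> x \<otimes> inv x \<in> \<Gamma> (s + u)" and b: "\<beta> x \<otimes> inv x \<in> \<Gamma> (t + u)"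
        using displacement_mem_lower_central[OF \<alpha>(2) u x] displacement_mem_lower_central[OF \<beta>(2) u x] by auto
      have eq: "s + (t + u) = s + t + u" "t + (s + u) = s + t + u" by auto
      have "johnson G (bracket (gr_F G) ?f ?g) y
          = homog G \<Gamma> (s + t + u) (commutator \<A> \<alpha> \<beta> x \<otimes> inv x)"
        unfolding y using \<alpha>(1,2) \<beta> u x
        by (simp add: F.bracket_gr_homog johnson_homog johnson_filtration_commutator)
      also have "\<dots> = bracket (Der (gr_Gamma G)) (johnson G ?f) (johnson G ?g) y"
        unfolding homog_displacement_commutator[OF \<alpha>(1) \<beta>(1) u \<alpha>(2) \<beta>(2) x]
        using \<alpha>(1,2) \<beta> u x a b yc by (simp add: bracket_Der y johnson_homog eq)
      finally show "johnson G (bracket (gr_F G) ?f ?g) y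
          = bracket (Der (gr_Gamma G)) (johnson G ?f) (johnson G ?g) y" .
    qed (use c in \<open>auto simp: leibniz_maps_def\<close>)
  next
    case (mult g g')
    then show ?case
      using f johnson_closed LF.bracket_closed
      by (simp add: LF.bracket_add_right D.bracket_add_right johnson_mult)
  qed
next
  case (mult f f')
  then show ?case
    using johnson_closed LF.bracket_closed
    by (simp add: LF.bracket_add_left D.bracket_add_left johnson_mult)
qed

lemma graded_lie_algebra_hom_johnson: "graded_lie_algebra_hom (gr_F G) (Der (gr_Gamma G)) (johnson G)"
proof (intro graded_lie_algebra_hom.intro graded_lie_algebra_hom_axioms.intro homI johnson_closed johnson_mult
    johnson_bracket LF.graded_lie_algebra_axioms D.graded_lie_algebra_axioms)
  show "johnson G f \<in> component (Der (gr_Gamma G)) s" if "1 \<le> s" "f \<in> component (gr_F G) s" for s f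
    using that johnson_homog_mem_derivations by (auto simp: F.component_gr component_Der)
qed

text \<open>Degree 1 arguments are enough: membership in the next step of the Johnson filtration is
  a condition on the displacements of all x in G, which is term 1 of the lower central
  series.\<close>

lemma johnson_eq_one:
  assumes f: "f \<in> carrier (gr_F G)" and f1: "johnson G f = \<one>\<^bsub>Der (gr_Gamma G)\<^esub>"
  shows "f = \<one>\<^bsub>gr_F G\<^esub>"
proof (rule F.gr_eqI[OF f LF.one_closed])
  fix s :: nat assume s: "1 \<le> s"
  obtain \<alpha> where \<alpha>: "\<alpha> \<in> \<F> s" "f s = gr_class \<A> \<F> s \<alpha>"
    using F.gr_apply_closed[OF f s] by (auto simp: F.carrier_gr_degree)
  have "\<alpha> x \<otimes> inv x \<in> \<Gamma> (Suc (Suc s))" if "x \<in> carrier G" for x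
  proof -
    have x: "x \<in> \<Gamma> 1" using that by simp
    let ?y = "homog G \<Gamma> 1 x"
    have y: "?y \<in> carrier (gr_Gamma G)" using x by (intro LC.homog_closed) simp
    have a: "\<alpha> x \<otimes> inv x \<in> \<Gamma> (s + 1)" using displacement_mem_lower_central[OF \<alpha>(1) _ x] by simp
    have "\<one>\<^bsub>gr_degree G \<Gamma> (s + 1)\<^esub> = johnson G f ?y (s + 1)"
      using y by (simp add: f1 one_Der LC.one_gr)
    \<comment> \<open>In degree s + 1 against an argument of degree 1, only the component
      \<open>f s\<close> contributes.\<close>
    also have "\<dots> = disp.pair_class (s + 1) (f s) (gr_class G \<Gamma> 1 x)"
      using y s disp.conv_homog_right[OF f _ x, of "s + 1"] by (simp add: johnson_apply)
    also have "\<dots> = gr_class G \<Gamma> (s + 1) (\<alpha> x \<otimes> inv x)"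
      unfolding \<alpha>(2) using s \<alpha>(1) x by (intro disp.pair_class_eq) auto
    finally have "\<alpha> x \<otimes> inv x \<in> \<Gamma> (Suc (s + 1))" using LC.gr_class_eq_one_iff[OF _ a] by simp
    then show ?thesis by (simp only: Suc_eq_plus1)
  qed
  then have "\<alpha> \<in> \<F> (Suc s)"
    using \<alpha>(1) by (simp add: johnson_filtration_def del: lower_central.simps)
  then show "f s = \<one>\<^bsub>gr_F G\<^esub> s"
    using s \<alpha> F.gr_class_eq_one_iff[OF s \<alpha>(1)] by (simp add: F.one_gr)
qed

subsection \<open>Passing to outer automorphisms\<close>

interpretation inn: filtered_hom G "\<Gamma>" "\<A>" "\<F>" "inner_aut G"
  by (intro filtered_hom.intro filtered_hom_axioms.intro LC.N_series_axioms F.N_series_axioms inner_aut_hom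
      inner_aut_mem_johnson_filtration)

interpretation out: filtered_hom "\<A>" "\<F>" "Out G" "\<O>" "Out_proj G"
  by (intro filtered_hom.intro filtered_hom_axioms.intro O.N_series_axioms F.N_series_axioms Out_proj_hom)
    (simp add: outer_johnson_filtration_def)

abbreviation (input) gr_inner :: "(nat \<Rightarrow> 'a set) \<Rightarrow> nat \<Rightarrow> ('a \<Rightarrow> 'a) set" where
  "gr_inner \<equiv> gr_map \<A> \<F> (inner_aut G)"

lemma gr_proj_eq_gr_map: "gr_proj G = gr_map (Out G) \<O> (Out_proj G)"
  by (intro ext) (simp only: gr_proj_def gr_map_def)

lemma johnson_gr_inner:
  assumes "y \<in> carrier (gr_Gamma G)"
  shows "johnson G (gr_inner y) = ad (gr_Gamma G) y"
  unfolding johnson_eq ad_def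
proof (rule restrict_ext)
  fix z assume "z \<in> carrier (gr_Gamma G)"
  with assms show "disp.conv (gr_inner y) z = bracket (gr_Gamma G) y z"
  proof (induction y rule: LC.gr_induct)
    case g: (homog s g)
    have f: "gr_inner (homog G \<Gamma> s g) \<in> carrier (gr_F G)"
      by (intro inn.gr_map_closed LC.homog_closed g)
    from g(3) show ?case
    proof (induction z rule: LC.gr_induct)
      case (homog t x)
      then show ?case
        using g(1,2) inner_aut_mem_johnson_filtration[OF g(1,2)] inner_aut_displacement[of x g]
        by (simp add: inn.gr_map_homog disp.conv_homog LC.bracket_gr_homog lower_central_carrier del: inner_aut_apply)
    next
      case (mult z z')
      then show ?case
        using f LC.homog_closed[OF g(1,2)] by (simp add: disp.conv_mult_right L.bracket_add_right)
    qed
  next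
    case (mult y y')
    then show ?case
      by (simp add: inn.gr_map_mult inn.gr_map_closed disp.conv_mult_left L.bracket_add_left)
  qed
qed

lemma Out_proj_inner_aut: "g \<in> carrier G \<Longrightarrow> Out_proj G (inner_aut G g) = \<one>\<^bsub>Out G\<^esub>"
  using F.coset_join2[of "inner_aut G g" "Inn G"] Inn_normal
  by (simp add: Out_proj_def Out_def Inn_eq[symmetric] normal_imp_subgroup) (simp add: Inn_eq)

lemma gr_proj_gr_inner:
  assumes "y \<in> carrier (gr_Gamma G)"
  shows "gr_proj G (gr_inner y) = \<one>\<^bsub>gr_outer_F G\<^esub>"
  unfolding gr_proj_eq_gr_map using assms
proof (induction y rule: LC.gr_induct)
  case (homog s g)
  then show ?case
    using inner_aut_mem_johnson_filtration[OF homog]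
    by (simp add: inn.gr_map_homog out.gr_map_homog Out_proj_inner_aut lower_central_carrier O.homog_one)
next
  case (mult y y')
  then show ?case by (simp add: inn.gr_map_mult inn.gr_map_closed out.gr_map_mult)
qed

text \<open>
  If \<open>g\<close> lies in \<open>\<Gamma>\<^sup>t\<close> with \<open>t < s\<close> and conjugation by \<open>g\<close> lies in \<open>F\<^sup>s\<close>, then the class of
  \<open>g\<close> in degree \<open>t\<close> is central, hence zero, so \<open>g\<close> lies in \<open>\<Gamma>\<^sup>t\<^sup>+\<^sup>1\<close>.
\<close>

lemma mem_lower_central_if_inner_aut:
  assumes center: "lie_center (gr_Gamma G) = {\<one>\<^bsub>gr_Gamma G\<^esub>}"
    and "1 \<le> s" and g: "g \<in> carrier G" and gF: "inner_aut G g \<in> \<F> s"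
  shows "g \<in> \<Gamma> s"
proof -
  have "g \<in> \<Gamma> t" if "1 \<le> t" "t \<le> s" for t
    using that
  proof (induction t rule: dec_induct)
    case base
    then show ?case using g by simp
  next
    case (step t)
    then have gt: "g \<in> \<Gamma> t" by simp
    let ?h = "homog G \<Gamma> t g"
    have "bracket (gr_Gamma G) ?h y = \<one>\<^bsub>gr_Gamma G\<^esub>" if "y \<in> carrier (gr_Gamma G)" for y
      using that
    proof (induction y rule: LC.gr_induct)
      case (homog u x)
      have "commutator G g x \<in> \<Gamma> (s + u)"
        using displacement_mem_lower_central[OF gF homog] homog by (simp add: inner_aut_displacement[symmetric] lower_central_carrier)
      \<comment> \<open>As t < s, the degree s + u is beyond the degree t + u in which the bracket
        with the class of g lives.\<close>
      then have c: "commutator G g x \<in> \<Gamma> (Suc (t + u))"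
        by (rule LC.Phi_mono) (use step.prems in auto)
      have tu: "1 \<le> t + u" using homog by simp
      have c': "commutator G g x \<in> \<Gamma> (t + u)" using c lower_central_Suc_subset by blast
      have "gr_class G \<Gamma> (t + u) (commutator G g x) = gr_class G \<Gamma> (t + u) \<one>"
        using LC.gr_class_eq_one_iff[OF tu c'] c LC.gr_class_one[OF tu] by simp
      then have "homog G \<Gamma> (t + u) (commutator G g x) = homog G \<Gamma> (t + u) \<one>"
        by (rule LC.homog_class_cong)
      then show ?case
        using step.hyps gt homog tu by (simp add: LC.bracket_gr_homog LC.homog_one)
    next
      case (mult y z)
      then show ?case using LC.homog_closed[OF _ gt] step.hyps by (simp add: L.bracket_add_right)
    qed
    then have "?h \<in> lie_center (gr_Gamma G)"
      using LC.homog_closed[OF _ gt] step.hyps by (simp add: lie_center_def)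
    then have "?h = homog G \<Gamma> t \<one>" using center step.hyps by (simp add: LC.homog_one)
    then have "g \<otimes> inv \<one> \<in> \<Gamma> (Suc t)"
      using LC.homog_eq_iff[OF _ gt LC.Phi_one] step.hyps by blast
    then show ?case using g by (simp del: lower_central.simps)
  qed
  then show ?thesis using \<open>1 \<le> s\<close> by blast
qed

text \<open>With c_g for conjugation by g, vanishing in degree s gives \<alpha> = c_g \<beta> with
  \<beta> in step s + 1. Hence c_g lies in step s, and the hypothesis on the centre moves g into
  \<open>lower_central G s\<close>; since \<alpha> c_g^-1 is a conjugate of \<beta>, the classes of
  \<alpha> and c_g agree.\<close>

lemma gr_class_inner_if_gr_proj_eq_one:
  assumes center: "lie_center (gr_Gamma G) = {\<one>\<^bsub>gr_Gamma G\<^esub>}"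
    and f: "f \<in> carrier (gr_F G)" and f1: "gr_proj G f = \<one>\<^bsub>gr_outer_F G\<^esub>" and s: "1 \<le> s"
  obtains g where "g \<in> \<Gamma> s"
    "f s = gr_class \<A> \<F> s (inner_aut G g)"
proof -
  obtain \<alpha> where \<alpha>: "\<alpha> \<in> \<F> s" and fs: "f s = gr_class \<A> \<F> s \<alpha>"
    using F.gr_apply_closed[OF f s] by (auto simp: F.carrier_gr_degree)
  have "gr_class (Out G) \<O> s (Out_proj G \<alpha>) = gr_proj G f s"
    using s out.Union_gr_class_hom[OF s \<alpha>] by (simp add: gr_proj_def fs)
  also have "\<dots> = \<one>\<^bsub>gr_degree (Out G) \<O> s\<^esub>"
    using s by (simp add: f1 O.one_gr)
  finally have "Out_proj G \<alpha> \<in> \<O> (Suc s)"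
    using O.gr_class_eq_one_iff[OF s out.filtered[OF s \<alpha>]] by blast
  then obtain \<beta> where \<beta>: "\<beta> \<in> \<F> (Suc s)" and eq: "Out_proj G \<alpha> = Out_proj G \<beta>"
    by (auto simp: outer_johnson_filtration_def)
  have A: "\<alpha> \<in> carrier \<A>" and B: "\<beta> \<in> carrier \<A>"
    using \<alpha> \<beta> johnson_filtrationD by auto
  obtain g where g: "g \<in> carrier G" and \<alpha>g: "\<alpha> = inner_aut G g \<otimes>\<^bsub>\<A>\<^esub> \<beta>"
    using eq Out_proj_eq_iff[OF A B] by blast
  have "inner_aut G g = \<alpha> \<otimes>\<^bsub>\<A>\<^esub> inv\<^bsub>\<A>\<^esub> \<beta>"
    using g B by (simp add: \<alpha>g F.m_assoc)
  also have "\<dots> \<in> \<F> s"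
    using \<beta> F.Phi_Suc[OF s] by (intro F.Phi_mult[OF s \<alpha>] F.Phi_inv[OF s]) blast
  finally have gF: "inner_aut G g \<in> \<F> s" .
  have "\<alpha> \<otimes>\<^bsub>\<A>\<^esub> inv\<^bsub>\<A>\<^esub> inner_aut G g \<in> \<F> (Suc s)"
    unfolding \<alpha>g using g by (intro johnson_filtration_conj[OF _ \<beta>]) simp
  then have "gr_class \<A> \<F> s \<alpha> = gr_class \<A> \<F> s (inner_aut G g)"
    using F.gr_class_eq_iff[OF s \<alpha> gF] by blast
  then show thesis
    using that[OF mem_lower_central_if_inner_aut[OF center s g gF]] by (simp add: fs)
qed

text \<open>The kernel comparison behind the induced map. From left to right, the elements g of the
  separate degrees are assembled into one y with J f = ad y; from right to left, injectivity of J
  forces f to be the image of y, which dies in the outer algebra.\<close>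

lemma gr_proj_eq_one_iff:
  assumes center: "lie_center (gr_Gamma G) = {\<one>\<^bsub>gr_Gamma G\<^esub>}" and f: "f \<in> carrier (gr_F G)"
  shows "gr_proj G f = \<one>\<^bsub>gr_outer_F G\<^esub> \<longleftrightarrow> johnson G f \<in> ad (gr_Gamma G) ` carrier (gr_Gamma G)"
proof
  assume f1: "gr_proj G f = \<one>\<^bsub>gr_outer_F G\<^esub>"
  \<comment> \<open>Normalising g to the unit wherever \<open>f s\<close> is trivial gives the
    family y finite support.\<close>
  have "\<exists>g. g \<in> \<Gamma> s \<and> f s = gr_class \<A> \<F> s (inner_aut G g)
      \<and> (f s = \<one>\<^bsub>gr_degree \<A> \<F> s\<^esub> \<longrightarrow> g = \<one>)" if s: "1 \<le> s" for s
  proof (cases "f s = \<one>\<^bsub>gr_degree \<A> \<F> s\<^esub>")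
    case True
    then show ?thesis
      using s LC.Phi_one[OF s] group_hom.hom_one[OF inner_aut_hom] F.gr_class_one[OF s] by auto
  next
    case False
    then show ?thesis using gr_class_inner_if_gr_proj_eq_one[OF center f f1 s] by metis
  qed
  then obtain g where g: "\<And>s. 1 \<le> s \<Longrightarrow> g s \<in> \<Gamma> s"
    "\<And>s. 1 \<le> s \<Longrightarrow> f s = gr_class \<A> \<F> s (inner_aut G (g s))"
    "\<And>s. \<lbrakk>1 \<le> s; f s = \<one>\<^bsub>gr_degree \<A> \<F> s\<^esub>\<rbrakk> \<Longrightarrow> g s = \<one>"
    by metis
  define y where "y = (\<lambda>s\<in>{1..}. gr_class G \<Gamma> s (g s))"
  have "finite {s \<in> {1..}. y s \<noteq> \<one>\<^bsub>gr_degree G \<Gamma> s\<^esub>}"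
    by (rule finite_subset[of _ "{s \<in> {1..}. f s \<noteq> \<one>\<^bsub>gr_degree \<A> \<F> s\<^esub>}"])
      (use f g(3) LC.gr_class_one in \<open>auto simp: y_def F.carrier_gr\<close>)
  then have y: "y \<in> carrier (gr_Gamma G)"
    using g(1) LC.gr_class_closed by (auto simp: LC.carrier_gr y_def)
  have "f = gr_inner y"
  proof (rule F.gr_eqI[OF f inn.gr_map_closed[OF y]])
    fix s :: nat assume s: "1 \<le> s"
    then show "f s = gr_inner y s"
      using inn.Union_gr_class_hom[OF s g(1)[OF s]] g(2)[OF s] by (simp add: gr_map_def y_def)
  qed
  then show "johnson G f \<in> ad (gr_Gamma G) ` carrier (gr_Gamma G)"
    using johnson_gr_inner[OF y] y by simp
next
  assume "johnson G f \<in> ad (gr_Gamma G) ` carrier (gr_Gamma G)"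
  then obtain y where y: "y \<in> carrier (gr_Gamma G)" and "johnson G f = ad (gr_Gamma G) y" by blast
  then have eq: "johnson G f = johnson G (gr_inner y)" by (simp add: johnson_gr_inner)
  interpret J: group_hom "gr_F G" "Der (gr_Gamma G)" "johnson G"
    using LF.is_group D.is_group graded_lie_algebra_hom.hom[OF graded_lie_algebra_hom_johnson]
    by (simp add: group_hom_def group_hom_axioms_def)
  have "inj_on (johnson G) (carrier (gr_F G))"
    unfolding J.inj_on_one_iff using johnson_eq_one by blast
  then have "f = gr_inner y" using eq f inn.gr_map_closed[OF y] by (rule inj_onD)
  then show "gr_proj G f = \<one>\<^bsub>gr_outer_F G\<^esub>" using gr_proj_gr_inner[OF y] by simp
qed

lemma component_gr_outer_F_subset:
  "1 \<le> s \<Longrightarrow> component (gr_outer_F G) s \<subseteq> gr_proj G ` component (gr_F G) s"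
  by (auto simp: O.component_gr F.component_gr gr_proj_eq_gr_map outer_johnson_filtration_def image_iff
      out.gr_map_homog intro!: bexI)

lemma gr_proj_surj: "gr_proj G ` carrier (gr_F G) = carrier (gr_outer_F G)"
proof
  show "gr_proj G ` carrier (gr_F G) \<subseteq> carrier (gr_outer_F G)"
    unfolding gr_proj_eq_gr_map using out.gr_map_closed by blast
  show "carrier (gr_outer_F G) \<subseteq> gr_proj G ` carrier (gr_F G)"
  proof
    fix z assume "z \<in> carrier (gr_outer_F G)"
    then show "z \<in> gr_proj G ` carrier (gr_F G)"
    proof (induction rule: LO.graded_induct)
      case one
      have "gr_proj G (homog \<A> \<F> 1 \<one>\<^bsub>\<A>\<^esub>) = \<one>\<^bsub>gr_outer_F G\<^esub>"
        by (simp add: gr_proj_eq_gr_map out.gr_map_homog out.hom_one O.homog_one)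
      then show ?case using F.homog_closed[of 1 "\<one>\<^bsub>\<A>\<^esub>"] by (metis F.Phi_one image_eqI order_refl)
    next
      case (component s x)
      then show ?case using component_gr_outer_F_subset LF.component_closed by blast
    next
      case (mult x y)
      then obtain f g where "f \<in> carrier (gr_F G)" "g \<in> carrier (gr_F G)" "x = gr_proj G f" "y = gr_proj G g" by blast
      then have "x \<otimes>\<^bsub>gr_outer_F G\<^esub> y = gr_proj G (f \<otimes>\<^bsub>gr_F G\<^esub> g)" "f \<otimes>\<^bsub>gr_F G\<^esub> g \<in> carrier (gr_F G)"
        by (simp_all add: gr_proj_eq_gr_map out.gr_map_mult)
      then show ?case by blast
    qed
  qed
qed

subsection \<open>Equivariance\<close>

lemma inner_aut_AutoGroup_filtered_hom:
  assumes "\<sigma> \<in> carrier \<A>"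
  shows "filtered_hom \<A> \<F> \<A> \<F> (inner_aut \<A> \<sigma>)"
  using assms johnson_filtration_conj johnson_filtrationD
  by (intro filtered_hom.intro filtered_hom_axioms.intro F.N_series_axioms F.aut_hom F.inner_aut_closed)
    (auto simp: F.inner_aut_apply)

lemma aut_filtered_hom:
  assumes "\<sigma> \<in> carrier \<A>"
  shows "filtered_hom G \<Gamma> G \<Gamma> \<sigma>"
  using assms aut_lower_central
  by (intro filtered_hom.intro filtered_hom_axioms.intro LC.N_series_axioms aut_hom) auto

lemma aut_ab_eq: "aut_ab G = \<A> Mod \<F> 1"
  by (simp add: aut_ab_def gr_degree_def johnson_filtration_0 One_nat_def)

lemma johnson_filtration_normal: "\<F> s \<lhd> \<A>"
  unfolding F.normal_inv_iff using johnson_filtration_subgroup johnson_filtration_conj by blast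

lemma carrier_aut_ab: "carrier (aut_ab G) = (\<lambda>\<sigma>. \<F> 1 #>\<^bsub>\<A>\<^esub> \<sigma>) ` carrier \<A>"
  by (simp add: aut_ab_eq carrier_FactGroup)

lemma inv_aut_ab:
  assumes "\<sigma> \<in> carrier \<A>"
  shows "inv\<^bsub>aut_ab G\<^esub> (\<F> 1 #>\<^bsub>\<A>\<^esub> \<sigma>)
    = \<F> 1 #>\<^bsub>\<A>\<^esub> inv\<^bsub>\<A>\<^esub> \<sigma>"
proof -
  interpret group_hom "\<A>" "aut_ab G" "\<lambda>\<sigma>. \<F> 1 #>\<^bsub>\<A>\<^esub> \<sigma>"
    unfolding aut_ab_eq
    by (intro group_hom.intro group_hom_axioms.intro AutoGroup normal.factorgroup_is_group
        normal.r_coset_hom_Mod johnson_filtration_normal)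
  show ?thesis using hom_inv[OF assms] by simp
qed

text \<open>Two representatives differ by an element of the Torelli group, whose displacements on
  term t lie in term t + 1; hence any single representative computes the action.\<close>

lemma act_gr_Gamma_eq:
  assumes \<sigma>: "\<sigma> \<in> carrier \<A>" and y: "y \<in> carrier (gr_Gamma G)"
  shows "act_gr_Gamma G (\<F> 1 #>\<^bsub>\<A>\<^esub> \<sigma>) y = gr_map G \<Gamma> \<sigma> y"
  unfolding act_gr_Gamma_def gr_map_def
proof (rule restrict_ext)
  let ?S = "\<F> 1 #>\<^bsub>\<A>\<^esub> \<sigma>"
  fix t :: nat assume "t \<in> {1..}"
  then have t: "1 \<le> t" by simp
  obtain x where x: "x \<in> \<Gamma> t" and yt: "y t = gr_class G \<Gamma> t x"
    using LC.gr_apply_closed[OF y t] by (auto simp: LC.carrier_gr_degree)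
  have *: "(\<Union>z\<in>y t. \<Gamma> (Suc t) #> \<tau> z) = gr_class G \<Gamma> t (\<tau> x)"
    if "\<tau> \<in> carrier \<A>" for \<tau>
    unfolding yt by (rule filtered_hom.Union_gr_class_hom[OF aut_filtered_hom[OF that] t x])
  have "gr_class G \<Gamma> t (\<tau> x) = gr_class G \<Gamma> t (\<sigma> x)" and "\<tau> \<in> carrier \<A>"
    if \<tau>: "\<tau> \<in> ?S" for \<tau>
  proof -
    obtain \<phi> where \<phi>: "\<phi> \<in> \<F> 1" and \<tau>\<phi>: "\<tau> = \<phi> \<otimes>\<^bsub>\<A>\<^esub> \<sigma>"
      using \<tau> by (auto simp: r_coset_def)
    have P: "\<phi> \<in> carrier \<A>" using \<phi> by (rule johnson_filtrationD)
    show "\<tau> \<in> carrier \<A>" using P \<sigma> by (simp add: \<tau>\<phi>)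
    have \<sigma>x: "\<sigma> x \<in> \<Gamma> t" using aut_lower_central[OF \<sigma> x] .
    have "\<phi> (\<sigma> x) \<otimes> inv (\<sigma> x) \<in> \<Gamma> (1 + t)"
      using displacement_mem_lower_central[OF \<phi> t \<sigma>x] .
    then show "gr_class G \<Gamma> t (\<tau> x) = gr_class G \<Gamma> t (\<sigma> x)"
      using LC.gr_class_eq_iff[OF t aut_lower_central[OF P \<sigma>x] \<sigma>x] lower_central_carrier[OF x] P \<sigma>
      by (simp add: \<tau>\<phi> Suc_eq_plus1_left[of t])
  qed
  then have "\<And>\<tau>. \<tau> \<in> ?S \<Longrightarrow> (\<Union>z\<in>y t. \<Gamma> (Suc t) #> \<tau> z) = gr_class G \<Gamma> t (\<sigma> x)"
    using * by simp
  moreover have "\<sigma> \<in> ?S"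
    using \<sigma> johnson_filtration_subgroup by (rule F.rcos_self)
  ultimately have "(\<Union>\<tau>\<in>?S. \<Union>z\<in>y t. \<Gamma> (Suc t) #> \<tau> z) = gr_class G \<Gamma> t (\<sigma> x)"
    by blast
  then show "(\<Union>\<tau>\<in>?S. \<Union>z\<in>y t. \<Gamma> (Suc t) #> \<tau> z) = (\<Union>z\<in>y t. \<Gamma> (Suc t) #> \<sigma> z)"
    using *[OF \<sigma>] by simp
qed

text \<open>Equivariance of J before passing to quotients. On homogeneous elements it is the
  identity \<sigma>(\<alpha>(\<sigma>^-1 x)) x^-1 = \<sigma>(\<alpha>(z) z^-1) with z = \<sigma>^-1
  x.\<close>

lemma act_Der_johnson:
  assumes \<sigma>: "\<sigma> \<in> carrier \<A>" and f: "f \<in> carrier (gr_F G)"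
  shows "act_Der G (\<F> 1 #>\<^bsub>\<A>\<^esub> \<sigma>) (johnson G f)
    = johnson G (gr_map \<A> \<F> (inner_aut \<A> \<sigma>) f)"
  unfolding act_Der_def johnson_eq[of "gr_map \<A> \<F> (inner_aut \<A> \<sigma>) f"]
proof (rule restrict_ext)
  let ?i = "inv\<^bsub>\<A>\<^esub> \<sigma>"
  have i: "?i \<in> carrier \<A>" using \<sigma> by simp
  interpret \<sigma>: filtered_hom G "\<Gamma>" G "\<Gamma>" \<sigma> using \<sigma> by (rule aut_filtered_hom)
  interpret i: filtered_hom G "\<Gamma>" G "\<Gamma>" ?i using i by (rule aut_filtered_hom)
  interpret c: filtered_hom "\<A>" "\<F>" "\<A>" "\<F>" "inner_aut \<A> \<sigma>"
    using \<sigma> by (rule inner_aut_AutoGroup_filtered_hom)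
  let ?c = "gr_map \<A> \<F> (inner_aut \<A> \<sigma>)"
  let ?\<sigma> = "gr_map G \<Gamma> \<sigma>" and ?\<iota> = "gr_map G \<Gamma> ?i"
  fix y assume y: "y \<in> carrier (gr_Gamma G)"
  have "?\<sigma> (disp.conv f (?\<iota> y)) = disp.conv (?c f) y"
    using f y
  proof (induction f rule: F.gr_induct)
    case \<alpha>: (homog s \<alpha>)
    let ?f = "homog \<A> \<F> s \<alpha>"
    have f: "?f \<in> carrier (gr_F G)" using \<alpha>(1,2) by (rule F.homog_closed)
    have A: "\<alpha> \<in> carrier \<A>" using \<alpha>(2) by (rule johnson_filtrationD)
    have c: "\<sigma> \<otimes>\<^bsub>\<A>\<^esub> \<alpha> \<otimes>\<^bsub>\<A>\<^esub> ?i \<in> \<F> s"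
      using \<sigma> \<alpha>(2) by (rule johnson_filtration_conj)
    from \<alpha>(3) show ?case
    proof (induction y rule: LC.gr_induct)
      case x: (homog t x)
      have xc: "x \<in> carrier G" using x(2) by (rule lower_central_carrier)
      have ix: "?i x \<in> \<Gamma> t" using aut_lower_central[OF i x(2)] .
      have "\<alpha> (?i x) \<otimes> inv (?i x) \<in> \<Gamma> (s + t)"
        using displacement_mem_lower_central[OF \<alpha>(2) x(1) ix] .
      then show ?case
        using \<alpha>(1,2) x ix c A \<sigma> xc
        by (simp add: i.gr_map_homog c.gr_map_homog F.inner_aut_apply disp.conv_homog \<sigma>.gr_map_homog)
    next
      case (mult y z)
      then show ?case
        using f by (simp add: i.gr_map_mult i.gr_map_closed c.gr_map_closed disp.conv_mult_right disp.conv_closed \<sigma>.gr_map_mult)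
    qed
  next
    case (mult f f')
    then show ?case
      by (simp add: i.gr_map_closed c.gr_map_closed c.gr_map_mult disp.conv_mult_left disp.conv_closed \<sigma>.gr_map_mult)
  qed
  moreover have iy: "?\<iota> y \<in> carrier (gr_Gamma G)" using y by (rule i.gr_map_closed)
  moreover have "disp.conv f (?\<iota> y) \<in> carrier (gr_Gamma G)" using f iy by (rule disp.conv_closed)
  ultimately show "act_gr_Gamma G (\<F> 1 #>\<^bsub>\<A>\<^esub> \<sigma>) (johnson G f
      (act_gr_Gamma G (inv\<^bsub>aut_ab G\<^esub> (\<F> 1 #>\<^bsub>\<A>\<^esub> \<sigma>)) y)) = disp.conv (?c f) y"
    using \<sigma> i y by (simp add: inv_aut_ab act_gr_Gamma_eq johnson_apply)
qed

text \<open>Two choices must be shown immaterial: \<tau> = \<phi> \<sigma> with \<phi> in the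
  Torelli group, and a representative of the outer class, which is the image of \<beta> \<alpha>
  with \<beta> in step s + 1. After conjugation by \<sigma>, \<beta> is still in step s + 1, and
  conjugation by \<phi> is trivial in degree s.\<close>

lemma act_gr_outer_F_gr_proj:
  assumes \<sigma>: "\<sigma> \<in> carrier \<A>" and f: "f \<in> carrier (gr_F G)"
  shows "act_gr_outer_F G (\<F> 1 #>\<^bsub>\<A>\<^esub> \<sigma>) (gr_proj G f)
    = gr_proj G (gr_map \<A> \<F> (inner_aut \<A> \<sigma>) f)"
  unfolding act_gr_outer_F_def gr_proj_def[of G "gr_map \<A> \<F> (inner_aut \<A> \<sigma>) f"]
proof (rule restrict_ext)
  let ?S = "\<F> 1 #>\<^bsub>\<A>\<^esub> \<sigma>"
  interpret c: filtered_hom "\<A>" "\<F>" "\<A>" "\<F>" "inner_aut \<A> \<sigma>"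
    using \<sigma> by (rule inner_aut_AutoGroup_filtered_hom)
  let ?c = "gr_map \<A> \<F> (inner_aut \<A> \<sigma>)"
  let ?P = "Out_proj G" and ?O = "\<O>" and ?F = "\<F>"
  fix s :: nat assume "s \<in> {1..}"
  then have s: "1 \<le> s" by simp
  obtain \<alpha> where \<alpha>: "\<alpha> \<in> ?F s" and fs: "f s = gr_class \<A> ?F s \<alpha>"
    using F.gr_apply_closed[OF f s] by (auto simp: F.carrier_gr_degree)
  have A: "\<alpha> \<in> carrier \<A>" using \<alpha> by (rule johnson_filtrationD)
  define \<alpha>' where "\<alpha>' = inner_aut \<A> \<sigma> \<alpha>"
  have \<alpha>': "\<alpha>' \<in> ?F s" unfolding \<alpha>'_def by (rule c.filtered[OF s \<alpha>])
  have "?c f s = gr_class \<A> ?F s \<alpha>'"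
    using s c.Union_gr_class_hom[OF s \<alpha>] by (simp add: gr_map_def fs \<alpha>'_def)
  then have rhs: "(\<Union>\<alpha>\<in>?c f s. ?O (Suc s) #>\<^bsub>Out G\<^esub> ?P \<alpha>) = gr_class (Out G) ?O s (?P \<alpha>')"
    using out.Union_gr_class_hom[OF s \<alpha>'] by simp
  have fs': "gr_proj G f s = gr_class (Out G) ?O s (?P \<alpha>)"
    using s out.Union_gr_class_hom[OF s \<alpha>] by (simp add: gr_proj_def fs)
  have const: "?O (Suc s) #>\<^bsub>Out G\<^esub> (?P \<tau> \<otimes>\<^bsub>Out G\<^esub> a \<otimes>\<^bsub>Out G\<^esub> inv\<^bsub>Out G\<^esub> ?P \<tau>) = gr_class (Out G) ?O s (?P \<alpha>')"
    if \<tau>: "\<tau> \<in> ?S" and a: "a \<in> gr_proj G f s" for \<tau> a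
  proof -
    obtain \<phi> where \<phi>: "\<phi> \<in> ?F 1" and \<tau>\<phi>: "\<tau> = \<phi> \<otimes>\<^bsub>\<A>\<^esub> \<sigma>"
      using \<tau> by (auto simp: r_coset_def)
    obtain \<beta> where \<beta>: "\<beta> \<in> ?F (Suc s)" and a\<beta>: "a = ?P \<beta> \<otimes>\<^bsub>Out G\<^esub> ?P \<alpha>"
      using a by (auto simp: fs' gr_class_def r_coset_def outer_johnson_filtration_def)
    have P: "\<phi> \<in> carrier \<A>" and B: "\<beta> \<in> carrier \<A>"
      using \<phi> \<beta> johnson_filtrationD by auto
    define \<beta>' where "\<beta>' = inner_aut \<A> \<sigma> \<beta>"
    have \<beta>': "\<beta>' \<in> ?F (Suc s)" unfolding \<beta>'_def by (rule c.filtered[OF _ \<beta>]) simp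
    have A': "\<alpha>' \<in> carrier \<A>" and B': "\<beta>' \<in> carrier \<A>"
      using \<alpha>' \<beta>' johnson_filtrationD by auto
    have \<beta>\<alpha>: "\<beta>' \<otimes>\<^bsub>\<A>\<^esub> \<alpha>' \<in> ?F s"
      using F.Phi_mult[OF s _ \<alpha>'] F.Phi_Suc[OF s] \<beta>' by blast
    have conj: "\<phi> \<otimes>\<^bsub>\<A>\<^esub> (\<beta>' \<otimes>\<^bsub>\<A>\<^esub> \<alpha>') \<otimes>\<^bsub>\<A>\<^esub> inv\<^bsub>\<A>\<^esub> \<phi> \<in> ?F s"
      using P \<beta>\<alpha> by (rule johnson_filtration_conj)
    have "?P \<tau> \<otimes>\<^bsub>Out G\<^esub> a \<otimes>\<^bsub>Out G\<^esub> inv\<^bsub>Out G\<^esub> ?P \<tau>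
        = ?P (\<tau> \<otimes>\<^bsub>\<A>\<^esub> (\<beta> \<otimes>\<^bsub>\<A>\<^esub> \<alpha>) \<otimes>\<^bsub>\<A>\<^esub> inv\<^bsub>\<A>\<^esub> \<tau>)"
      using \<sigma> P A B by (simp add: \<tau>\<phi> a\<beta>)
    also have "\<tau> \<otimes>\<^bsub>\<A>\<^esub> (\<beta> \<otimes>\<^bsub>\<A>\<^esub> \<alpha>) \<otimes>\<^bsub>\<A>\<^esub> inv\<^bsub>\<A>\<^esub> \<tau>
        = \<phi> \<otimes>\<^bsub>\<A>\<^esub> (\<beta>' \<otimes>\<^bsub>\<A>\<^esub> \<alpha>') \<otimes>\<^bsub>\<A>\<^esub> inv\<^bsub>\<A>\<^esub> \<phi>"
      using \<sigma> P A B by (simp add: \<tau>\<phi> \<beta>'_def \<alpha>'_def F.inner_aut_apply F.word_simps)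
    finally have e: "?P \<tau> \<otimes>\<^bsub>Out G\<^esub> a \<otimes>\<^bsub>Out G\<^esub> inv\<^bsub>Out G\<^esub> ?P \<tau>
        = ?P (\<phi> \<otimes>\<^bsub>\<A>\<^esub> (\<beta>' \<otimes>\<^bsub>\<A>\<^esub> \<alpha>') \<otimes>\<^bsub>\<A>\<^esub> inv\<^bsub>\<A>\<^esub> \<phi>)" .
    have "gr_class \<A> ?F s (\<phi> \<otimes>\<^bsub>\<A>\<^esub> (\<beta>' \<otimes>\<^bsub>\<A>\<^esub> \<alpha>') \<otimes>\<^bsub>\<A>\<^esub> inv\<^bsub>\<A>\<^esub> \<phi>)
        = gr_class \<A> ?F s (\<beta>' \<otimes>\<^bsub>\<A>\<^esub> \<alpha>')"
      using F.gr_class_conj[OF _ s \<phi> \<beta>\<alpha>] by simp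
    also have "\<dots> = gr_class \<A> ?F s \<alpha>'"
      using F.gr_class_eq_iff[OF s \<beta>\<alpha> \<alpha>'] \<beta>' A' B' by (simp add: F.m_assoc)
    finally have "gr_class (Out G) ?O s (?P (\<phi> \<otimes>\<^bsub>\<A>\<^esub> (\<beta>' \<otimes>\<^bsub>\<A>\<^esub> \<alpha>') \<otimes>\<^bsub>\<A>\<^esub> inv\<^bsub>\<A>\<^esub> \<phi>))
        = gr_class (Out G) ?O s (?P \<alpha>')"
      using out.Union_gr_class_hom[OF s conj] out.Union_gr_class_hom[OF s \<alpha>'] by simp
    then show ?thesis unfolding e by (simp only: gr_class_def[of "Out G"])
  qed
  have "\<sigma> \<in> ?S" using \<sigma> johnson_filtration_subgroup by (rule F.rcos_self)
  moreover have "?P \<alpha> \<in> gr_proj G f s"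
    unfolding fs' gr_class_def using A O.subgroup_Phi[of "Suc s"] by (intro O.rcos_self) auto
  ultimately have "(\<Union>\<tau>\<in>?S. \<Union>a\<in>gr_proj G f s. ?O (Suc s) #>\<^bsub>Out G\<^esub> (?P \<tau> \<otimes>\<^bsub>Out G\<^esub> a \<otimes>\<^bsub>Out G\<^esub> inv\<^bsub>Out G\<^esub> ?P \<tau>))
      = gr_class (Out G) ?O s (?P \<alpha>')"
    using const by blast
  then show "(\<Union>\<tau>\<in>?S. \<Union>a\<in>gr_proj G f s. ?O (Suc s) #>\<^bsub>Out G\<^esub> (?P \<tau> \<otimes>\<^bsub>Out G\<^esub> a \<otimes>\<^bsub>Out G\<^esub> inv\<^bsub>Out G\<^esub> ?P \<tau>))
      = (\<Union>\<alpha>\<in>?c f s. ?O (Suc s) #>\<^bsub>Out G\<^esub> ?P \<alpha>)"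
    unfolding rhs .
qed

section \<open>The induced map on the outer graded Lie algebra\<close>

lemma outer_johnson_exists:
  assumes center: "lie_center (gr_Gamma G) = {\<one>\<^bsub>gr_Gamma G\<^esub>}"
  obtains Jt where "graded_lie_algebra_hom (gr_outer_F G) (outer_Der (gr_Gamma G)) Jt"
    "inj_on Jt (carrier (gr_outer_F G))"
    "\<And>f. f \<in> carrier (gr_F G) \<Longrightarrow> Jt (gr_proj G f) = outer_Der_proj (gr_Gamma G) (johnson G f)"
proof (rule graded_lie_algebra_hom_factor)
  show "graded_lie_algebra_hom (gr_F G) (gr_outer_F G) (gr_proj G)"
    unfolding gr_proj_eq_gr_map by (rule out.graded_lie_algebra_hom_gr_map)
  show "graded_lie_algebra_hom (gr_F G) (outer_Der (gr_Gamma G)) (\<lambda>f. outer_Der_proj (gr_Gamma G) (johnson G f))"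
    using graded_lie_algebra_hom_johnson L.graded_lie_algebra_hom_outer_Der_proj
    by (rule graded_lie_algebra_hom_compose)
  show "gr_proj G f = \<one>\<^bsub>gr_outer_F G\<^esub> \<longleftrightarrow> outer_Der_proj (gr_Gamma G) (johnson G f) = \<one>\<^bsub>outer_Der (gr_Gamma G)\<^esub>"
    if "f \<in> carrier (gr_F G)" for f
    unfolding L.outer_Der_proj_eq_one_iff[OF johnson_closed[OF that]] by (rule gr_proj_eq_one_iff[OF center that])
qed (use gr_proj_surj component_gr_outer_F_subset that in auto)

text \<open>
  Every representative of the class of \<open>J f\<close> is again of the form \<open>J f'\<close> with \<open>f'\<close> and \<open>f\<close> having
  the same image in the outer graded Lie algebra, because inner derivations come from inner automorphisms.
\<close>

lemma act_outer_Der_eq: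
  assumes Jt: "\<And>f. f \<in> carrier (gr_F G) \<Longrightarrow> Jt (gr_proj G f) = outer_Der_proj (gr_Gamma G) (johnson G f)"
    and S: "S \<in> carrier (aut_ab G)" and z: "z \<in> carrier (gr_outer_F G)"
  shows "Jt (act_gr_outer_F G S z) = act_outer_Der G S (Jt z)"
proof -
  obtain \<sigma> where \<sigma>: "\<sigma> \<in> carrier \<A>" and S: "S = \<F> 1 #>\<^bsub>\<A>\<^esub> \<sigma>"
    using S by (auto simp: carrier_aut_ab)
  obtain f where f: "f \<in> carrier (gr_F G)" and zf: "z = gr_proj G f"
    using z unfolding gr_proj_surj[symmetric] by blast
  interpret c: filtered_hom "\<A>" "\<F>" "\<A>" "\<F>" "inner_aut \<A> \<sigma>"
    using \<sigma> by (rule inner_aut_AutoGroup_filtered_hom)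
  have const: "outer_Der_proj (gr_Gamma G) (act_Der G S \<delta>) = Jt (act_gr_outer_F G S z)" if "\<delta> \<in> Jt z" for \<delta>
  proof -
    from that obtain y where y: "y \<in> carrier (gr_Gamma G)"
      and \<delta>: "\<delta> = ad (gr_Gamma G) y \<otimes>\<^bsub>Der (gr_Gamma G)\<^esub> johnson G f"
      by (auto simp: zf Jt[OF f] outer_Der_proj_def r_coset_def)
    define f' where "f' = gr_inner y \<otimes>\<^bsub>gr_F G\<^esub> f"
    have f': "f' \<in> carrier (gr_F G)" unfolding f'_def using inn.gr_map_closed[OF y] f by simp
    have "\<delta> = johnson G f'"
      unfolding f'_def \<delta> using inn.gr_map_closed[OF y] f by (simp add: johnson_mult johnson_gr_inner[OF y])
    moreover have "gr_proj G f' = z"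
      using inn.gr_map_closed[OF y] f gr_proj_gr_inner[OF y] z
      by (simp add: f'_def zf gr_proj_eq_gr_map out.gr_map_mult)
    ultimately show ?thesis
      using Jt[OF c.gr_map_closed[OF f']] act_Der_johnson[OF \<sigma> f'] act_gr_outer_F_gr_proj[OF \<sigma> f']
      by (simp add: S)
  qed
  \<comment> \<open>Makes the union in \<open>act_outer_Der\<close> nonempty, so that it equals the
    constant value of its members.\<close>
  have "johnson G f \<in> Jt z"
    unfolding zf Jt[OF f] outer_Der_proj_def
    using johnson_closed[OF f] homogeneous_ideal.ideal_subgroup[OF L.homogeneous_ideal_ad] by (rule D.rcos_self)
  then show ?thesis unfolding act_outer_Der_def using const by blast
qed

end

theorem theorem4p3:
  fixes G :: "('a, 'm) monoid_scheme"
  assumes "group G"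
    and "lie_center (gr_Gamma G) = {\<one>\<^bsub>gr_Gamma G\<^esub>}"
  shows "\<exists>Jt. graded_lie_algebra_hom (gr_outer_F G) (outer_Der (gr_Gamma G)) Jt \<and>
    inj_on Jt (carrier (gr_outer_F G)) \<and>
    (\<forall>f\<in>carrier (gr_F G). Jt (gr_proj G f) = outer_Der_proj (gr_Gamma G) (johnson G f)) \<and>
    (\<forall>S\<in>carrier (aut_ab G). \<forall>f\<in>carrier (gr_outer_F G).
      Jt (act_gr_outer_F G S f) = act_outer_Der G S (Jt f))"
proof -
  interpret group G by fact
  obtain Jt where "graded_lie_algebra_hom (gr_outer_F G) (outer_Der (gr_Gamma G)) Jt"
    "inj_on Jt (carrier (gr_outer_F G))"
    and Jt: "\<And>f. f \<in> carrier (gr_F G) \<Longrightarrow> Jt (gr_proj G f) = outer_Der_proj (gr_Gamma G) (johnson G f)"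
    using outer_johnson_exists[OF assms(2)] by blast
  then show ?thesis
    using act_outer_Der_eq[of Jt, OF Jt] by (intro exI[of _ Jt]) auto
qed

end
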